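(* Let $0<\omega<\infty$ and let $\alpha\in\mathbb{C}$ with $\Re\alpha=0$, $\alpha\neq0$. Let $B_\alpha=J^{-\alpha}QJ^{\alpha}$ on $L^2(0,\omega)$ and put $W_0(t)=|t|^{\alpha}I$ for $t\ne0$. Then the generalized wave operators $$W_\pm(B_\alpha,Q)=\lim_{t\to\pm\infty}\bigl(e^{iB_\alpha t}e^{-iQt}W_0(t)\bigr)$$ (strong limits) exist and $$W_\pm(B_\alpha,Q)=e^{\pm i\alpha\pi/2}J^{-\alpha}.$$
   Context: $Q$ is multiplication by the independent variable on $L^2(0,\omega)$: $(Qf)(x)=xf(x)$. For $\Re\beta>0$, $J^\beta$ is the fractional integral operator $(J^\beta f)(x)=\frac{1}{\Gamma(\beta)}\int_0^x(x-t)^{\beta-1}f(t)\,dt$ on $L^2(0,\omega)$. For $\Re\alpha=0$, $J^\alpha$ is the bounded operator on $L^2(0,\omega)$ given by $(J^\alpha f)(x)=\frac{1}{\Gamma(\alpha+1)}\frac{d}{dx}\int_0^x(x-t)^{\alpha}f(t)\,dt$ (equivalently, the strong limit of $J^{\alpha+\nu}$ as $\nu\to+0$); its bounded inverse is $J^{-\alpha}$. It is known that $B_\alpha$ has the explicit form $(B_\alpha f)(x)=xf(x)+\alpha\int_0^xf(y)\,dy$. Generalized wave operators: let $A$ and $A_0$ act in a Hilbert space $H$, with $A_0$ self-adjoint with absolutely continuous spectrum. Suppose $W_0(t)$ is a unitary operator function such that (1) the strong limits $W_\pm(A,A_0)=\lim_{t\to\pm\infty}(e^{iAt}e^{-iA_0t}W_0(t))$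 exist; (2) $\lim_{t\to\pm\infty}W_0^{-1}(t+\tau)W_0(t)=I$ for every $\tau$; (3) $W_0(t)A_0=A_0W_0(t)$ and $W_0(t)W_0(t+\tau)=W_0(t+\tau)W_0(t)$ for all $t,\tau$. Then $W_\pm(A,A_0)$ are called generalized wave operators. Only the values of $W_0(t)$ for large $|t|$ matter for the limits. *)

theory Defs
  imports "HOL-Analysis.Analysis"
begin

text \<open>
  Elements of \<open>L\<^sup>2(M)\<close> are represented by functions, equality being equality almost
  everywhere; operators act on representatives.
\<close>

type_synonym 'a fop = "('a \<Rightarrow> complex) \<Rightarrow> ('a \<Rightarrow> complex)"

definition L2 :: "'a measure \<Rightarrow> ('a \<Rightarrow> complex) set" where
  "L2 M = {f \<in> borel_measurable M. integrable M (\<lambda>x. (norm (f x))\<^sup>2)}"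

definition L2_inner :: "'a measure \<Rightarrow> ('a \<Rightarrow> complex) \<Rightarrow> ('a \<Rightarrow> complex) \<Rightarrow> complex" where
  "L2_inner M f g = (LINT x|M. f x * cnj (g x))"

definition L2_norm :: "'a measure \<Rightarrow> ('a \<Rightarrow> complex) \<Rightarrow> real" where
  "L2_norm M f = sqrt (LINT x|M. (norm (f x))\<^sup>2)"

text \<open>
  The membership conditions are needed since the Bochner integral of a non-integrable
  function is \<open>0\<close>.
\<close>

definition L2_tendsto ::
  "'a measure \<Rightarrow> ('b \<Rightarrow> 'a \<Rightarrow> complex) \<Rightarrow> ('a \<Rightarrow> complex) \<Rightarrow> 'b filter \<Rightarrow> bool" where
  "L2_tendsto M g l F \<longleftrightarrow>
     l \<in> L2 M \<and> (\<forall>\<^sub>F t in F. g t \<in> L2 M) \<and>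
     ((\<lambda>t. L2_norm M (\<lambda>x. g t x - l x)) \<longlongrightarrow> 0) F"

definition strong_limit :: "'a measure \<Rightarrow> ('b \<Rightarrow> 'a fop) \<Rightarrow> 'a fop \<Rightarrow> 'b filter \<Rightarrow> bool" where
  "strong_limit M T W F \<longleftrightarrow> (\<forall>f\<in>L2 M. L2_tendsto M (\<lambda>t. T t f) (W f) F)"

definition op_eq :: "'a measure \<Rightarrow> 'a fop \<Rightarrow> 'a fop \<Rightarrow> bool" where
  "op_eq M A B \<longleftrightarrow> (\<forall>f\<in>L2 M. AE x in M. A f x = B f x)"

definition bounded_op :: "'a measure \<Rightarrow> 'a fop \<Rightarrow> bool" where
  "bounded_op M A \<longleftrightarrow>
     (\<forall>f\<in>L2 M. A f \<in> L2 M) \<and>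
     (\<forall>f\<in>L2 M. \<forall>g\<in>L2 M. (AE x in M. f x = g x) \<longrightarrow> (AE x in M. A f x = A g x)) \<and>
     (\<forall>f\<in>L2 M. \<forall>g\<in>L2 M. AE x in M. A (\<lambda>y. f y + g y) x = A f x + A g x) \<and>
     (\<forall>c. \<forall>f\<in>L2 M. AE x in M. A (\<lambda>y. c * f y) x = c * A f x) \<and>
     (\<exists>K. \<forall>f\<in>L2 M. L2_norm M (A f) \<le> K * L2_norm M f)"

definition selfadjoint_op :: "'a measure \<Rightarrow> 'a fop \<Rightarrow> bool" where
  "selfadjoint_op M A \<longleftrightarrow>
     bounded_op M A \<and> (\<forall>f\<in>L2 M. \<forall>g\<in>L2 M. L2_inner M (A f) g = L2_inner M f (A g))"

definition unitary_op :: "'a measure \<Rightarrow> 'a fop \<Rightarrow> bool" where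
  "unitary_op M U \<longleftrightarrow>
     bounded_op M U \<and>
     (\<forall>f\<in>L2 M. \<forall>g\<in>L2 M. L2_inner M (U f) (U g) = L2_inner M f g) \<and>
     (\<forall>g\<in>L2 M. \<exists>f\<in>L2 M. AE x in M. U f x = g x)"

text \<open>
  Inverse and exponential choose a representative of an element of \<open>L\<^sup>2(M)\<close> which is unique
  up to null sets when the operator is invertible, respectively bounded.
\<close>

definition op_inv :: "'a measure \<Rightarrow> 'a fop \<Rightarrow> 'a fop" where
  "op_inv M U g = (SOME f. f \<in> L2 M \<and> (AE x in M. U f x = g x))"

definition op_exp :: "'a measure \<Rightarrow> 'a fop \<Rightarrow> 'a fop" where
  "op_exp M A f =
     (SOME g. L2_tendsto M (\<lambda>N x. \<Sum>n<N. (A ^^ n) f x / fact n) g sequentially)"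

definition op_scale :: "complex \<Rightarrow> 'a fop \<Rightarrow> 'a fop" where
  "op_scale c A f = (\<lambda>x. c * A f x)"

definition spectral_measure :: "'a measure \<Rightarrow> (real set \<Rightarrow> 'a fop) \<Rightarrow> bool" where
  "spectral_measure M E \<longleftrightarrow>
     (\<forall>S\<in>sets borel. selfadjoint_op M (E S)) \<and>
     (\<forall>S\<in>sets borel. \<forall>S'\<in>sets borel. op_eq M (E S \<circ> E S') (E (S \<inter> S'))) \<and>
     op_eq M (E UNIV) id \<and>
     (\<forall>S. range S \<subseteq> sets borel \<and> disjoint_family S \<longrightarrow>
        strong_limit M (\<lambda>N f x. \<Sum>n<N. E (S n) f x) (E (\<Union>n. S n)) sequentially)"

definition scalar_measure ::
  "'a measure \<Rightarrow> (real set \<Rightarrow> 'a fop) \<Rightarrow> ('a \<Rightarrow> complex) \<Rightarrow> real measure" where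
  "scalar_measure M E f =
     measure_of UNIV (sets borel) (\<lambda>S. ennreal (Re (L2_inner M (E S f) f)))"

text \<open>
  \<open>A = \<integral>\<lambda> dE(\<lambda>)\<close> in the weak sense for an everywhere defined \<open>A\<close>; by polarization the
  diagonal forms suffice.
\<close>

definition spectral_measure_of :: "'a measure \<Rightarrow> 'a fop \<Rightarrow> (real set \<Rightarrow> 'a fop) \<Rightarrow> bool" where
  "spectral_measure_of M A E \<longleftrightarrow>
     spectral_measure M E \<and>
     (\<forall>f\<in>L2 M. integrable (scalar_measure M E f) (\<lambda>s. s\<^sup>2) \<and>
        L2_inner M (A f) f = complex_of_real (LINT s|scalar_measure M E f. s))"

definition ac_spectrum :: "'a measure \<Rightarrow> 'a fop \<Rightarrow> bool" where
  "ac_spectrum M A \<longleftrightarrow>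
     (\<exists>E. spectral_measure_of M A E \<and>
        (\<forall>f\<in>L2 M. absolutely_continuous lborel (scalar_measure M E f)))"

text \<open>
  The definition is given for bounded \<open>A\<close> and \<open>A0\<close>. The operators \<open>Wp\<close> and \<open>Wm\<close> are
  determined up to \<^const>\<open>op_eq\<close>.
\<close>

definition generalized_wave_operators ::
  "'a measure \<Rightarrow> 'a fop \<Rightarrow> 'a fop \<Rightarrow> (real \<Rightarrow> 'a fop) \<Rightarrow> 'a fop \<Rightarrow> 'a fop \<Rightarrow> bool" where
  "generalized_wave_operators M A A0 W0 Wp Wm \<longleftrightarrow>
     bounded_op M A \<and> selfadjoint_op M A0 \<and> ac_spectrum M A0 \<and>
     (\<forall>t. unitary_op M (W0 t)) \<and>
     (let T = (\<lambda>t. op_exp M (op_scale (\<i> * of_real t) A) \<circ>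
                    op_exp M (op_scale (- \<i> * of_real t) A0) \<circ> W0 t)
      in strong_limit M T Wp at_top \<and> strong_limit M T Wm at_bot) \<and>
     (\<forall>\<tau>. strong_limit M (\<lambda>t. op_inv M (W0 (t + \<tau>)) \<circ> W0 t) id at_top \<and>
          strong_limit M (\<lambda>t. op_inv M (W0 (t + \<tau>)) \<circ> W0 t) id at_bot) \<and>
     (\<forall>t. op_eq M (W0 t \<circ> A0) (A0 \<circ> W0 t)) \<and>
     (\<forall>t \<tau>. op_eq M (W0 t \<circ> W0 (t + \<tau>)) (W0 (t + \<tau>) \<circ> W0 t))"

definition Q :: "real fop" where
  "Q f = (\<lambda>x. complex_of_real x * f x)"

text \<open>
  The operator \<open>J\<^sup>\<alpha>\<close> for \<open>Re \<alpha> = 0\<close>. For \<open>f\<close> in \<open>L\<^sup>2(0,\<omega>)\<close> the derivative exists at almost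
  every point of \<open>(0,\<omega>)\<close>; the value elsewhere is irrelevant. No dependence on \<open>\<omega>\<close>
  is needed, as the value at \<open>x\<close> only depends on \<open>f\<close> on a neighbourhood of \<open>{0<..x}\<close>.
\<close>

definition J :: "complex \<Rightarrow> real fop" where
  "J \<alpha> f = (\<lambda>x. 1 / Gamma (\<alpha> + 1) *
     vector_derivative (\<lambda>u. LINT t:{0<..<u}|lebesgue. complex_of_real (u - t) powr \<alpha> * f t) (at x))"

definition B :: "complex \<Rightarrow> real fop" where
  "B \<alpha> = J (- \<alpha>) \<circ> Q \<circ> J \<alpha>"

text \<open>
  \<open>|t|\<^sup>\<alpha> I\<close> for \<open>t \<noteq> 0\<close>. The value at \<open>t = 0\<close> does not influence the limits; the identity makes
  the family unitary everywhere.
\<close>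

definition W0 :: "complex \<Rightarrow> real \<Rightarrow> real fop" where
  "W0 \<alpha> t = (if t = 0 then id else op_scale (complex_of_real \<bar>t\<bar> powr \<alpha>) id)"

end

theory Submission
  imports Defs "HOL-Probability.Characteristic_Functions"
begin

text \<open>
  Since \<open>J\<^sup>-\<^sup>\<alpha>\<close> inverts \<open>J\<^sup>\<alpha>\<close>, one has \<open>exp(itB) = J\<^sup>-\<^sup>\<alpha> exp(itQ) J\<^sup>\<alpha>\<close>, so it suffices to show that
  \<open>|t|\<^sup>\<alpha> exp(itQ) J\<^sup>\<alpha> exp(-itQ)\<close> tends strongly to \<open>exp(\<plusminus>i\<alpha>\<pi>/2)\<close>. These operators are uniformly bounded,
  hence it is enough to consider the indicator of \<open>(a, \<omega>)\<close>, where the function obtained is explicitly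
  an incomplete Gamma integral \<open>\<Gamma>(\<alpha>)\<^sup>-\<^sup>1 |t|\<^sup>\<alpha> \<integral>\<^sub>0\<^sup>x\<^sup>-\<^sup>a w\<^sup>\<alpha>\<^sup>-\<^sup>1 exp(itw) dw\<close>.

  Boundedness of \<open>J\<^sup>\<alpha>\<close>: on a step function supported in \<open>(0, \<omega>)\<close> and after multiplication with
  \<open>exp(-x)\<close>, applying \<open>J\<^sup>\<alpha>\<close> multiplies the Fourier transform by \<open>(1 + i\<xi>)\<^sup>-\<^sup>\<alpha>\<close>, which is bounded by
  \<open>exp(\<pi>|\<alpha>|)\<close>. For general \<open>f\<close> one extends by density; that the extension is the pointwise derivative
  in the definition of \<open>J\<^sup>\<alpha>\<close> is Lebesgue's differentiation theorem.
\<close>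

section \<open>The space \<open>L\<^sup>2\<close>\<close>

text \<open>Conjugation by exp(itx) turns d/dx into d/dx - it, so exp(itQ) J^\<alpha> exp(-itQ) is
  formally (d/dx - it)^(-\<alpha>). Its leading term for large |t| is the scalar (-it)^(-\<alpha>):
  the factor |t|^\<alpha> removes the dependence on |t|, and the principal argument of -it, which is
  -pi/2 or pi/2, leaves the phase of the theorem. The obstacle is Re \<alpha> = 0: the kernel
  w^(\<alpha>-1) is not integrable at 0, so J^\<alpha> is a singular integral and no estimate by
  absolute values of the kernel bounds it. Identities are therefore proved one integration higher,
  for the kernel w^\<alpha> of modulus one, and are differentiated only at the end; the relation
  \<open>is_J\<close> and the function \<open>tgam\<close> are the two devices for this. The weight
  exp(-x) moves the transform variable from the imaginary axis to 1 + i\<xi>, where the Laplace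
  integral converges absolutely. It costs the factor exp \<omega> in the operator norm, finite
  because the interval is bounded.\<close>

lemma L2_I:
  "f \<in> borel_measurable M \<Longrightarrow> integrable M (\<lambda>x. (norm (f x))\<^sup>2) \<Longrightarrow> f \<in> L2 M"
  by (simp add: L2_def)

lemma L2_measurable: "f \<in> L2 M \<Longrightarrow> f \<in> borel_measurable M"
  by (simp add: L2_def)

lemma L2_integrable: "f \<in> L2 M \<Longrightarrow> integrable M (\<lambda>x. (norm (f x))\<^sup>2)"
  by (simp add: L2_def)

text \<open>The two sides differ by a perfect square over \<open>l * (1 - l)\<close>. With
  \<open>l\<close> proportional to the two norms, the integrated inequality becomes Minkowski's
  inequality in \<open>L2_norm_triangle\<close>.\<close>

lemma square_sum_le:
  fixes p q l :: real
  assumes "0 < l" "l < 1"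
  shows "(p + q)\<^sup>2 \<le> p\<^sup>2 / l + q\<^sup>2 / (1 - l)"
proof -
  have "p\<^sup>2 / l + q\<^sup>2 / (1 - l) - (p + q)\<^sup>2 = (p * (1 - l) - q * l)\<^sup>2 / (l * (1 - l))"
    using assms by (simp add: field_simps power2_eq_square)
  moreover have "\<dots> \<ge> 0" using assms by simp
  ultimately show ?thesis by linarith
qed

lemma norm_square_add_le:
  fixes a b :: "'a::real_normed_vector"
  assumes "0 < l" "l < 1"
  shows "(norm (a + b))\<^sup>2 \<le> (norm a)\<^sup>2 / l + (norm b)\<^sup>2 / (1 - l)"
proof -
  have "(norm (a + b))\<^sup>2 \<le> (norm a + norm b)\<^sup>2"
    by (intro power_mono norm_triangle_ineq) auto
  also note square_sum_le[OF assms]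
  finally show ?thesis .
qed

lemma L2_add:
  assumes "f \<in> L2 M" "g \<in> L2 M"
  shows "(\<lambda>x. f x + g x) \<in> L2 M"
proof (rule L2_I)
  note [measurable] = L2_measurable[OF assms(1)] L2_measurable[OF assms(2)]
  show "(\<lambda>x. f x + g x) \<in> borel_measurable M" by measurable
  show "integrable M (\<lambda>x. (norm (f x + g x))\<^sup>2)"
  proof (rule Bochner_Integration.integrable_bound)
    show "integrable M (\<lambda>x. (norm (f x))\<^sup>2 / (1/2) + (norm (g x))\<^sup>2 / (1/2))"
      using L2_integrable[OF assms(1)] L2_integrable[OF assms(2)] by simp
    show "AE x in M. norm ((norm (f x + g x))\<^sup>2)
        \<le> norm ((norm (f x))\<^sup>2 / (1/2) + (norm (g x))\<^sup>2 / (1/2))"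
      using norm_square_add_le[of "1/2" "f _" "g _"] by (intro AE_I2) simp
  qed measurable
qed

lemma L2_mult_bounded:
  assumes "f \<in> L2 M" "m \<in> borel_measurable M" "AE x in M. norm (m x) \<le> C"
  shows "(\<lambda>x. m x * f x) \<in> L2 M"
proof (rule L2_I)
  note [measurable] = L2_measurable[OF assms(1)] assms(2)
  show "(\<lambda>x. m x * f x) \<in> borel_measurable M" by measurable
  show "integrable M (\<lambda>x. (norm (m x * f x))\<^sup>2)"
  proof (rule Bochner_Integration.integrable_bound)
    show "integrable M (\<lambda>x. C\<^sup>2 * (norm (f x))\<^sup>2)"
      using L2_integrable[OF assms(1)] by simp
    show "AE x in M. norm ((norm (m x * f x))\<^sup>2) \<le> norm (C\<^sup>2 * (norm (f x))\<^sup>2)"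
      using assms(3)
      by eventually_elim (auto simp: norm_mult power_mult_distrib intro!: mult_right_mono power_mono)
  qed measurable
qed

lemma L2_cmult: "f \<in> L2 M \<Longrightarrow> (\<lambda>x. c * f x) \<in> L2 M"
  by (rule L2_mult_bounded[where C = "norm c"]) auto

lemma L2_diff: "f \<in> L2 M \<Longrightarrow> g \<in> L2 M \<Longrightarrow> (\<lambda>x. f x - g x) \<in> L2 M"
  using L2_add[of f M "\<lambda>x. (-1) * g x"] L2_cmult[of g M "-1"] by simp

lemma L2_zero: "(\<lambda>x. 0) \<in> L2 M"
  by (rule L2_I) auto

lemma L2_sum: "(\<And>i. i \<in> I \<Longrightarrow> f i \<in> L2 M) \<Longrightarrow> (\<lambda>x. \<Sum>i\<in>I. f i x) \<in> L2 M"
  by (induction I rule: infinite_finite_induct) (auto intro: L2_add L2_zero)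

lemma L2_norm_nonneg [simp]: "0 \<le> L2_norm M f"
  by (simp add: L2_norm_def)

lemma L2_norm_square: "(L2_norm M f)\<^sup>2 = (LINT x|M. (norm (f x))\<^sup>2)"
  by (simp add: L2_norm_def)

lemma L2_norm_zero [simp]: "L2_norm M (\<lambda>x. 0) = 0"
  by (simp add: L2_norm_def)

lemma L2_norm_cong_AE:
  assumes "f \<in> borel_measurable M" "g \<in> borel_measurable M" "AE x in M. f x = g x"
  shows "L2_norm M f = L2_norm M g"
proof -
  note [measurable] = assms(1,2)
  have "(LINT x|M. (norm (f x))\<^sup>2) = (LINT x|M. (norm (g x))\<^sup>2)"
    by (rule integral_cong_AE) (use assms(3) in auto)
  then show ?thesis by (simp add: L2_norm_def)
qed

lemma L2_norm_mono:
  assumes "f \<in> borel_measurable M" "g \<in> L2 M" "AE x in M. norm (f x) \<le> norm (g x)"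
  shows "L2_norm M f \<le> L2_norm M g"
proof -
  note [measurable] = assms(1) L2_measurable[OF assms(2)]
  have "(LINT x|M. (norm (f x))\<^sup>2) \<le> (LINT x|M. (norm (g x))\<^sup>2)"
    by (rule integral_mono_AE') (use assms L2_integrable[OF assms(2)] in \<open>auto intro: power_mono\<close>)
  then show ?thesis by (simp add: L2_norm_def)
qed

lemma L2_norm_cmult: "L2_norm M (\<lambda>x. c * f x) = norm c * L2_norm M f"
  by (simp add: L2_norm_def norm_mult power_mult_distrib real_sqrt_mult)

lemma L2_norm_mult_le:
  assumes "f \<in> L2 M" "m \<in> borel_measurable M" "AE x in M. norm (m x) \<le> C"
  shows "L2_norm M (\<lambda>x. m x * f x) \<le> C * L2_norm M f"
proof (cases "C \<ge> 0")
  case True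
  note [measurable] = assms(2) L2_measurable[OF assms(1)]
  have "L2_norm M (\<lambda>x. m x * f x) \<le> L2_norm M (\<lambda>x. complex_of_real C * f x)"
    by (rule L2_norm_mono)
       (use assms True in \<open>auto simp: norm_mult intro!: L2_cmult elim!: eventually_mono mult_right_mono\<close>)
  then show ?thesis using True by (simp add: L2_norm_cmult)
next
  case False
  \<comment> \<open>A norm bounded by a negative number makes the whole space a null set, so both
    sides vanish.\<close>
  have "AE x in M. False"
    using assms(3) by (rule eventually_mono) (use False norm_ge_zero order_trans in blast)
  then have "L2_norm M h = 0" if "h \<in> L2 M" for h
    using L2_norm_cong_AE[of h M "\<lambda>x. 0"] L2_measurable[OF that] by (simp add: eventually_mono)
  then show ?thesis using assms L2_mult_bounded[OF assms] by simp
qed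

lemma L2_norm_unimodular:
  assumes "\<And>x. norm (m x) = 1"
  shows "L2_norm M (\<lambda>x. m x * f x) = L2_norm M f"
  using assms by (simp add: L2_norm_def norm_mult)

lemma L2_norm_triangle:
  assumes "f \<in> L2 M" "g \<in> L2 M"
  shows "L2_norm M (\<lambda>x. f x + g x) \<le> L2_norm M f + L2_norm M g"
proof (rule field_le_epsilon)
  fix e :: real assume "0 < e"
  \<comment> \<open>The added halves of \<open>e\<close> keep \<open>a\<close> and \<open>b\<close>
    positive even if a norm vanishes, so that the weight \<open>l\<close> lies strictly between 0
    and 1.\<close>
  define a where "a = L2_norm M f + e / 2"
  define b where "b = L2_norm M g + e / 2"
  have ab: "0 < a" "0 < b" "L2_norm M f \<le> a" "L2_norm M g \<le> b"
    using \<open>0 < e\<close> L2_norm_nonneg[of M f] L2_norm_nonneg[of M g]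
    unfolding a_def b_def by linarith+
  define l where "l = a / (a + b)"
  have l: "0 < l" "l < 1" "1 - l = b / (a + b)"
    using ab by (auto simp: l_def field_simps)
  have "(LINT x|M. (norm (f x + g x))\<^sup>2) \<le> (LINT x|M. (norm (f x))\<^sup>2 / l + (norm (g x))\<^sup>2 / (1 - l))"
    using L2_integrable[OF L2_add[OF assms]] L2_integrable[OF assms(1)] L2_integrable[OF assms(2)]
    by (intro integral_mono Bochner_Integration.integrable_add norm_square_add_le[OF l(1,2)]
        Bochner_Integration.integrable_divide_zero) auto
  also have "\<dots> = (L2_norm M f)\<^sup>2 / l + (L2_norm M g)\<^sup>2 / (1 - l)"
    using L2_integrable[OF assms(1)] L2_integrable[OF assms(2)] by (simp add: L2_norm_square)
  also have "\<dots> \<le> a\<^sup>2 / l + b\<^sup>2 / (1 - l)"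
    using ab l by (intro add_mono divide_right_mono power_mono) auto
  also have "\<dots> = (a + b)\<^sup>2"
    using ab unfolding l(3) by (simp add: l_def field_simps power2_eq_square)
  finally have "L2_norm M (\<lambda>x. f x + g x) \<le> a + b"
    unfolding L2_norm_def using ab by (intro real_le_lsqrt) auto
  then show "L2_norm M (\<lambda>x. f x + g x) \<le> L2_norm M f + L2_norm M g + e"
    by (simp add: a_def b_def)
qed

lemma L2_norm_minus_commute: "L2_norm M (\<lambda>x. f x - g x) = L2_norm M (\<lambda>x. g x - f x)"
  by (simp add: L2_norm_def norm_minus_commute)

lemma L2_norm_triangle3:
  assumes "f \<in> L2 M" "g \<in> L2 M" "h \<in> L2 M"
  shows "L2_norm M (\<lambda>x. f x - h x) \<le> L2_norm M (\<lambda>x. f x - g x) + L2_norm M (\<lambda>x. g x - h x)"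
  using L2_norm_triangle[OF L2_diff[OF assms(1,2)] L2_diff[OF assms(2,3)]] by simp

lemma L2_norm_eq_0_AE:
  assumes "f \<in> L2 M" "L2_norm M f = 0"
  shows "AE x in M. f x = 0"
proof -
  have "(LINT x|M. (norm (f x))\<^sup>2) = 0"
    using assms(2) by (simp add: L2_norm_def)
  then have "AE x in M. (norm (f x))\<^sup>2 = 0"
    by (subst (asm) integral_nonneg_eq_0_iff_AE[OF L2_integrable[OF assms(1)]]) auto
  then show ?thesis by eventually_elim simp
qed

lemma L2_norm_diff_eq_0:
  assumes "f \<in> borel_measurable M" "g \<in> borel_measurable M" "AE x in M. f x = g x"
  shows "L2_norm M (\<lambda>x. f x - g x) = 0"
  using L2_norm_cong_AE[of "\<lambda>x. f x - g x" M "\<lambda>x. 0"] assms by (auto elim: eventually_mono)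

lemma L2_norm_le_add_diff:
  assumes "f \<in> L2 M" "g \<in> L2 M"
  shows "L2_norm M f \<le> L2_norm M g + L2_norm M (\<lambda>x. f x - g x)"
  using L2_norm_triangle[OF assms(2) L2_diff[OF assms]] by simp

lemma L2_mult_integrable:
  assumes "f \<in> L2 M" "g \<in> L2 M"
  shows "integrable M (\<lambda>x. f x * g x)"
proof (rule Bochner_Integration.integrable_bound)
  note [measurable] = L2_measurable[OF assms(1)] L2_measurable[OF assms(2)]
  show "integrable M (\<lambda>x. (norm (f x))\<^sup>2 + (norm (g x))\<^sup>2)"
    using assms by (intro Bochner_Integration.integrable_add L2_integrable)
  show "(\<lambda>x. f x * g x) \<in> borel_measurable M" by measurable
  show "AE x in M. norm (f x * g x) \<le> norm ((norm (f x))\<^sup>2 + (norm (g x))\<^sup>2)"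
  proof (rule AE_I2)
    fix x
    have "norm (f x) * norm (g x) \<le> 2 * norm (f x) * norm (g x)" by simp
    also have "\<dots> \<le> (norm (f x))\<^sup>2 + (norm (g x))\<^sup>2"
      by (rule sum_squares_bound)
    finally show "norm (f x * g x) \<le> norm ((norm (f x))\<^sup>2 + (norm (g x))\<^sup>2)"
      by (simp add: norm_mult)
  qed
qed

text \<open>Young's inequality with a free scale \<open>s\<close>, which is then chosen to balance
  the two terms; a vanishing norm is treated apart because the optimal scale \<open>C / A\<close>
  degenerates. The product carries no conjugate, since the main use is pairing a function with a
  convolution kernel.\<close>

lemma L2_Cauchy_Schwarz:
  assumes "f \<in> L2 M" "g \<in> L2 M"
  shows "norm (LINT x|M. f x * g x) \<le> L2_norm M f * L2_norm M g"
proof (rule field_le_epsilon)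
  fix e :: real assume "0 < e"
  define A where "A = L2_norm M f"
  define C where "C = L2_norm M g"
  have nn: "0 \<le> A" "0 \<le> C" by (auto simp: A_def C_def)
  note [measurable] = L2_measurable[OF assms(1)] L2_measurable[OF assms(2)]
  have young: "norm (LINT x|M. f x * g x) \<le> (s * A\<^sup>2 + C\<^sup>2 / s) / 2" if s: "0 < s" for s
  proof -
    have "norm (LINT x|M. f x * g x) \<le> (LINT x|M. norm (f x * g x))"
      by (rule integral_norm_bound)
    also have "\<dots> \<le> (LINT x|M. (s * (norm (f x))\<^sup>2 + (norm (g x))\<^sup>2 / s) / 2)"
    proof (rule integral_mono)
      show "integrable M (\<lambda>x. norm (f x * g x))"
        by (intro integrable_norm L2_mult_integrable assms)
      show "integrable M (\<lambda>x. (s * (norm (f x))\<^sup>2 + (norm (g x))\<^sup>2 / s) / 2)"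
        using assms[THEN L2_integrable] by simp
      fix x
      have "2 * s * (norm (f x) * norm (g x)) \<le> (s * norm (f x))\<^sup>2 + (norm (g x))\<^sup>2"
        using sum_squares_bound[of "s * norm (f x)" "norm (g x)"] by (simp add: mult_ac)
      then show "norm (f x * g x) \<le> (s * (norm (f x))\<^sup>2 + (norm (g x))\<^sup>2 / s) / 2"
        using s by (simp add: norm_mult field_simps power2_eq_square)
    qed
    also have "\<dots> = (s * A\<^sup>2 + C\<^sup>2 / s) / 2"
      using assms[THEN L2_integrable] by (simp add: A_def C_def L2_norm_square)
    finally show ?thesis .
  qed
  show "norm (LINT x|M. f x * g x) \<le> L2_norm M f * L2_norm M g + e"
  proof (cases "A = 0 \<or> C = 0")
    case False
    then have "(C / A * A\<^sup>2 + C\<^sup>2 / (C / A)) / 2 = A * C" by (simp add: field_simps power2_eq_square)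
    moreover have "0 < C / A" using nn False by simp
    ultimately show ?thesis using young[of "C / A"] \<open>0 < e\<close> by (simp add: A_def C_def del: times_divide_eq_left)
  next
    case True
    then show ?thesis
    proof
      assume "A = 0"
      then have "AE x in M. f x = 0" using assms(1) L2_norm_eq_0_AE by (auto simp: A_def)
      then have "(LINT x|M. f x * g x) = (LINT x|M. 0)" by (intro integral_cong_AE) auto
      then show ?thesis using \<open>0 < e\<close> by simp
    next
      assume "C = 0"
      then have "AE x in M. g x = 0" using assms(2) L2_norm_eq_0_AE by (auto simp: C_def)
      then have "(LINT x|M. f x * g x) = (LINT x|M. 0)" by (intro integral_cong_AE) auto
      then show ?thesis using \<open>0 < e\<close> by simp
    qed
  qed
qed

section \<open>Convergence in L^2 and dominated convergence\<close>

lemma L2_tendsto_unique: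
  assumes "L2_tendsto M g l F" "L2_tendsto M g l' F" "F \<noteq> bot"
  shows "AE x in M. l x = l' x"
proof -
  have L: "l \<in> L2 M" "l' \<in> L2 M" using assms by (auto simp: L2_tendsto_def)
  have ev: "\<forall>\<^sub>F t in F. g t \<in> L2 M" using assms by (auto simp: L2_tendsto_def)
  have lim: "((\<lambda>t. L2_norm M (\<lambda>x. g t x - l x) + L2_norm M (\<lambda>x. g t x - l' x)) \<longlongrightarrow> 0 + 0) F"
    using assms by (intro tendsto_add) (auto simp: L2_tendsto_def)
  have "L2_norm M (\<lambda>x. l x - l' x) \<le> 0 + 0"
  proof (rule tendsto_le[OF assms(3) lim tendsto_const])
    show "\<forall>\<^sub>F t in F. L2_norm M (\<lambda>x. l x - l' x)
        \<le> L2_norm M (\<lambda>x. g t x - l x) + L2_norm M (\<lambda>x. g t x - l' x)"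
      using ev by eventually_elim
        (use L2_norm_triangle3[OF L(1) _ L(2)] L2_norm_minus_commute[of M l] in auto)
  qed
  then have "L2_norm M (\<lambda>x. l x - l' x) = 0" using L2_norm_nonneg[of M "\<lambda>x. l x - l' x"] by linarith
  from L2_norm_eq_0_AE[OF L2_diff[OF L] this] show ?thesis by eventually_elim simp
qed

text \<open>Lets limits be computed with convenient representatives, as the operators below are
  identified only up to null sets. Membership of the new functions in L^2 is assumed because over a
  general measure equality almost everywhere does not transfer measurability.\<close>

lemma L2_tendsto_cong_AE:
  assumes "L2_tendsto M g l F" "\<forall>\<^sub>F t in F. g' t \<in> L2 M \<and> (AE x in M. g' t x = g t x)"
    "l' \<in> L2 M" "AE x in M. l' x = l x"
  shows "L2_tendsto M g' l' F"
proof -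
  have L: "l \<in> L2 M" and ev: "\<forall>\<^sub>F t in F. g t \<in> L2 M"
    and lim: "((\<lambda>t. L2_norm M (\<lambda>x. g t x - l x)) \<longlongrightarrow> 0) F"
    using assms(1) by (auto simp: L2_tendsto_def)
  have "\<forall>\<^sub>F t in F. L2_norm M (\<lambda>x. g t x - l x) = L2_norm M (\<lambda>x. g' t x - l' x)"
    using ev assms(2)
  proof eventually_elim
    case (elim t)
    show ?case
    proof (rule L2_norm_cong_AE)
      show "AE x in M. g t x - l x = g' t x - l' x"
        using conjunct2[OF elim(2)] assms(4) by eventually_elim simp
    qed (use elim L assms(3) in \<open>auto intro!: L2_measurable L2_diff\<close>)
  qed
  from Lim_transform_eventually[OF lim this]
  show ?thesis using assms by (auto simp: L2_tendsto_def elim: eventually_mono)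
qed

lemma L2_tendsto_add:
  assumes "L2_tendsto M f l F" "L2_tendsto M g k F"
  shows "L2_tendsto M (\<lambda>t x. f t x + g t x) (\<lambda>x. l x + k x) F"
proof -
  have ev: "\<forall>\<^sub>F t in F. f t \<in> L2 M \<and> g t \<in> L2 M" and L: "l \<in> L2 M" "k \<in> L2 M"
    using assms by (auto simp: L2_tendsto_def intro: eventually_conj)
  have lim: "((\<lambda>t. L2_norm M (\<lambda>x. f t x - l x) + L2_norm M (\<lambda>x. g t x - k x)) \<longlongrightarrow> 0 + 0) F"
    using assms by (intro tendsto_add) (auto simp: L2_tendsto_def)
  have "((\<lambda>t. L2_norm M (\<lambda>x. (f t x + g t x) - (l x + k x))) \<longlongrightarrow> 0) F"
  proof (rule tendsto_sandwich[OF _ _ tendsto_const])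
    show "\<forall>\<^sub>F t in F. L2_norm M (\<lambda>x. (f t x + g t x) - (l x + k x))
       \<le> L2_norm M (\<lambda>x. f t x - l x) + L2_norm M (\<lambda>x. g t x - k x)"
      using ev
    proof eventually_elim
      case (elim t)
      then show ?case
        using L2_norm_triangle[OF L2_diff[of "f t" M l] L2_diff[of "g t" M k]] L
        by (simp add: algebra_simps)
    qed
  qed (use lim in auto)
  then show ?thesis
    using ev L by (auto simp: L2_tendsto_def elim!: eventually_mono intro!: L2_add)
qed

lemma L2_tendsto_cmult:
  assumes "L2_tendsto M f l F"
  shows "L2_tendsto M (\<lambda>t x. c * f t x) (\<lambda>x. c * l x) F"
proof -
  have "((\<lambda>t. norm c * L2_norm M (\<lambda>x. f t x - l x)) \<longlongrightarrow> norm c * 0) F"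
    using assms by (intro tendsto_mult_left) (auto simp: L2_tendsto_def)
  then have "((\<lambda>t. L2_norm M (\<lambda>x. c * f t x - c * l x)) \<longlongrightarrow> 0) F"
    using L2_norm_cmult[of M c] by (simp flip: right_diff_distrib)
  then show ?thesis
    using assms by (auto simp: L2_tendsto_def elim!: eventually_mono intro!: L2_cmult)
qed

lemma L2_tendsto_compose:
  assumes "L2_tendsto M g l F" "filterlim h F G"
  shows "L2_tendsto M (\<lambda>t. g (h t)) l G"
  using assms eventually_compose_filterlim[OF _ assms(2)] filterlim_compose[OF _ assms(2)]
  unfolding L2_tendsto_def by blast

lemma L2_tendsto_dominated_seq:
  fixes g :: "nat \<Rightarrow> 'a \<Rightarrow> complex"
  assumes "l \<in> borel_measurable M" "\<And>n. g n \<in> borel_measurable M" "w \<in> L2 M"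
    and lim: "AE x in M. (\<lambda>n. g n x) \<longlonglongrightarrow> l x"
    and dom: "\<And>n. AE x in M. norm (g n x) \<le> norm (w x)"
  shows "L2_tendsto M g l sequentially"
proof -
  note [measurable] = assms(1,2) L2_measurable[OF assms(3)]
  have w: "integrable M (\<lambda>x. (norm (w x))\<^sup>2)" by (rule L2_integrable[OF assms(3)])
  have *: "h \<in> L2 M" if [measurable]: "h \<in> borel_measurable M" and "AE x in M. norm (h x) \<le> norm (w x)" for h
    by (intro L2_I that Bochner_Integration.integrable_bound[OF w])
       (use that(2) in \<open>auto elim!: eventually_mono intro: power_mono\<close>)
  have domall: "AE x in M. \<forall>n. norm (g n x) \<le> norm (w x)" using dom by (simp add: AE_all_countable)
  have ldom: "AE x in M. norm (l x) \<le> norm (w x)"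
    using lim domall
  proof eventually_elim
    case (elim x)
    show ?case by (rule LIMSEQ_le_const2[OF tendsto_norm[OF elim(1)]]) (use elim in auto)
  qed
  have "(\<lambda>n. LINT x|M. (norm (g n x - l x))\<^sup>2) \<longlonglongrightarrow> (LINT x|M. 0)"
  proof (rule integral_dominated_convergence[where w = "\<lambda>x. 4 * (norm (w x))\<^sup>2"])
    show "AE x in M. (\<lambda>n. (norm (g n x - l x))\<^sup>2) \<longlonglongrightarrow> 0"
      using lim
    proof eventually_elim
      case (elim x)
      have "(\<lambda>n. (norm (g n x - l x))\<^sup>2) \<longlonglongrightarrow> (norm (l x - l x))\<^sup>2"
        by (intro tendsto_intros elim)
      then show ?case by simp
    qed
    show "AE x in M. norm ((norm (g n x - l x))\<^sup>2) \<le> 4 * (norm (w x))\<^sup>2" for n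
      using dom[of n] ldom
    proof eventually_elim
      case (elim x)
      have "norm (g n x - l x) \<le> 2 * norm (w x)"
        using norm_triangle_ineq4[of "g n x" "l x"] elim by linarith
      then have "(norm (g n x - l x))\<^sup>2 \<le> (2 * norm (w x))\<^sup>2" by (intro power_mono) auto
      then show ?case by (simp add: power_mult_distrib)
    qed
  qed (use w in auto)
  then have "(\<lambda>n. L2_norm M (\<lambda>x. g n x - l x)) \<longlonglongrightarrow> 0"
    unfolding L2_norm_def using tendsto_real_sqrt by fastforce
  then show ?thesis unfolding L2_tendsto_def using * dom ldom by auto
qed

lemma L2_tendsto_dominated_at_top:
  fixes g :: "real \<Rightarrow> 'a \<Rightarrow> complex"
  assumes "l \<in> borel_measurable M" "\<And>t. g t \<in> borel_measurable M" "w \<in> L2 M"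
    and lim: "AE x in M. ((\<lambda>t. g t x) \<longlongrightarrow> l x) at_top"
    and dom: "\<And>t. t > c \<Longrightarrow> AE x in M. norm (g t x) \<le> norm (w x)"
  shows "L2_tendsto M g l at_top"
proof -
  have w: "integrable M (\<lambda>x. (norm (w x))\<^sup>2)" by (rule L2_integrable[OF assms(3)])
  have seq: "L2_tendsto M (\<lambda>n. g (X n)) l sequentially"
    if X: "filterlim X at_top sequentially" "\<And>n. X n > c" for X :: "nat \<Rightarrow> real"
  proof (rule L2_tendsto_dominated_seq[OF assms(1) _ assms(3)])
    show "AE x in M. (\<lambda>n. g (X n) x) \<longlonglongrightarrow> l x"
      using lim by eventually_elim (use filterlim_compose[OF _ X(1)] in auto)
  qed (use assms X in auto)
  have "l \<in> L2 M"
    using seq[of "\<lambda>n. c + 1 + real n"] filterlim_tendsto_add_at_top[OF tendsto_const filterlim_real_sequentially]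
    by (auto simp: L2_tendsto_def)
  moreover have gL: "g t \<in> L2 M" if "t > c" for t
    using assms(2) dom[OF that]
    by (intro L2_I Bochner_Integration.integrable_bound[OF w]) (auto elim!: eventually_mono intro: power_mono)
  then have "\<forall>\<^sub>F t in at_top. g t \<in> L2 M"
    by (rule eventually_mono[OF eventually_gt_at_top[of c]])
  moreover have "((\<lambda>t. L2_norm M (\<lambda>x. g t x - l x)) \<longlongrightarrow> 0) at_top"
  proof (rule tendsto_at_topI_sequentially)
    fix X :: "nat \<Rightarrow> real" assume X: "filterlim X at_top sequentially"
    \<comment> \<open>Domination is only assumed beyond \<open>c\<close>. \<open>Y\<close> replaces
      the terms of \<open>X\<close> that are too small and agrees with \<open>X\<close>
      eventually.\<close>
    define Y where "Y n = (if X n > c then X n else c + 1 + real n)" for n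
    have XY: "\<forall>\<^sub>F n in sequentially. Y n = X n"
      using X unfolding filterlim_at_top_dense Y_def by (auto elim: eventually_mono)
    have "filterlim Y at_top sequentially"
      by (rule filterlim_mono_eventually[OF X order_refl order_refl]) (use XY in \<open>auto elim: eventually_mono\<close>)
    then have "(\<lambda>n. L2_norm M (\<lambda>x. g (Y n) x - l x)) \<longlonglongrightarrow> 0"
      using seq[of Y] by (auto simp: L2_tendsto_def Y_def)
    then show "(\<lambda>n. L2_norm M (\<lambda>x. g (X n) x - l x)) \<longlonglongrightarrow> 0"
      by (rule Lim_transform_eventually) (use XY in \<open>auto elim: eventually_mono\<close>)
  qed
  ultimately show ?thesis by (auto simp: L2_tendsto_def)
qed

section \<open>Bounded operators and completeness\<close>

lemma bounded_op_L2: "bounded_op M A \<Longrightarrow> f \<in> L2 M \<Longrightarrow> A f \<in> L2 M"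
  by (simp add: bounded_op_def)

lemma bounded_op_cong:
  "bounded_op M A \<Longrightarrow> f \<in> L2 M \<Longrightarrow> g \<in> L2 M \<Longrightarrow> AE x in M. f x = g x \<Longrightarrow> AE x in M. A f x = A g x"
  by (simp add: bounded_op_def)

lemma bounded_op_add:
  "bounded_op M A \<Longrightarrow> f \<in> L2 M \<Longrightarrow> g \<in> L2 M \<Longrightarrow> AE x in M. A (\<lambda>y. f y + g y) x = A f x + A g x"
  by (simp add: bounded_op_def)

lemma bounded_op_cmult:
  "bounded_op M A \<Longrightarrow> f \<in> L2 M \<Longrightarrow> AE x in M. A (\<lambda>y. c * f y) x = c * A f x"
  by (simp add: bounded_op_def)

lemma bounded_op_bound:
  assumes "bounded_op M A"
  obtains K where "0 \<le> K" "\<And>f. f \<in> L2 M \<Longrightarrow> L2_norm M (A f) \<le> K * L2_norm M f"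
proof -
  obtain K where K: "\<And>f. f \<in> L2 M \<Longrightarrow> L2_norm M (A f) \<le> K * L2_norm M f"
    using assms unfolding bounded_op_def by blast
  have "L2_norm M (A f) \<le> max K 0 * L2_norm M f" if "f \<in> L2 M" for f
    using K[OF that] mult_right_mono[of K "max K 0" "L2_norm M f"] by simp
  then show ?thesis using that[of "max K 0"] by auto
qed

lemma bounded_op_zero:
  assumes "bounded_op M A"
  shows "AE x in M. A (\<lambda>x. 0) x = 0"
  using bounded_op_cmult[OF assms L2_zero, of 0] by simp

lemma bounded_op_diff:
  assumes "bounded_op M A" "f \<in> L2 M" "g \<in> L2 M"
  shows "AE x in M. A (\<lambda>y. f y - g y) x = A f x - A g x"
proof -
  have "AE x in M. A (\<lambda>y. f y + (-1) * g y) x = A f x + A (\<lambda>y. (-1) * g y) x"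
    using assms by (intro bounded_op_add L2_cmult)
  moreover have "AE x in M. A (\<lambda>y. (-1) * g y) x = (-1) * A g x"
    using assms by (intro bounded_op_cmult)
  ultimately show ?thesis by eventually_elim simp
qed

lemma bounded_op_sum:
  assumes "bounded_op M A" "\<And>i. i \<in> I \<Longrightarrow> f i \<in> L2 M"
  shows "AE x in M. A (\<lambda>y. \<Sum>i\<in>I. f i y) x = (\<Sum>i\<in>I. A (f i) x)"
  using assms(2)
proof (induction I rule: infinite_finite_induct)
  case (insert i I)
  have fi: "f i \<in> L2 M" and fI: "\<And>k. k \<in> I \<Longrightarrow> f k \<in> L2 M"
    using insert.prems by simp_all
  have "AE x in M. A (\<lambda>y. f i y + (\<Sum>k\<in>I. f k y)) x = A (f i) x + A (\<lambda>y. \<Sum>k\<in>I. f k y) x"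
    by (intro bounded_op_add[OF assms(1) fi] L2_sum fI)
  moreover have "AE x in M. A (\<lambda>y. \<Sum>k\<in>I. f k y) x = (\<Sum>k\<in>I. A (f k) x)"
    by (rule insert.IH[OF fI])
  ultimately show ?case
    unfolding sum.insert[OF insert.hyps] by eventually_elim (rule trans, assumption, simp)
next
  case (infinite I)
  then show ?case using bounded_op_zero[OF assms(1)] by simp
next
  case empty
  show ?case using bounded_op_zero[OF assms(1)] by simp
qed

lemma bounded_op_diff_norm:
  assumes "bounded_op M A" "f \<in> L2 M" "g \<in> L2 M"
  shows "L2_norm M (\<lambda>x. A f x - A g x) = L2_norm M (A (\<lambda>x. f x - g x))"
proof (rule L2_norm_cong_AE)
  show "AE x in M. A f x - A g x = A (\<lambda>x. f x - g x) x"
    using bounded_op_diff[OF assms] by eventually_elim simp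
qed (intro L2_measurable L2_diff bounded_op_L2[OF assms(1)] assms(2,3))+

lemma bounded_op_comp:
  assumes A: "bounded_op M A" and U: "bounded_op M U"
  shows "bounded_op M (A \<circ> U)"
  unfolding bounded_op_def
proof (intro conjI ballI allI impI)
  fix f assume f: "f \<in> L2 M"
  then show "(A \<circ> U) f \<in> L2 M" using bounded_op_L2[OF A bounded_op_L2[OF U]] by simp
  fix c
  have "AE x in M. A (U (\<lambda>y. c * f y)) x = A (\<lambda>y. c * U f y) x"
    by (rule bounded_op_cong[OF A bounded_op_L2[OF U L2_cmult[OF f]] L2_cmult[OF bounded_op_L2[OF U f]]
          bounded_op_cmult[OF U f]])
  moreover have "AE x in M. A (\<lambda>y. c * U f y) x = c * A (U f) x"
    by (rule bounded_op_cmult[OF A bounded_op_L2[OF U f]])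
  ultimately show "AE x in M. (A \<circ> U) (\<lambda>y. c * f y) x = c * (A \<circ> U) f x"
    by eventually_elim simp
next
  fix f g assume fg: "f \<in> L2 M" "g \<in> L2 M"
  have "AE x in M. A (U (\<lambda>y. f y + g y)) x = A (\<lambda>y. U f y + U g y) x"
    by (rule bounded_op_cong[OF A bounded_op_L2[OF U L2_add[OF fg]]
          L2_add[OF bounded_op_L2[OF U fg(1)] bounded_op_L2[OF U fg(2)]] bounded_op_add[OF U fg]])
  moreover have "AE x in M. A (\<lambda>y. U f y + U g y) x = A (U f) x + A (U g) x"
    by (rule bounded_op_add[OF A bounded_op_L2[OF U fg(1)] bounded_op_L2[OF U fg(2)]])
  ultimately show "AE x in M. (A \<circ> U) (\<lambda>y. f y + g y) x = (A \<circ> U) f x + (A \<circ> U) g x"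
    by eventually_elim simp
  show "AE x in M. (A \<circ> U) f x = (A \<circ> U) g x" if "AE x in M. f x = g x"
    using bounded_op_cong[OF A bounded_op_L2[OF U fg(1)] bounded_op_L2[OF U fg(2)]
        bounded_op_cong[OF U fg that]] by simp
next
  obtain K where K: "0 \<le> K" "\<And>f. f \<in> L2 M \<Longrightarrow> L2_norm M (A f) \<le> K * L2_norm M f"
    using bounded_op_bound[OF A] by blast
  obtain K' where K': "0 \<le> K'" "\<And>f. f \<in> L2 M \<Longrightarrow> L2_norm M (U f) \<le> K' * L2_norm M f"
    using bounded_op_bound[OF U] by blast
  have "L2_norm M (A (U f)) \<le> (K * K') * L2_norm M f" if "f \<in> L2 M" for f
    using K(2)[OF bounded_op_L2[OF U that]] mult_left_mono[OF K'(2)[OF that] K(1)] by simp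
  then show "\<exists>K. \<forall>f\<in>L2 M. L2_norm M ((A \<circ> U) f) \<le> K * L2_norm M f" by auto
qed

lemma bounded_op_multiplication:
  fixes m :: "'a \<Rightarrow> complex"
  assumes "m \<in> borel_measurable M" "AE x in M. norm (m x) \<le> C"
  shows "bounded_op M (\<lambda>f x. m x * f x)"
  unfolding bounded_op_def
proof (intro conjI ballI allI impI)
  fix f g :: "'a \<Rightarrow> complex" assume "AE x in M. f x = g x"
  then show "AE x in M. m x * f x = m x * g x" by eventually_elim simp
qed (use L2_mult_bounded[OF _ assms] L2_norm_mult_le[OF _ assms] in \<open>auto simp: distrib_left mult.left_commute\<close>)

lemma bounded_op_tendsto:
  assumes A: "bounded_op M A" and "L2_tendsto M g l F"
  shows "L2_tendsto M (\<lambda>t. A (g t)) (A l) F"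
proof -
  obtain K where K: "0 \<le> K" "\<And>f. f \<in> L2 M \<Longrightarrow> L2_norm M (A f) \<le> K * L2_norm M f"
    using bounded_op_bound[OF A] by blast
  have l: "l \<in> L2 M" and ev: "\<forall>\<^sub>F t in F. g t \<in> L2 M"
    and lim: "((\<lambda>t. L2_norm M (\<lambda>x. g t x - l x)) \<longlongrightarrow> 0) F"
    using assms by (auto simp: L2_tendsto_def)
  have "((\<lambda>t. L2_norm M (\<lambda>x. A (g t) x - A l x)) \<longlongrightarrow> 0) F"
  proof (rule tendsto_sandwich[OF _ _ tendsto_const])
    show "\<forall>\<^sub>F t in F. L2_norm M (\<lambda>x. A (g t) x - A l x) \<le> K * L2_norm M (\<lambda>x. g t x - l x)"
      using ev by eventually_elim (simp add: bounded_op_diff_norm[OF A] l K L2_diff)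
    show "((\<lambda>t. K * L2_norm M (\<lambda>x. g t x - l x)) \<longlongrightarrow> 0) F"
      using tendsto_mult_left[OF lim, of K] by simp
  qed auto
  then show ?thesis
    unfolding L2_tendsto_def using l ev by (auto intro: bounded_op_L2[OF A] elim: eventually_mono)
qed

text \<open>The density half of the Banach-Steinhaus argument: T f - T s and W s - W f are small by
  the norm bounds, uniformly in \<open>t\<close>, and T s - W s is small by the convergence at
  \<open>s\<close>.\<close>

lemma L2_tendsto_uniformly_bounded:
  assumes T: "\<And>t. bounded_op M (T t)" and W: "bounded_op M W"
    and K: "\<And>t g. g \<in> L2 M \<Longrightarrow> L2_norm M (T t g) \<le> K * L2_norm M g"
    and f: "f \<in> L2 M"
    and approx: "\<And>e. 0 < e \<Longrightarrow> \<exists>s\<in>L2 M. L2_norm M (\<lambda>x. f x - s x) < e \<and> L2_tendsto M (\<lambda>t. T t s) (W s) F"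
  shows "L2_tendsto M (\<lambda>t. T t f) (W f) F"
proof -
  obtain K' where K': "0 \<le> K'" "\<And>f. f \<in> L2 M \<Longrightarrow> L2_norm M (W f) \<le> K' * L2_norm M f"
    using bounded_op_bound[OF W] by blast
  have "((\<lambda>t. L2_norm M (\<lambda>x. T t f x - W f x)) \<longlongrightarrow> 0) F"
  proof (rule tendstoI)
    fix e :: real assume e: "0 < e"
    \<comment> \<open>With this \<open>d\<close> the two approximation errors together cost at most
      \<open>e / 2\<close>; the summand 1 keeps the denominator positive.\<close>
    define d where "d = e / (2 * (\<bar>K\<bar> + K' + 1))"
    have d: "0 < d" using e K' by (auto simp: d_def)
    obtain s where s: "s \<in> L2 M" "L2_norm M (\<lambda>x. f x - s x) < d" "L2_tendsto M (\<lambda>t. T t s) (W s) F"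
      using approx[OF d] by blast
    have ev: "\<forall>\<^sub>F t in F. L2_norm M (\<lambda>x. T t s x - W s x) < e / 2"
      using s(3) e by (intro order_tendstoD(2)[where y = 0]) (auto simp: L2_tendsto_def)
    have main: "(\<bar>K\<bar> + K') * L2_norm M (\<lambda>x. f x - s x) \<le> e / 2"
    proof -
      have "(\<bar>K\<bar> + K') * L2_norm M (\<lambda>x. f x - s x) \<le> (\<bar>K\<bar> + K' + 1) * d"
        using s K' by (intro mult_mono) auto
      also have "\<dots> = e / 2" using K' unfolding d_def by (simp add: field_simps)
      finally show ?thesis .
    qed
    show "\<forall>\<^sub>F t in F. dist (L2_norm M (\<lambda>x. T t f x - W f x)) 0 < e"
      using ev
    proof eventually_elim
      case (elim t)
      note L = bounded_op_L2[OF T f, of t] bounded_op_L2[OF T s(1), of t] bounded_op_L2[OF W f] bounded_op_L2[OF W s(1)]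
      have "L2_norm M (\<lambda>x. T t f x - W f x) \<le> L2_norm M (\<lambda>x. T t f x - T t s x)
          + (L2_norm M (\<lambda>x. T t s x - W s x) + L2_norm M (\<lambda>x. W s x - W f x))"
        using L2_norm_triangle3[OF L(1,2,3)] L2_norm_triangle3[OF L(2,4,3)] by simp
      also have "L2_norm M (\<lambda>x. T t f x - T t s x) \<le> \<bar>K\<bar> * L2_norm M (\<lambda>x. f x - s x)"
        unfolding bounded_op_diff_norm[OF T f s(1)]
        by (rule order_trans[OF K[OF L2_diff[OF f s(1)]] mult_right_mono]) auto
      also have "L2_norm M (\<lambda>x. W s x - W f x) \<le> K' * L2_norm M (\<lambda>x. f x - s x)"
        using K'(2)[OF L2_diff[OF f s(1)]]
        unfolding L2_norm_minus_commute[of M "W s"] bounded_op_diff_norm[OF W f s(1)] .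
      finally show ?case using elim main by (simp add: algebra_simps)
    qed
  qed
  then show ?thesis
    unfolding L2_tendsto_def using bounded_op_L2[OF T f] bounded_op_L2[OF W f] by simp
qed

text \<open>Once the exponential series has some limit, the choice in \<open>op_exp\<close> returns
  a limit, and limits in L^2 are unique up to null sets. Computing an exponential thus amounts to
  exhibiting one limit.\<close>

lemma op_exp_eq:
  assumes "L2_tendsto M (\<lambda>N x. \<Sum>n<N. (A ^^ n) f x / fact n) g sequentially"
  shows "op_exp M A f \<in> L2 M" "AE x in M. op_exp M A f x = g x"
proof -
  have *: "L2_tendsto M (\<lambda>N x. \<Sum>n<N. (A ^^ n) f x / fact n) (op_exp M A f) sequentially"
    unfolding op_exp_def by (rule someI[of _ g]) (rule assms)
  then show "op_exp M A f \<in> L2 M" by (simp add: L2_tendsto_def)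
  show "AE x in M. op_exp M A f x = g x"
    by (rule L2_tendsto_unique[OF * assms]) simp
qed

section \<open>Finite measure spaces and completeness\<close>

lemma (in finite_measure) L2_const: "(\<lambda>x. c) \<in> L2 M"
  by (rule L2_I) auto

lemma (in finite_measure) L2_imp_integrable:
  assumes "f \<in> L2 M"
  shows "integrable M f"
  using L2_mult_integrable[OF assms L2_const[of 1]] by simp

lemma (in finite_measure) L2_norm_L1_le:
  assumes "f \<in> L2 M"
  shows "(LINT x|M. norm (f x)) \<le> sqrt (measure M (space M)) * L2_norm M f"
proof -
  have [measurable]: "f \<in> borel_measurable M" using assms by (rule L2_measurable)
  have g: "(\<lambda>x. complex_of_real (norm (f x))) \<in> L2 M"
    using L2_integrable[OF assms] by (intro L2_I) auto
  have "norm (LINT x|M. complex_of_real (norm (f x)) * 1)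
      \<le> L2_norm M (\<lambda>x. complex_of_real (norm (f x))) * L2_norm M (\<lambda>x. 1)"
    by (rule L2_Cauchy_Schwarz[OF g L2_const])
  then show ?thesis
    by (simp add: L2_norm_def mult.commute abs_of_nonneg)
qed

text \<open>Riesz-Fischer for geometrically fast sequences. On a finite measure space the L^2 norm
  controls the L^1 norm, so the increments are absolutely summable almost everywhere; this produces
  a pointwise limit, and Fatou's lemma turns the tail estimate into convergence in L^2.\<close>

lemma (in finite_measure) L2_complete:
  assumes g: "\<And>n. g n \<in> L2 M" and fast: "\<And>n. L2_norm M (\<lambda>x. g (Suc n) x - g n x) \<le> C * (1 / 2) ^ n"
  shows "\<exists>l. L2_tendsto M g l sequentially"
proof -
  note [measurable] = g[THEN L2_measurable]
  have C: "0 \<le> C" using order_trans[OF L2_norm_nonneg fast[of 0]] by simp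
  define D where "D n x = g (Suc n) x - g n x" for n x
  have DL: "D n \<in> L2 M" for n unfolding D_def by (intro L2_diff g)
  have Dm[measurable]: "D n \<in> borel_measurable M" for n using DL by (rule L2_measurable)
  have Dn: "L2_norm M (D n) \<le> C * (1/2)^n" for n unfolding D_def by (rule fast)
  have telescope: "g n x = g N x + (\<Sum>i=N..<n. D i x)" if "N \<le> n" for n N x
    using that by (induction n rule: dec_induct) (auto simp: D_def)
  have tail: "L2_norm M (\<lambda>x. g n x - g N x) \<le> 2 * C * (1/2)^N" if "N \<le> n" for n N
  proof -
    \<comment> \<open>The sharper right-hand side, a difference of two geometric tails, is what the
      induction on \<open>n\<close> reproduces.\<close>
    have "L2_norm M (\<lambda>x. g n x - g N x) \<le> 2 * C * ((1/2)^N - (1/2)^n)"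
      using that
    proof (induction n rule: dec_induct)
      case (step n)
      have "L2_norm M (\<lambda>x. g (Suc n) x - g N x) \<le> C * (1/2)^n + 2 * C * ((1/2)^N - (1/2)^n)"
        using L2_norm_triangle3[OF g[of "Suc n"] g[of n] g[of N]] fast[of n] step by linarith
      then show ?case by (simp add: algebra_simps)
    qed simp
    also have "\<dots> \<le> 2 * C * (1/2)^N" using C by (intro mult_left_mono) auto
    finally show ?thesis .
  qed
  have "(\<integral>\<^sup>+x. (\<Sum>n. ennreal (norm (D n x))) \<partial>M) = (\<Sum>n. \<integral>\<^sup>+x. ennreal (norm (D n x)) \<partial>M)"
    by (rule nn_integral_suminf) measurable
  also have "\<dots> \<le> (\<Sum>n. ennreal (sqrt (measure M (space M)) * (C * (1/2)^n)))"
  proof (rule suminf_le)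
    fix n
    have "(\<integral>\<^sup>+x. ennreal (norm (D n x)) \<partial>M) = ennreal (LINT x|M. norm (D n x))"
      using L2_imp_integrable[OF DL] by (intro nn_integral_eq_integral) auto
    also have "\<dots> \<le> ennreal (sqrt (measure M (space M)) * (C * (1/2)^n))"
      by (intro ennreal_leI order_trans[OF L2_norm_L1_le[OF DL]] mult_left_mono Dn) auto
    finally show "(\<integral>\<^sup>+x. ennreal (norm (D n x)) \<partial>M) \<le> ennreal (sqrt (measure M (space M)) * (C * (1/2)^n))" .
  qed auto
  also have "\<dots> < \<infinity>"
    using C by (subst suminf_ennreal2) (auto intro!: summable_mult summable_geometric)
  finally have "AE x in M. (\<Sum>n. ennreal (norm (D n x))) \<noteq> \<infinity>"
    by (intro nn_integral_PInf_AE) auto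
  then have conv: "AE x in M. convergent (\<lambda>n. g n x)"
  proof eventually_elim
    case (elim x)
    then have "summable (\<lambda>n. norm (D n x))"
      by (intro summable_suminf_not_top) (auto simp: infinity_ennreal_def)
    then have "summable (\<lambda>n. D n x)" by (rule summable_norm_cancel)
    then have "convergent (\<lambda>n. g 0 x + (\<Sum>i<n. D i x))"
      by (intro convergent_add convergent_const) (simp add: summable_iff_convergent)
    moreover have "(\<lambda>n. g n x) = (\<lambda>n. g 0 x + (\<Sum>i<n. D i x))"
      using telescope[of 0 _ x] unfolding lessThan_atLeast0 by blast
    ultimately show "convergent (\<lambda>n. g n x)" by (rule ssubst[rotated])
  qed
  define l where "l x = lim (\<lambda>n. g n x)" for x
  have [measurable]: "l \<in> borel_measurable M" unfolding l_def by measurable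
  have lim: "AE x in M. (\<lambda>n. g n x) \<longlonglongrightarrow> l x"
    using conv by eventually_elim (simp add: convergent_LIMSEQ_iff l_def)
  \<comment> \<open>Fatou's lemma: the tail bound is uniform in \<open>n\<close> and survives the
    passage to the pointwise limit.\<close>
  have bound: "(\<integral>\<^sup>+x. ennreal ((norm (l x - g N x))\<^sup>2) \<partial>M) \<le> ennreal ((2 * C * (1/2)^N)\<^sup>2)" for N
  proof -
    have "(\<integral>\<^sup>+x. ennreal ((norm (l x - g N x))\<^sup>2) \<partial>M)
        = (\<integral>\<^sup>+x. liminf (\<lambda>n. ennreal ((norm (g n x - g N x))\<^sup>2)) \<partial>M)"
    proof (rule nn_integral_cong_AE)
      show "AE x in M. ennreal ((norm (l x - g N x))\<^sup>2) = liminf (\<lambda>n. ennreal ((norm (g n x - g N x))\<^sup>2))"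
        using lim
      proof eventually_elim
        case (elim x)
        have "(\<lambda>n. ennreal ((norm (g n x - g N x))\<^sup>2)) \<longlonglongrightarrow> ennreal ((norm (l x - g N x))\<^sup>2)"
          by (intro tendsto_intros elim)
        from lim_imp_Liminf[OF _ this] show ?case by simp
      qed
    qed
    also have "\<dots> \<le> liminf (\<lambda>n. \<integral>\<^sup>+x. ennreal ((norm (g n x - g N x))\<^sup>2) \<partial>M)"
      by (rule nn_integral_liminf) measurable
    also have "\<dots> \<le> liminf (\<lambda>n. ennreal ((2 * C * (1/2)^N)\<^sup>2))"
    proof (rule Liminf_mono, rule eventually_sequentiallyI[of N])
      fix n assume "N \<le> n"
      have "(\<integral>\<^sup>+x. ennreal ((norm (g n x - g N x))\<^sup>2) \<partial>M) = ennreal ((L2_norm M (\<lambda>x. g n x - g N x))\<^sup>2)"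
        unfolding L2_norm_square using L2_integrable[OF L2_diff[OF g g]] by (intro nn_integral_eq_integral) auto
      also have "\<dots> \<le> ennreal ((2 * C * (1/2)^N)\<^sup>2)"
        by (intro ennreal_leI power_mono tail \<open>N \<le> n\<close>) auto
      finally show "(\<integral>\<^sup>+x. ennreal ((norm (g n x - g N x))\<^sup>2) \<partial>M) \<le> ennreal ((2 * C * (1/2)^N)\<^sup>2)" .
    qed
    finally show ?thesis by (simp add: Liminf_const)
  qed
  have diffL: "(\<lambda>x. l x - g N x) \<in> L2 M" for N
  proof (intro L2_I integrableI_bounded)
    show "(\<integral>\<^sup>+x. ennreal (norm ((norm (l x - g N x))\<^sup>2)) \<partial>M) < \<infinity>"
      using le_less_trans[OF bound[of N]] by simp
  qed measurable
  have "(\<lambda>x. (l x - g 0 x) + g 0 x) \<in> L2 M" by (intro L2_add diffL g)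
  then have l: "l \<in> L2 M" by simp
  have nb: "L2_norm M (\<lambda>x. g N x - l x) \<le> 2 * C * (1/2)^N" for N
  proof -
    have "ennreal (LINT x|M. (norm (l x - g N x))\<^sup>2) \<le> ennreal ((2 * C * (1/2)^N)\<^sup>2)"
      using bound[of N] nn_integral_eq_integral[OF L2_integrable[OF diffL[of N]]] by simp
    then have "(LINT x|M. (norm (l x - g N x))\<^sup>2) \<le> (2 * C * (1/2)^N)\<^sup>2"
      by (simp add: ennreal_le_iff)
    then show ?thesis
      unfolding L2_norm_def norm_minus_commute[of "g N _"] using C by (intro real_le_lsqrt) auto
  qed
  have "(\<lambda>N. L2_norm M (\<lambda>x. g N x - l x)) \<longlonglongrightarrow> 0"
  proof (rule tendsto_sandwich[OF _ _ tendsto_const])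
    have "(\<lambda>N. 2 * C * (1/2)^N) \<longlonglongrightarrow> 2 * C * 0"
      by (intro tendsto_mult_left LIMSEQ_power_zero) auto
    then show "(\<lambda>N. 2 * C * (1/2)^N) \<longlonglongrightarrow> (0::real)" by simp
  qed (use nb in auto)
  then show ?thesis using l g by (auto simp: L2_tendsto_def)
qed

section \<open>Step functions and Lebesgue differentiation\<close>

abbreviation leb :: "real \<Rightarrow> real measure" where
  "leb \<omega> \<equiv> lebesgue_on {0<..<\<omega>}"

lemma finite_measure_leb: "finite_measure (leb \<omega>)"
  by (rule finite_measure_lebesgue_on) simp

text \<open>Rests on the completeness of Lebesgue measure. \<open>J\<close> is a pointwise
  derivative that is known only up to null sets, and this is how its measurability is
  obtained.\<close>

lemma borel_measurable_leb_AE: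
  fixes f g :: "real \<Rightarrow> complex"
  assumes "f \<in> borel_measurable (leb \<omega>)" "AE x in leb \<omega>. f x = g x"
  shows "g \<in> borel_measurable (leb \<omega>)"
proof -
  have "(\<lambda>x. if x \<in> {0<..<\<omega>} then f x else 0) \<in> borel_measurable lebesgue"
    by (subst borel_measurable_if) (use assms(1) in auto)
  moreover have "AE x in lebesgue. x \<in> {0<..<\<omega>} \<longrightarrow> f x = g x"
    using assms(2) by (simp add: AE_restrict_space_iff)
  then have "AE x in lebesgue. (if x \<in> {0<..<\<omega>} then f x else 0) = (if x \<in> {0<..<\<omega>} then g x else 0)"
    by eventually_elim auto
  ultimately have "(\<lambda>x. if x \<in> {0<..<\<omega>} then g x else 0) \<in> borel_measurable lebesgue"
    by (rule borel_measurable_AE)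
  then show ?thesis by (rule borel_measurable_if_D)
qed

lemma L2_leb_AE:
  assumes "f \<in> L2 (leb \<omega>)" "AE x in leb \<omega>. f x = g x"
  shows "g \<in> L2 (leb \<omega>)"
proof (rule L2_I)
  have [measurable]: "f \<in> borel_measurable (leb \<omega>)" by (rule L2_measurable[OF assms(1)])
  show [measurable]: "g \<in> borel_measurable (leb \<omega>)"
    by (rule borel_measurable_leb_AE[OF _ assms(2)]) simp
  show "integrable (leb \<omega>) (\<lambda>x. (norm (g x))\<^sup>2)"
    by (rule integrable_cong_AE_imp[OF L2_integrable[OF assms(1)]])
       (use assms(2) in \<open>auto elim!: eventually_mono\<close>)
qed

lemma borel_imp_leb_measurable [measurable (raw)]:
  "f \<in> borel_measurable borel \<Longrightarrow> f \<in> borel_measurable (leb \<omega>)"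
  by (intro measurable_restrict_space1 measurable_completion) simp

text \<open>The condition \<open>sum c A = 0\<close> makes a step function vanish beyond \<open>\<omega>\<close>.\<close>

definition steps :: "real \<Rightarrow> (real \<Rightarrow> complex) set" where
  "steps \<omega> = {s. \<exists>A c. finite A \<and> A \<subseteq> {0..\<omega>} \<and> sum c A = 0 \<and>
                 s = (\<lambda>x. \<Sum>a\<in>A. c a * indicator {a<..} x)}"

lemma steps_add:
  assumes "s \<in> steps \<omega>" "s' \<in> steps \<omega>"
  shows "(\<lambda>x. s x + s' x) \<in> steps \<omega>"
proof -
  obtain A c where s: "finite A" "A \<subseteq> {0..\<omega>}" "sum c A = 0" "s = (\<lambda>x. \<Sum>a\<in>A. c a * indicator {a<..} x)"
    using assms(1) unfolding steps_def by blast
  obtain A' c' where s': "finite A'" "A' \<subseteq> {0..\<omega>}" "sum c' A' = 0" "s' = (\<lambda>x. \<Sum>a\<in>A'. c' a * indicator {a<..} x)"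
    using assms(2) unfolding steps_def by blast
  define d where "d a = (if a \<in> A then c a else 0) + (if a \<in> A' then c' a else 0)" for a
  have split: "(\<Sum>a\<in>A \<union> A'. d a * h a) = (\<Sum>a\<in>A. c a * h a) + (\<Sum>a\<in>A'. c' a * h a)" for h
  proof -
    have "(\<Sum>a\<in>A \<union> A'. d a * h a) = (\<Sum>a\<in>A \<union> A'. if a \<in> A then c a * h a else 0)
        + (\<Sum>a\<in>A \<union> A'. if a \<in> A' then c' a * h a else 0)"
      by (simp add: d_def flip: sum.distrib) (rule sum.cong, auto simp: algebra_simps)
    also have "(\<Sum>a\<in>A \<union> A'. if a \<in> A then c a * h a else 0) = (\<Sum>a\<in>A. c a * h a)"
      by (subst sum.inter_restrict[symmetric]) (use s s' in \<open>auto intro!: sum.cong\<close>)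
    also have "(\<Sum>a\<in>A \<union> A'. if a \<in> A' then c' a * h a else 0) = (\<Sum>a\<in>A'. c' a * h a)"
      by (subst sum.inter_restrict[symmetric]) (use s s' in \<open>auto intro!: sum.cong\<close>)
    finally show ?thesis .
  qed
  show ?thesis
    unfolding steps_def
  proof (intro CollectI exI[of _ "A \<union> A'"] exI[of _ d] conjI)
    show "sum d (A \<union> A') = 0" using split[of "\<lambda>_. 1"] s s' by simp
    show "(\<lambda>x. s x + s' x) = (\<lambda>x. \<Sum>a\<in>A \<union> A'. d a * indicator {a<..} x)"
      unfolding s(4) s'(4) split ..
  qed (use s s' in auto)
qed

lemma steps_cmult:
  assumes "s \<in> steps \<omega>"
  shows "(\<lambda>x. b * s x) \<in> steps \<omega>"
proof -
  obtain A c where s: "finite A" "A \<subseteq> {0..\<omega>}" "sum c A = 0" "s = (\<lambda>x. \<Sum>a\<in>A. c a * indicator {a<..} x)"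
    using assms(1) unfolding steps_def by blast
  then show ?thesis
    unfolding steps_def
    by (intro CollectI exI[of _ A] exI[of _ "\<lambda>a. b * c a"])
       (auto simp: sum_distrib_left mult.assoc simp flip: sum_distrib_left)
qed

lemma steps_zero: "(\<lambda>x. 0) \<in> steps \<omega>"
  unfolding steps_def by (intro CollectI exI[of _ "{}"]) auto

lemma steps_interval:
  assumes "0 \<le> a" "a \<le> \<omega>"
  shows "(\<lambda>x. indicator {a<..\<omega>} x) \<in> steps \<omega>"
proof (cases "a = \<omega>")
  case True
  then show ?thesis using steps_zero by simp
next
  case False
  show ?thesis
    unfolding steps_def
    by (rule CollectI, rule exI[of _ "{a, \<omega>}"], rule exI[of _ "\<lambda>x. if x = a then 1 else -1"])
       (use assms False in \<open>auto simp: indicator_def fun_eq_iff\<close>)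
qed

lemma steps_measurable [measurable]:
  assumes "s \<in> steps \<omega>"
  shows "s \<in> borel_measurable borel"
proof -
  obtain A c where s: "s = (\<lambda>x. \<Sum>a\<in>A. c a * indicator {a<..} x)"
    using assms(1) unfolding steps_def by blast
  show ?thesis unfolding s by measurable
qed

lemma steps_L2:
  assumes "s \<in> steps \<omega>"
  shows "s \<in> L2 (leb \<omega>)"
proof -
  interpret finite_measure "leb \<omega>" by (rule finite_measure_leb)
  obtain A c where s: "s = (\<lambda>x. \<Sum>a\<in>A. c a * indicator {a<..} x)"
    using assms(1) unfolding steps_def by blast
  have "(\<lambda>x. (c a * indicator {a<..} x) * 1) \<in> L2 (leb \<omega>)" for a
    by (rule L2_mult_bounded[OF L2_const, where C = "norm (c a)"]) (auto simp: indicator_def norm_mult)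
  then show ?thesis unfolding s by (intro L2_sum) simp
qed

text \<open>The functions approximable by step functions form a closed subspace; the sets whose
  indicators belong to it form a Dynkin system containing the half lines.\<close>

lemma steps_dense:
  assumes "0 < \<omega>" "f \<in> L2 (leb \<omega>)" "0 < e"
  shows "\<exists>s\<in>steps \<omega>. L2_norm (leb \<omega>) (\<lambda>x. f x - s x) < e"
proof -
  interpret finite_measure "leb \<omega>" by (rule finite_measure_leb)
  define P where "P f \<longleftrightarrow> f \<in> L2 (leb \<omega>) \<and> (\<forall>e>0. \<exists>s\<in>steps \<omega>. L2_norm (leb \<omega>) (\<lambda>x. f x - s x) < e)" for f
  have P_lim: "P f" if f: "f \<in> L2 (leb \<omega>)" and
    ap: "\<And>e. 0 < e \<Longrightarrow> \<exists>g. P g \<and> L2_norm (leb \<omega>) (\<lambda>x. f x - g x) < e" for f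
    unfolding P_def
  proof (intro conjI allI impI f)
    fix e :: real assume "0 < e"
    then obtain g where g: "P g" "L2_norm (leb \<omega>) (\<lambda>x. f x - g x) < e / 2"
      using ap[of "e/2"] by auto
    then obtain s where s: "s \<in> steps \<omega>" "L2_norm (leb \<omega>) (\<lambda>x. g x - s x) < e / 2"
      using \<open>0 < e\<close> unfolding P_def by (metis half_gt_zero)
    have "L2_norm (leb \<omega>) (\<lambda>x. f x - s x) < e"
      using L2_norm_triangle3[OF f, of g s] g s steps_L2[OF s(1)] by (simp add: P_def)
    then show "\<exists>s\<in>steps \<omega>. L2_norm (leb \<omega>) (\<lambda>x. f x - s x) < e" using s by blast
  qed
  have P_seq: "P l" if "L2_tendsto (leb \<omega>) g l sequentially" "\<And>n. P (g n)" for g l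
  proof (rule P_lim)
    fix e :: real assume "0 < e"
    then have "\<forall>\<^sub>F n in sequentially. L2_norm (leb \<omega>) (\<lambda>x. g n x - l x) < e"
      using that(1) by (intro order_tendstoD(2)[where y = 0]) (auto simp: L2_tendsto_def)
    then obtain n where "L2_norm (leb \<omega>) (\<lambda>x. g n x - l x) < e"
      unfolding eventually_sequentially by blast
    then show "\<exists>g. P g \<and> L2_norm (leb \<omega>) (\<lambda>x. l x - g x) < e"
      using that(2)[of n] L2_norm_minus_commute[of "leb \<omega>" l "g n"] by auto
  qed (use that in \<open>simp add: L2_tendsto_def\<close>)
  have P_steps: "P s" if "s \<in> steps \<omega>" for s
    unfolding P_def using steps_L2[OF that] that by (auto intro!: bexI[of _ s])
  have P_cong: "P g" if f: "P f" and eq: "AE x in leb \<omega>. f x = g x" for f g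
  proof (rule P_lim)
    show g: "g \<in> L2 (leb \<omega>)" using L2_leb_AE[OF _ eq] f by (simp add: P_def)
    have "L2_norm (leb \<omega>) (\<lambda>x. g x - f x) = 0"
      by (rule L2_norm_diff_eq_0) (use f g eq in \<open>auto simp: P_def L2_measurable elim: eventually_mono\<close>)
    then show "\<exists>h. P h \<and> L2_norm (leb \<omega>) (\<lambda>x. g x - h x) < e" if "0 < e" for e
      using f that by auto
  qed
  have P_add: "P (\<lambda>x. f x + g x)" if fg: "P f" "P g" for f g
    unfolding P_def
  proof (intro conjI allI impI)
    show "(\<lambda>x. f x + g x) \<in> L2 (leb \<omega>)" using fg by (auto simp: P_def intro: L2_add)
    fix e :: real assume "0 < e"
    obtain s where s: "s \<in> steps \<omega>" "L2_norm (leb \<omega>) (\<lambda>x. f x - s x) < e / 2"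
      using \<open>0 < e\<close> fg unfolding P_def by (metis half_gt_zero)
    obtain s' where s': "s' \<in> steps \<omega>" "L2_norm (leb \<omega>) (\<lambda>x. g x - s' x) < e / 2"
      using \<open>0 < e\<close> fg unfolding P_def by (metis half_gt_zero)
    have "L2_norm (leb \<omega>) (\<lambda>x. (f x - s x) + (g x - s' x)) < e"
      using L2_norm_triangle[of "\<lambda>x. f x - s x" "leb \<omega>" "\<lambda>x. g x - s' x"] s s' fg
      by (force simp: P_def intro: L2_diff steps_L2)
    then show "\<exists>s\<in>steps \<omega>. L2_norm (leb \<omega>) (\<lambda>x. f x + g x - s x) < e"
      using steps_add[OF s(1) s'(1)] by (intro bexI[of _ "\<lambda>x. s x + s' x"]) (auto simp: algebra_simps)
  qed
  have P_cmult: "P (\<lambda>x. b * f x)" if f: "P f" for f b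
    unfolding P_def
  proof (intro conjI allI impI)
    show "(\<lambda>x. b * f x) \<in> L2 (leb \<omega>)" using f by (auto simp: P_def intro: L2_cmult)
    fix e :: real assume "0 < e"
    obtain s where s: "s \<in> steps \<omega>" "L2_norm (leb \<omega>) (\<lambda>x. f x - s x) < e / (norm b + 1)"
      using \<open>0 < e\<close> f unfolding P_def by (metis add_nonneg_pos divide_pos_pos norm_ge_zero zero_less_one)
    have "L2_norm (leb \<omega>) (\<lambda>x. b * f x - b * s x) = norm b * L2_norm (leb \<omega>) (\<lambda>x. f x - s x)"
      by (simp add: L2_norm_cmult flip: right_diff_distrib)
    also have "\<dots> \<le> norm b * (e / (norm b + 1))"
      using s by (intro mult_left_mono) auto
    also have "\<dots> < e" using \<open>0 < e\<close> by (simp add: pos_divide_less_eq add_nonneg_pos distrib_left mult.commute)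
    finally show "\<exists>s\<in>steps \<omega>. L2_norm (leb \<omega>) (\<lambda>x. b * f x - s x) < e"
      using steps_cmult[OF s(1)] by (intro bexI[of _ "\<lambda>x. b * s x"]) auto
  qed
  have P_zero: "P (\<lambda>x. 0)" by (rule P_steps[OF steps_zero])
  have P_sum: "P (\<lambda>x. \<Sum>i\<in>I. h i x)" if "\<And>i. i \<in> I \<Longrightarrow> P (h i)" for h and I :: "'i set"
    using that by (induction I rule: infinite_finite_induct) (auto intro: P_add P_zero)
  have P_halfline: "P (\<lambda>x. indicator {a<..} x)" for a
  proof -
    \<comment> \<open>Only the part of a half line inside (0, \<omega>) matters, so its end point is
      clipped to [0, \<omega>].\<close>
    define b where "b = max 0 (min a \<omega>)"
    have "(\<lambda>x. indicator {b<..\<omega>} x) \<in> steps \<omega>"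
      using assms(1) by (intro steps_interval) (auto simp: b_def)
    from P_steps[OF this] show ?thesis
      by (rule P_cong, intro AE_I2) (auto simp: b_def indicator_def)
  qed
  have P_borel: "P (\<lambda>x. indicator S x)" if "S \<in> sets borel" for S
  proof -
    have gen: "sets borel = sigma_sets UNIV (range (\<lambda>a::real. {a<..}))"
      by (subst borel_Ioi) (simp add: sets_measure_of)
    have S: "S \<in> sigma_sets UNIV (range (\<lambda>a::real. {a<..}))" using that gen by simp
    have "{a<..} \<inter> {b<..} = {max a b<..}" for a b :: real by auto
    then have "Int_stable (range (\<lambda>a::real. {a<..}))" by (auto simp: Int_stable_def)
    from this subset_Pow_Union[THEN order_trans[OF _ Pow_mono[OF subset_UNIV]]] S show ?thesis
    proof (induction rule: sigma_sets_induct_disjoint)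
      case empty
      show ?case using P_zero by simp
    next
      case (compl S)
      \<comment> \<open>On (0, \<omega>) the constant 1 is the indicator of the half line
        \<open>{0<..}\<close>, so complements are differences.\<close>
      have "P (\<lambda>x. 1 + (-1) * indicator S x)"
        by (intro P_add P_cmult compl P_cong[OF P_halfline[of 0]] AE_I2) auto
      then show ?case by (rule P_cong) (auto simp: indicator_def)
    next
      case (union D)
      have D: "D i \<in> sets borel" for i using union(2) gen by auto
      have "L2_tendsto (leb \<omega>) (\<lambda>n x. \<Sum>i<n. indicator (D i) x) (\<lambda>x. indicator (\<Union>i. D i) x) sequentially"
      proof (rule L2_tendsto_dominated_seq[where w = "\<lambda>x. 1"])
        show "AE x in leb \<omega>. (\<lambda>n. \<Sum>i<n. indicator (D i) x) \<longlonglongrightarrow> (indicator (\<Union>i. D i) x :: complex)"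
        proof (rule AE_I2)
          fix x
          have "(\<lambda>i. indicator (D i) x :: real) sums indicator (\<Union>i. D i) x"
            by (rule indicator_sums) (use union(1) in \<open>auto simp: disjoint_family_on_def\<close>)
          then have "(\<lambda>i. complex_of_real (indicator (D i) x)) sums complex_of_real (indicator (\<Union>i. D i) x)"
            by (rule sums_of_real)
          then show "(\<lambda>n. \<Sum>i<n. indicator (D i) x) \<longlonglongrightarrow> (indicator (\<Union>i. D i) x :: complex)"
            by (simp add: sums_def of_real_indicator)
        qed
        show "AE x in leb \<omega>. norm (\<Sum>i<n. indicator (D i) x :: complex) \<le> norm (1::complex)" for n
        proof (rule AE_I2)
          fix x
          have "(\<Sum>i<n. indicator (D i) x :: complex) = indicator (\<Union>i<n. D i) x"
            by (rule indicator_UN_disjoint[symmetric])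
               (use union(1) in \<open>auto simp: disjoint_family_on_def\<close>)
          then show "norm (\<Sum>i<n. indicator (D i) x :: complex) \<le> norm (1::complex)"
            by (simp add: indicator_def)
        qed
        show "(\<lambda>x. \<Sum>i<n. indicator (D i) x :: complex) \<in> borel_measurable (leb \<omega>)" for n
          using D by measurable
        show "(\<lambda>x. indicator (\<Union>i. D i) x :: complex) \<in> borel_measurable (leb \<omega>)"
          using D by (intro borel_imp_leb_measurable borel_measurable_indicator) auto
      qed (rule L2_const)
      then show ?case
        by (rule P_seq) (intro P_sum union(3))
    qed (use P_halfline in auto)
  qed
  have P_lebesgue: "P (\<lambda>x. indicator S x)" if S: "S \<in> sets (leb \<omega>)" for S
  proof -
    have "S \<in> sets lebesgue" using S by (auto simp: sets_restrict_space)
    \<comment> \<open>A Lebesgue set is a Borel set up to a null set, which L^2 does not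
      see.\<close>
    then obtain T N N' where T: "S = T \<union> N" "N \<subseteq> N'" "N' \<in> null_sets lborel" "T \<in> sets lborel"
      by (rule sets_completionE)
    have "AE x in lebesgue. x \<notin> N'"
      using T(3) by (intro AE_completion AE_not_in)
    then have "AE x in leb \<omega>. x \<notin> N'"
      by (subst AE_restrict_space_iff) (auto elim: eventually_mono)
    then have "AE x in leb \<omega>. (indicator T x :: complex) = indicator S x"
      by eventually_elim (use T in \<open>auto simp: indicator_def\<close>)
    then show ?thesis using P_borel[of T] T(4) P_cong by auto
  qed
  have P_simple: "P h" if h: "simple_function (leb \<omega>) h" for h
  proof -
    have "P (\<lambda>x. \<Sum>y\<in>h ` space (leb \<omega>). y * indicator (h -` {y} \<inter> space (leb \<omega>)) x)"
      using h by (intro P_sum P_cmult P_lebesgue simple_functionD)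
    then show ?thesis
      by (rule P_cong, intro AE_I2, subst simple_function_indicator_representation_banach[OF h])
         (auto intro!: sum.cong simp: indicator_def)
  qed
  note [measurable] = L2_measurable[OF assms(2)]
  obtain F where F: "\<And>i. simple_function (leb \<omega>) (F i)"
    "\<And>x. x \<in> space (leb \<omega>) \<Longrightarrow> (\<lambda>i. F i x) \<longlonglongrightarrow> f x"
    "\<And>i x. x \<in> space (leb \<omega>) \<Longrightarrow> dist (F i x) 0 \<le> 2 * dist (f x) 0"
    using borel_measurable_implies_sequence_metric[OF L2_measurable[OF assms(2)], of 0] by blast
  have "L2_tendsto (leb \<omega>) F f sequentially"
  proof (rule L2_tendsto_dominated_seq[where w = "\<lambda>x. 2 * f x"])
    show "F n \<in> borel_measurable (leb \<omega>)" for n by (rule borel_measurable_simple_function[OF F(1)])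
    show "AE x in leb \<omega>. (\<lambda>n. F n x) \<longlonglongrightarrow> f x" using F(2) by (intro AE_I2)
    show "AE x in leb \<omega>. norm (F n x) \<le> norm (2 * f x)" for n
      using F(3) by (intro AE_I2) (simp add: norm_mult)
  qed (use assms in \<open>auto intro: L2_cmult\<close>)
  then have "P f" using P_seq P_simple F(1) by blast
  then show ?thesis using assms(3) by (simp add: P_def)
qed

section \<open>Lebesgue differentiation from both sides\<close>

lemma negligible_uminus:
  fixes N :: "real set"
  assumes "negligible N"
  shows "negligible {x. - x \<in> N}"
proof -
  have "negligible (uminus ` N)"
    by (rule negligible_differentiable_image_negligible[OF _ assms]) (auto intro!: derivative_intros)
  then show ?thesis by (rule negligible_subset) force
qed

text \<open>Lebesgue differentiation: the library provides right derivatives almost everywhere, and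
  reflection gives the left ones.\<close>

lemma primitive_has_vector_derivative_AE:
  assumes f: "f \<in> L2 (leb \<omega>)"
  shows "AE x in leb \<omega>. ((\<lambda>u. LINT t:{0<..<u}|lebesgue. f t) has_vector_derivative f x) (at x)"
proof -
  interpret finite_measure "leb \<omega>" by (rule finite_measure_leb)
  define g where "g x = (if x \<in> {0<..<\<omega>} then f x else 0)" for x
  have ig: "integrable lebesgue g"
    using L2_imp_integrable[OF f]
    by (simp add: integrable_restrict_space g_def[abs_def] indicator_scaleR_eq_if)
  have si: "set_integrable lebesgue S g" if "S \<in> sets lebesgue" for S
    unfolding set_integrable_def using ig that integrable_mult_indicator by blast
  have int: "g integrable_on {a..b}" for a b
    using set_lebesgue_integral_eq_integral(1)[OF si[of "{a..b}"]] by simp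
  define F where "F u = (LINT t:{0<..<u}|lebesgue. f t)" for u
  have F_eq: "F u = integral {0..u} g" if "0 < u" "u < \<omega>" for u
  proof -
    have "F u = (LINT t:{0<..<u}|lebesgue. g t)"
      unfolding F_def by (rule set_lebesgue_integral_cong) (use that in \<open>auto simp: g_def\<close>)
    also have "\<dots> = integral {0<..<u} g"
      by (rule set_lebesgue_integral_eq_integral(2)[OF si]) simp
    also have "\<dots> = integral {0..u} g"
      using integral_open_interval_real[of 0 u g] by simp
    finally show ?thesis .
  qed
  obtain N where N: "negligible N" "\<And>x e. \<lbrakk>x \<notin> N; 0 < e\<rbrakk> \<Longrightarrow>
      \<exists>d>0. \<forall>h. 0 < h \<and> h < d \<longrightarrow> norm (integral {x..x + h} g /\<^sub>R h - g x) < e"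
    using integrable_ccontinuous_explicit[of g] int by (auto simp: cbox_interval)
  have int': "(\<lambda>x. g (- x)) integrable_on {a..b}" for a b
    using int[of "-b" "-a"] Henstock_Kurzweil_Integration.integrable_reflect_real[where f = g and a = "-b" and b = "-a"] by simp
  obtain N' where N': "negligible N'" "\<And>x e. \<lbrakk>x \<notin> N'; 0 < e\<rbrakk> \<Longrightarrow>
      \<exists>d>0. \<forall>h. 0 < h \<and> h < d \<longrightarrow> norm (integral {x..x + h} (\<lambda>x. g (- x)) /\<^sub>R h - g (- x)) < e"
    using integrable_ccontinuous_explicit[of "\<lambda>x. g (- x)"] int' by (auto simp: cbox_interval)
  have main: "(F has_vector_derivative f x) (at x)" if x: "0 < x" "x < \<omega>" "x \<notin> N" "- x \<notin> N'" for x
    unfolding has_vector_derivative_def has_derivative_at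
  proof (intro conjI)
    show "bounded_linear (\<lambda>h. h *\<^sub>R f x)" by (rule bounded_linear_scaleR_left)
    show "(\<lambda>h. norm (F (x + h) - F x - h *\<^sub>R f x) / norm h) \<midarrow>0\<rightarrow> 0"
      unfolding LIM_eq
    proof (intro allI impI)
      fix e :: real assume "0 < e"
      have gx: "g x = f x" using x by (simp add: g_def)
      obtain d where d: "d > 0" "\<And>h. 0 < h \<Longrightarrow> h < d \<Longrightarrow> norm (integral {x..x + h} g /\<^sub>R h - f x) < e"
        using N(2)[OF x(3) \<open>0 < e\<close>] gx by auto
      obtain d' where d': "d' > 0" "\<And>h. 0 < h \<Longrightarrow> h < d' \<Longrightarrow>
          norm (integral {- x..- x + h} (\<lambda>x. g (- x)) /\<^sub>R h - f x) < e"
        using N'(2)[OF x(4) \<open>0 < e\<close>] gx by auto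
      \<comment> \<open>Small enough for both one-sided estimates and for \<open>x + h\<close> to
        stay inside the interval, where \<open>F_eq\<close> is valid.\<close>
      define k where "k = min (min d d') (min x (\<omega> - x))"
      have "0 < k" using d d' x by (simp add: k_def)
      moreover have "norm (norm (F (x + h) - F x - h *\<^sub>R f x) / norm h - 0) < e"
        if h: "h \<noteq> 0" "norm (h - 0) < k" for h
      proof (cases "h > 0")
        case True
        have "integral {0..x} g + integral {x..x+h} g = integral {0..x+h} g"
          by (rule Henstock_Kurzweil_Integration.integral_combine) (use x True int in auto)
        then have "F (x + h) - F x = integral {x..x+h} g"
          using F_eq[of x] F_eq[of "x + h"] h True x by (simp add: k_def algebra_simps)
        then have "F (x + h) - F x - h *\<^sub>R f x = h *\<^sub>R (integral {x..x + h} g /\<^sub>R h - f x)"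
          using True by (simp add: scaleR_diff_right)
        then have "norm (F (x + h) - F x - h *\<^sub>R f x) / norm h = norm (integral {x..x + h} g /\<^sub>R h - f x)"
          using True by simp
        then show ?thesis using d(2)[of h] True h by (simp add: k_def)
      next
        case False
        define m where "m = - h"
        have m: "0 < m" "m < k" using False h by (auto simp: m_def)
        have "integral {0..x-m} g + integral {x-m..x} g = integral {0..x} g"
          by (rule Henstock_Kurzweil_Integration.integral_combine) (use x m int in \<open>auto simp: k_def\<close>)
        moreover have "integral {x-m..x} g = integral {-x..-x+m} (\<lambda>x. g (- x))"
          using Henstock_Kurzweil_Integration.integral_reflect_real[where f = g and a = "x - m" and b = x] by (simp add: algebra_simps)
        ultimately have "F (x + h) - F x = - integral {-x..-x+m} (\<lambda>x. g (- x))"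
          using F_eq[of x] F_eq[of "x - m"] m x by (simp add: k_def algebra_simps m_def)
        then have "F (x + h) - F x - h *\<^sub>R f x = (- m) *\<^sub>R (integral {-x..-x+m} (\<lambda>x. g (- x)) /\<^sub>R m - f x)"
          using m by (simp add: scaleR_diff_right m_def)
        then have "norm (F (x + h) - F x - h *\<^sub>R f x) / norm h = norm (integral {-x..-x+m} (\<lambda>x. g (- x)) /\<^sub>R m - f x)"
          using m by (simp add: m_def)
        then show ?thesis using d'(2)[of m] m by (simp add: k_def)
      qed
      ultimately show "\<exists>s>0. \<forall>h. h \<noteq> 0 \<and> norm (h - 0) < s \<longrightarrow>
          norm (norm (F (x + h) - F x - h *\<^sub>R f x) / norm h - 0) < e"
        by blast
    qed
  qed
  have "negligible (N \<union> {x. - x \<in> N'})"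
    using N(1) negligible_uminus[OF N'(1)] by (rule negligible_Un)
  then have "AE x in lebesgue. x \<notin> N \<union> {x. - x \<in> N'}"
    by (intro AE_not_in) (simp add: negligible_iff_null_sets)
  then have "AE x in lebesgue. x \<in> {0<..<\<omega>} \<longrightarrow> (F has_vector_derivative f x) (at x)"
    by (rule eventually_mono) (use main in auto)
  then show ?thesis
    unfolding F_def by (subst AE_restrict_space_iff) auto
qed

section \<open>Laplace transform of truncated powers\<close>

text \<open>The truncated power \<open>w\<^sub>+\<^sup>s\<close>, with value \<open>0\<close> at \<open>w \<le> 0\<close> also for \<open>s = 0\<close>.\<close>

definition tpow :: "complex \<Rightarrow> real \<Rightarrow> complex" where
  "tpow s w = (if 0 < w then exp (s * of_real (ln w)) else 0)"

lemma tpow_eq_powr: "0 < w \<Longrightarrow> tpow s w = complex_of_real w powr s"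
  by (simp add: tpow_def powr_def Ln_of_real)

lemma tpow_nonpos [simp]: "w \<le> 0 \<Longrightarrow> tpow s w = 0"
  by (simp add: tpow_def)

lemma tpow_measurable [measurable]: "tpow s \<in> borel_measurable borel"
  unfolding tpow_def[abs_def] by measurable

lemma norm_tpow: "0 < w \<Longrightarrow> norm (tpow s w) = w powr Re s"
  by (simp add: tpow_def powr_def)

lemma norm_tpow_imaginary: "Re s = 0 \<Longrightarrow> norm (tpow s w) = indicator {0<..} w"
  by (simp add: tpow_def indicator_def)

lemma norm_tpow_imaginary_le: "Re s = 0 \<Longrightarrow> norm (tpow s w) \<le> 1"
  by (simp add: norm_tpow_imaginary indicator_def)

lemma tpow_add: "tpow s w * tpow s' w = tpow (s + s') w"
  by (simp add: tpow_def exp_add distrib_right)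

lemma tpow_mult: "0 < c \<Longrightarrow> tpow s (c * w) = tpow s c * tpow s w"
  by (simp add: tpow_def ln_mult exp_add distrib_left zero_less_mult_iff)

lemma tpow_zero: "tpow 0 w = indicator {0<..} w"
  by (simp add: tpow_def indicator_def)

lemma tpow_of_nat: "0 < w \<Longrightarrow> tpow (of_nat n) w = of_real w ^ n"
  by (simp add: tpow_eq_powr powr_nat)

lemma tpow_has_vector_derivative [derivative_intros]:
  assumes "0 < w"
  shows "(tpow s has_vector_derivative s * tpow (s - 1) w) (at w)"
proof -
  have "((\<lambda>w. complex_of_real (ln w)) has_vector_derivative complex_of_real (1 / w)) (at w)"
    using assms by (intro has_vector_derivative_of_real) (auto intro!: derivative_eq_intros simp: has_real_derivative_iff_has_vector_derivative[symmetric] divide_inverse)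
  then have "((\<lambda>w. s * complex_of_real (ln w)) has_vector_derivative s * complex_of_real (1 / w)) (at w)"
    by (rule has_vector_derivative_mult_right)
  from field_vector_diff_chain_at[OF this DERIV_exp]
  have "((\<lambda>w. exp (s * complex_of_real (ln w))) has_vector_derivative
      (s * complex_of_real (1 / w)) * exp (s * complex_of_real (ln w))) (at w)"
    by (simp add: o_def)
  moreover have "(s * complex_of_real (1 / w)) * exp (s * complex_of_real (ln w)) = s * tpow (s - 1) w"
    using assms by (simp add: tpow_def left_diff_distrib exp_diff divide_simps exp_of_real)
  ultimately have "((\<lambda>w. exp (s * complex_of_real (ln w))) has_vector_derivative s * tpow (s - 1) w) (at w)"
    by simp
  then show ?thesis
    by (rule has_vector_derivative_transform_within_open[where S = "{0<..}"]) (use assms in \<open>auto simp: tpow_def\<close>)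
qed

lemma isCont_tpow: "0 < w \<Longrightarrow> isCont (tpow s) w"
  using tpow_has_vector_derivative has_vector_derivative_continuous by blast

lemma isCont_tpow_neg: "w < 0 \<Longrightarrow> isCont (tpow s) w"
  by (subst isCont_cong[where g = "\<lambda>_. 0"])
     (auto simp: eventually_nhds intro!: exI[of _ "{..<0}"])

text \<open>Euler's integral as a Bochner integral over the whole line: the cut at 0 sits inside
  \<open>tpow\<close>, so that the scalings and translations below are plain affine
  substitutions.\<close>

lemma Gamma_integral_tpow_1:
  assumes "Re s > 0"
  shows "has_bochner_integral lborel (\<lambda>w. tpow (s - 1) w * exp (- of_real w)) (Gamma s)"
proof -
  define f where "f = (\<lambda>w. tpow (s - 1) w * exp (- complex_of_real w))"
  have eq: "complex_of_real t powr (s - 1) / complex_of_real (exp t) = f t" if "t > 0" for t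
    using that by (simp add: f_def tpow_eq_powr exp_minus divide_inverse exp_of_real)
  have "(\<lambda>t. complex_of_real t powr (s - 1) / of_real (exp (1 * t))) absolutely_integrable_on {0<..}"
    by (rule absolutely_integrable_Gamma_integral) (use assms in auto)
  then have "f absolutely_integrable_on {0<..}"
    using eq by (subst (asm) set_integrable_cong[where f' = f]) auto
  moreover have "indicator {0<..} w *\<^sub>R f w = f w" for w
    by (simp add: f_def indicator_def)
  ultimately have int: "integrable lebesgue f" by (simp add: set_integrable_def)
  have [measurable]: "f \<in> borel_measurable borel" unfolding f_def by measurable
  have int': "integrable lborel f" using int by (simp add: integrable_completion)
  have "(f has_integral Gamma s) {0..}"
    by (rule has_integral_spike[OF negligible_sing[of 0] _ Gamma_integral_complex[OF assms]])
       (use eq in auto)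
  moreover have "(f has_integral integral\<^sup>L lborel f) {0..}"
  proof -
    have "(f has_integral integral\<^sup>L lborel f) UNIV" by (rule has_integral_integral_lborel[OF int'])
    then have "((\<lambda>x. if x \<in> {0..} then f x else 0) has_integral integral\<^sup>L lborel f) UNIV"
      by (rule has_integral_eq[rotated]) (auto simp: f_def)
    then show ?thesis by (simp only: has_integral_restrict_UNIV)
  qed
  ultimately have "integral\<^sup>L lborel f = Gamma s" by (rule has_integral_unique[rotated])
  with int' show ?thesis by (simp add: has_bochner_integral_iff f_def)
qed

lemma Gamma_integral_tpow:
  assumes "Re s > 0" "0 < c"
  shows "has_bochner_integral lborel (\<lambda>w. tpow (s - 1) w * exp (- of_real (c * w))) (Gamma s * tpow (- s) c)"
proof -
  have "has_bochner_integral lborel (\<lambda>w. tpow (s - 1) (0 + c * w) * exp (- of_real (0 + c * w))) (Gamma s /\<^sub>R \<bar>c\<bar>)"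
    using Gamma_integral_tpow_1[OF assms(1)] assms(2)
    by (subst (asm) lborel_has_bochner_integral_real_affine_iff[where c = c and t = 0]) auto
  \<comment> \<open>\<open>tpow (1 - s) c\<close> cancels the factor \<open>tpow (s - 1) c\<close>
    that homogeneity pulls out of the integrand.\<close>
  then have "has_bochner_integral lborel (\<lambda>w. tpow (1 - s) c * (tpow (s - 1) (0 + c * w) * exp (- of_real (0 + c * w)))) (tpow (1 - s) c * (Gamma s /\<^sub>R \<bar>c\<bar>))"
    by (intro has_bochner_integral_mult_right) auto
  moreover have "tpow (1 - s) c * (tpow (s - 1) (0 + c * w) * exp (- of_real (0 + c * w))) = tpow (s - 1) w * exp (- of_real (c * w))" for w
    using assms(2) by (simp add: tpow_mult tpow_add tpow_zero flip: mult.assoc)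
  moreover have "tpow (1 - s) c * (Gamma s /\<^sub>R \<bar>c\<bar>) = Gamma s * tpow (- s) c"
  proof -
    have "tpow (1 - s) c = tpow (- s) c * of_real c"
      using tpow_add[of "-s" c 1] tpow_of_nat[of c 1] assms(2) by simp
    then show ?thesis using assms(2) by (simp add: scaleR_conv_of_real field_simps)
  qed
  ultimately show ?thesis by (simp only:)
qed

text \<open>The integral is expanded around a large positive number \<open>c\<close>, where it is a binomial
  series; this replaces analytic continuation from the positive axis.\<close>

lemma Laplace_tpow:
  assumes \<alpha>: "Re \<alpha> = 0" and z: "0 < Re z"
  shows "has_bochner_integral lborel (\<lambda>w. tpow \<alpha> w * exp (- z * of_real w)) (Gamma (\<alpha> + 1) * z powr (- \<alpha> - 1))"
proof -
  have nz: "z \<noteq> 0" using z by auto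
  \<comment> \<open>Since |z - c|^2 = |z|^2 - 2 c Re z + c^2, this choice of \<open>c\<close> gives
    c^2 - |z|^2, so that \<open>z\<close> lies in the disc of radius \<open>c\<close> around
    \<open>c\<close> and \<eta> in the unit disc.\<close>
  define c where "c = (norm z)\<^sup>2 / Re z"
  have c: "0 < c" using z nz by (simp add: c_def)
  define \<eta> where "\<eta> = (z - of_real c) / of_real c"
  have z_eq: "z = of_real c * (1 + \<eta>)" using c by (simp add: \<eta>_def field_simps)
  have "(norm (z - of_real c))\<^sup>2 = (norm z)\<^sup>2 - 2 * c * Re z + c\<^sup>2"
    by (simp only: cmod_power2) (simp add: power2_eq_square algebra_simps)
  also have "\<dots> < c\<^sup>2" using z nz by (simp add: c_def)
  finally have "norm (z - of_real c) < c" using c by (simp add: power_less_imp_less_base)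
  then have \<eta>: "norm \<eta> < 1" using c by (simp add: \<eta>_def norm_divide)
  \<comment> \<open>The terms of exp(-zw) = exp(-cw) exp(-c\<eta>w) with the second factor expanded,
    each multiplied by \<open>tpow \<alpha> w\<close>.\<close>
  define F where "F n w = tpow \<alpha> w * exp (- of_real (c * w)) * ((- of_real c * \<eta> * of_real w) ^ n / fact n)" for n w
  have F_eq: "F n w = ((- of_real c * \<eta>) ^ n / fact n) * (tpow ((1 + \<alpha> + of_nat n) - 1) w * exp (- of_real (c * w)))" for n w
  proof (cases "0 < w")
    case True
    have "(- of_real c * \<eta> * of_real w) ^ n = (- of_real c * \<eta>) ^ n * tpow (of_nat n) w"
      using True by (simp only: power_mult_distrib tpow_of_nat)
    moreover have "tpow ((1 + \<alpha> + of_nat n) - 1) w = tpow \<alpha> w * tpow (of_nat n) w"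
      by (simp add: tpow_add)
    ultimately show ?thesis by (simp add: F_def)
  qed (simp add: F_def)
  have F_int: "has_bochner_integral lborel (F n) (((- of_real c * \<eta>) ^ n / fact n) * (Gamma (1 + \<alpha> + of_nat n) * tpow (- (1 + \<alpha> + of_nat n)) c))" for n
    unfolding F_eq by (intro has_bochner_integral_mult_right Gamma_integral_tpow) (use c \<alpha> in auto)
  \<comment> \<open>Each term integrates to a Gamma value; written as a Pochhammer symbol it gives
    the coefficient of the binomial series of (1 + \<eta>)^(-1-\<alpha>).\<close>
  have F_value: "((- of_real c * \<eta>) ^ n / fact n) * (Gamma (1 + \<alpha> + of_nat n) * tpow (- (1 + \<alpha> + of_nat n)) c)
      = Gamma (1 + \<alpha>) * tpow (- 1 - \<alpha>) c * (((- 1 - \<alpha>) gchoose n) * \<eta> ^ n)" for n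
  proof -
    have "1 + \<alpha> \<notin> \<int>\<^sub>\<le>\<^sub>0" using \<alpha> by (auto elim!: nonpos_Ints_cases simp: complex_eq_iff)
    then have "Gamma (1 + \<alpha> + of_nat n) = pochhammer (1 + \<alpha>) n * Gamma (1 + \<alpha>)"
      by (simp add: pochhammer_Gamma Gamma_eq_zero_iff)
    moreover have "tpow (- (1 + \<alpha> + of_nat n)) c = tpow (- 1 - \<alpha>) c / of_real c ^ n"
    proof -
      have "tpow (- (1 + \<alpha> + of_nat n)) c * tpow (of_nat n) c = tpow (- 1 - \<alpha>) c"
        by (simp add: tpow_add)
      then show ?thesis using c by (simp add: tpow_of_nat field_simps)
    qed
    moreover have "(- of_real c * \<eta>) ^ n = (- 1) ^ n * of_real c ^ n * \<eta> ^ n"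
      by (metis mult_minus1 power_mult_distrib)
    ultimately show ?thesis using c by (simp add: gbinomial_pochhammer field_simps)
  qed
  \<comment> \<open>For imaginary \<alpha> the modulus removes the power, and the integrated norms
    form exactly a geometric series in |\<eta>|. This is what allows termwise integration.\<close>
  have F_norm: "has_bochner_integral lborel (\<lambda>w. norm (F n w)) (norm \<eta> ^ n / c)" for n
  proof -
    have "has_bochner_integral lborel (\<lambda>w. of_real ((c * norm \<eta>) ^ n / fact n) * (tpow ((1 + of_nat n) - 1) w * exp (- of_real (c * w))))
        (of_real ((c * norm \<eta>) ^ n / fact n) * (Gamma (1 + of_nat n) * tpow (- (1 + of_nat n)) c))"
      by (intro has_bochner_integral_mult_right Gamma_integral_tpow) (use c in auto)
    moreover have "of_real ((c * norm \<eta>) ^ n / fact n) * (tpow ((1 + of_nat n) - 1) w * exp (- of_real (c * w))) = complex_of_real (norm (F n w))" for w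
    proof (cases "0 < w")
      case True
      then have "norm (F n w) = exp (- (c * w)) * ((c * norm \<eta> * w) ^ n / fact n)"
        using c \<alpha> by (simp add: F_def norm_mult norm_divide norm_power norm_tpow_imaginary power_mult_distrib)
      then show ?thesis using True
        by (simp add: tpow_of_nat power_mult_distrib exp_of_real[symmetric] exp_minus)
    qed (simp add: F_def)
    moreover have "of_real ((c * norm \<eta>) ^ n / fact n) * (Gamma (1 + of_nat n) * tpow (- (1 + of_nat n)) c) = complex_of_real (norm \<eta> ^ n / c)"
    proof -
      have "tpow (- (1 + of_nat n)) c * tpow (of_nat (Suc n)) c = 1"
        using c by (simp add: tpow_add tpow_zero)
      then have "tpow (- (1 + of_nat n)) c = 1 / of_real c ^ (Suc n)"
        using c by (simp add: tpow_of_nat field_simps del: of_nat_Suc)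
      then show ?thesis using c by (simp add: Gamma_fact power_mult_distrib)
    qed
    ultimately have "has_bochner_integral lborel (\<lambda>w. complex_of_real (norm (F n w))) (complex_of_real (norm \<eta> ^ n / c))"
      by simp
    then show ?thesis
      by (simp add: has_bochner_integral_iff complex_of_real_integrable_eq integral_complex_of_real del: of_real_divide of_real_power)
  qed
  have F_sums: "(\<lambda>n. F n w) sums (tpow \<alpha> w * exp (- z * of_real w))" for w
  proof -
    have "(\<lambda>n. (- of_real c * \<eta> * of_real w) ^ n /\<^sub>R fact n) sums exp (- of_real c * \<eta> * of_real w)"
      by (rule exp_converges)
    then have "(\<lambda>n. tpow \<alpha> w * exp (- of_real (c * w)) * ((- of_real c * \<eta> * of_real w) ^ n /\<^sub>R fact n))
       sums (tpow \<alpha> w * exp (- of_real (c * w)) * exp (- of_real c * \<eta> * of_real w))"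
      by (rule sums_mult)
    moreover have "exp (- of_real (c * w)) * exp (- of_real c * \<eta> * of_real w) = exp (- z * of_real w)"
      by (subst z_eq, subst exp_add[symmetric]) (simp add: algebra_simps)
    ultimately show ?thesis
      by (simp add: F_def[abs_def] scaleR_conv_of_real divide_inverse mult.assoc mult.commute[of "inverse _"])
  qed
  have F_summable: "summable (\<lambda>n. norm (F n w))" for w
  proof -
    have "summable (\<lambda>n. norm ((- of_real c * \<eta> * of_real w) ^ n /\<^sub>R fact n))"
      by (rule summable_norm_exp)
    from summable_mult[OF this, of "norm (tpow \<alpha> w * exp (- of_real (c * w)))"]
    show ?thesis by (simp add: F_def[abs_def] norm_mult norm_divide norm_inverse divide_inverse mult_ac)
  qed
  have sumint: "summable (\<lambda>n. LINT w|lborel. norm (F n w))"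
    using \<eta> F_norm by (simp add: has_bochner_integral_iff summable_divide summable_geometric)
  have *: "integrable lborel (F n)" for n using F_int has_bochner_integral_iff by blast
  have int: "integrable lborel (\<lambda>w. \<Sum>n. F n w)"
    by (rule integrable_suminf) (use * F_summable sumint in auto)
  have sums: "(\<lambda>n. integral\<^sup>L lborel (F n)) sums (LINT w|lborel. (\<Sum>n. F n w))"
    by (rule sums_integral) (use * F_summable sumint in auto)
  have "(\<lambda>n. ((- 1 - \<alpha>) gchoose n) * \<eta> ^ n) sums (1 + \<eta>) powr (- 1 - \<alpha>)"
    by (rule gen_binomial_complex[OF \<eta>])
  from sums_mult[OF this, of "Gamma (1 + \<alpha>) * tpow (- 1 - \<alpha>) c"]
  have "(\<lambda>n. integral\<^sup>L lborel (F n)) sums (Gamma (1 + \<alpha>) * tpow (- 1 - \<alpha>) c * (1 + \<eta>) powr (- 1 - \<alpha>))"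
    using F_int F_value by (simp add: has_bochner_integral_iff)
  with sums have "(LINT w|lborel. (\<Sum>n. F n w)) = Gamma (1 + \<alpha>) * tpow (- 1 - \<alpha>) c * (1 + \<eta>) powr (- 1 - \<alpha>)"
    by (rule sums_unique2)
  \<comment> \<open>A positive factor can be split off a principal power without a branch
    correction.\<close>
  also have "\<dots> = Gamma (1 + \<alpha>) * z powr (- 1 - \<alpha>)"
    using c by (subst z_eq, subst powr_times_real_left) (auto simp: tpow_eq_powr)
  finally show ?thesis
    using int F_sums by (simp add: has_bochner_integral_iff sums_iff add.commute minus_diff_commute)
qed

section \<open>Incomplete Gamma function on the right half plane\<close>

lemma integrable_indicator_bounded:
  fixes k :: "real \<Rightarrow> complex"
  assumes [measurable]: "k \<in> borel_measurable borel" and "\<And>w. w \<in> {a<..<b} \<Longrightarrow> norm (k w) \<le> C"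
  shows "integrable lborel (\<lambda>w. indicator {a<..<b} w * k w)"
proof (rule Bochner_Integration.integrable_bound)
  show "integrable lborel (\<lambda>w. indicator {a<..<b} w * \<bar>C\<bar> :: real)"
    by (cases "a \<le> b") (auto intro!: integrable_mult_left integrable_real_indicator simp: greaterThanLessThan_empty)
  show "AE w in lborel. norm (indicator {a<..<b} w * k w) \<le> norm (indicator {a<..<b} w * \<bar>C\<bar> :: real)"
  proof (rule AE_I2)
    fix w show "norm (indicator {a<..<b} w * k w) \<le> norm (indicator {a<..<b} w * \<bar>C\<bar> :: real)"
      using assms(2)[of w] by (auto simp: indicator_def norm_mult)
  qed
qed measurable

lemma norm_exp_le_1: "0 \<le> Re z \<Longrightarrow> 0 \<le> w \<Longrightarrow> norm (exp (- z * of_real w)) \<le> 1"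
  by (simp add: norm_exp_eq_Re)

text \<open>The Laplace integral of \<open>tpow \<alpha>\<close> cut off at \<open>y\<close>. Up to
  a constant and an exponential factor it is J^(\<alpha>+1) applied to an exponential, see
  \<open>rlint_modulated\<close>.\<close>

definition tint :: "complex \<Rightarrow> complex \<Rightarrow> real \<Rightarrow> complex" where
  "tint \<alpha> z y = (LINT w|lborel. indicator {0<..<y} w * (tpow \<alpha> w * exp (- z * of_real w)))"

text \<open>For \<open>Re z > 0\<close> integration by parts gives \<open>tgam \<alpha> z y = \<alpha> \<integral>\<^sub>0\<^sup>y w\<^sup>\<alpha>\<^sup>-\<^sup>1 exp (- z w) dw\<close>, interpreted as
  a finite part at \<open>0\<close>: the incomplete Gamma function.\<close>

definition tgam :: "complex \<Rightarrow> complex \<Rightarrow> real \<Rightarrow> complex" where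
  "tgam \<alpha> z y = tpow \<alpha> y * exp (- z * of_real y) + z * tint \<alpha> z y"

context
  fixes \<alpha> :: complex
  assumes \<alpha>: "Re \<alpha> = 0"
begin

lemma norm_tpow_exp_le:
  assumes "0 \<le> Re z"
  shows "norm (tpow \<alpha> w * exp (- z * of_real w)) \<le> 1"
proof (cases "0 < w")
  case True
  then show ?thesis
    using mult_mono[OF norm_tpow_imaginary_le[OF \<alpha>] norm_exp_le_1[OF assms]] by (simp add: norm_mult)
qed simp

lemma tint_integrable:
  assumes "0 \<le> Re z"
  shows "integrable lborel (\<lambda>w. indicator {0<..<y} w * (tpow \<alpha> w * exp (- z * of_real w)))"
  by (rule integrable_indicator_bounded[where C = 1]) (use norm_tpow_exp_le[OF assms] in auto)

lemma tint_has_vector_derivative: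
  assumes "0 \<le> Re z" "0 < y"
  shows "(tint \<alpha> z has_vector_derivative tpow \<alpha> y * exp (- z * of_real y)) (at y)"
proof -
  define h where "h w = tpow \<alpha> w * exp (- z * of_real w)" for w
  have [measurable]: "h \<in> borel_measurable borel" unfolding h_def[abs_def] by measurable
  have tint_eq: "tint \<alpha> z u = integral {0..u} h" for u
  proof -
    have int: "set_integrable lebesgue {0<..<u} h"
    proof -
      have "integrable lborel (\<lambda>w. indicator {0<..<u} w *\<^sub>R h w)"
        using tint_integrable[OF assms(1), of u] by (simp add: h_def scaleR_conv_of_real of_real_indicator)
      then show ?thesis unfolding set_integrable_def by (subst integrable_completion) auto
    qed
    have "tint \<alpha> z u = (LINT w:{0<..<u}|lebesgue. h w)"
      unfolding set_lebesgue_integral_def tint_def h_def[symmetric]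
      by (subst integral_completion) (auto simp: scaleR_conv_of_real of_real_indicator)
    also have "\<dots> = integral {0<..<u} h" by (rule set_lebesgue_integral_eq_integral(2)[OF int])
    also have "\<dots> = integral {0..u} h" by (rule integral_open_interval_real[symmetric])
    finally show ?thesis .
  qed
  have "h absolutely_integrable_on {0..y + 1}"
  proof -
    have "integrable lborel (\<lambda>w. indicator {-1<..<y + 2} w * (indicator {0..y+1} w * h w))"
      by (rule integrable_indicator_bounded[where C = 1])
         (use norm_tpow_exp_le[OF assms(1)] in \<open>auto simp: h_def norm_mult indicator_def\<close>)
    moreover have "indicator {-1<..<y + 2} w * (indicator {0..y+1} w * h w) = indicator {0..y+1} w *\<^sub>R h w" for w
      by (auto simp: indicator_def)
    ultimately show ?thesis
      unfolding set_integrable_def by (subst integrable_completion) (auto simp: o_def)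
  qed
  then have hint: "h integrable_on {0..y + 1}" by (rule set_lebesgue_integral_eq_integral(1))
  have "isCont h y"
    unfolding h_def using isCont_tpow[OF assms(2)] by (intro continuous_intros)
  then have cont: "continuous (at y within ({0..y+1} - {})) h"
    by (simp add: continuous_at_imp_continuous_at_within)
  have "((\<lambda>u. integral {0..u} h) has_vector_derivative h y) (at y within ({0..y+1} - {}))"
    by (rule integral_has_vector_derivative_continuous_at[OF hint _ _ cont]) (use assms in auto)
  then have "((\<lambda>u. integral {0..u} h) has_vector_derivative h y) (at y)"
    using assms(2) by (simp add: at_within_Icc_at)
  then show ?thesis unfolding tint_eq[abs_def] h_def .
qed

lemma exp_has_vector_derivative:
  "((\<lambda>w. exp (- z * complex_of_real w)) has_vector_derivative - z * exp (- z * complex_of_real y)) (at y)"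
proof -
  have "((\<lambda>w. - z * complex_of_real w) has_vector_derivative - z * 1) (at y)"
    by (intro has_vector_derivative_mult_right) (use has_vector_derivative_of_real[OF DERIV_ident] in simp)
  from field_vector_diff_chain_at[OF this DERIV_exp] show ?thesis by (simp add: o_def mult.commute)
qed

text \<open>The derivative \<alpha> w^(\<alpha>-1) exp(-zw) of \<open>tgam\<close> has modulus of
  order 1/w on the imaginary axis, which is not integrable at infinity. One more integration by
  parts, expressed by the correction \<open>R\<close>, leaves a derivative of order 1/(|z| w^2)
  uniformly in the closed half plane. In the constant, 2|\<alpha>| comes from the two values of
  \<open>R\<close> and |\<alpha>| |\<alpha> - 1| from the remaining integral.\<close>

lemma tgam_tail:
  assumes z: "0 \<le> Re z" "z \<noteq> 0" and y: "0 < y" "y \<le> y'"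
  shows "norm (tgam \<alpha> z y' - tgam \<alpha> z y) \<le> (2 * norm \<alpha> + norm \<alpha> * norm (\<alpha> - 1)) / (norm z * y)"
proof (cases "y = y'")
  case False
  with y have y': "y < y'" by simp
  define K where "K = norm \<alpha> * norm (\<alpha> - 1) / norm z"
  \<comment> \<open>Minus the leading term of an antiderivative of \<alpha> w^(\<alpha>-1) exp(-zw),
    so that the derivative of \<Psi> contains only \<open>tpow (\<alpha> - 2)\<close>.\<close>
  define R where "R w = (\<alpha> / z) * (tpow (\<alpha> - 1) w * exp (- z * of_real w))" for w
  define \<Psi> where "\<Psi> w = tgam \<alpha> z w + R w" for w
  have d\<Psi>: "(\<Psi> has_vector_derivative (\<alpha> / z) * (\<alpha> - 1) * (tpow (\<alpha> - 2) w * exp (- z * of_real w))) (at w)"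
    if w: "0 < w" for w
  proof -
    note E = exp_has_vector_derivative[of z w]
    have "(\<Psi> has_vector_derivative
        (tpow \<alpha> w * (- z * exp (- z * of_real w)) + \<alpha> * tpow (\<alpha> - 1) w * exp (- z * of_real w))
        + z * (tpow \<alpha> w * exp (- z * of_real w))
        + (\<alpha> / z) * (tpow (\<alpha> - 1) w * (- z * exp (- z * of_real w))
            + (\<alpha> - 1) * tpow (\<alpha> - 1 - 1) w * exp (- z * of_real w))) (at w)"
      unfolding \<Psi>_def[abs_def] tgam_def[abs_def] R_def
      by (intro has_vector_derivative_add has_vector_derivative_mult_right has_vector_derivative_mult
          tpow_has_vector_derivative tint_has_vector_derivative E w z(1))
    then show ?thesis
      by (rule has_vector_derivative_eq_rhs) (use z in \<open>simp add: field_simps diff_diff_eq\<close>)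
  qed
  \<comment> \<open>Mean value inequality with the majorant -K/w, whose derivative is K/w^2.\<close>
  have "norm (\<Psi> y' - \<Psi> y) \<le> - K / y' - (- K / y)"
  proof (rule differentiable_bound_general[OF y'])
    show "continuous_on {y..y'} \<Psi>"
      using d\<Psi> y by (intro continuous_at_imp_continuous_on ballI has_vector_derivative_continuous[OF d\<Psi>]) auto
    show "continuous_on {y..y'} (\<lambda>w. - K / w)" using y by (intro continuous_intros) auto
    show "((\<lambda>w. - K / w) has_vector_derivative K / w\<^sup>2) (at w)" if "y < w" "w < y'" for w
      unfolding has_real_derivative_iff_has_vector_derivative[symmetric]
      using that y by (auto intro!: derivative_eq_intros simp: power2_eq_square)
    show "(\<Psi> has_vector_derivative (\<alpha> / z) * (\<alpha> - 1) * (tpow (\<alpha> - 2) w * exp (- z * of_real w))) (at w)"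
      if "y < w" "w < y'" for w using d\<Psi> that y by simp
    show "norm ((\<alpha> / z) * (\<alpha> - 1) * (tpow (\<alpha> - 2) w * exp (- z * of_real w))) \<le> K / w\<^sup>2"
      if "y < w" "w < y'" for w
    proof -
      have w: "0 < w" using that y by simp
      have "norm ((\<alpha> / z) * (\<alpha> - 1) * (tpow (\<alpha> - 2) w * exp (- z * of_real w)))
          = K * (norm (tpow (\<alpha> - 2) w) * norm (exp (- z * of_real w)))"
        by (simp only: norm_mult norm_divide K_def) simp
      also have "\<dots> \<le> K * ((1 / w\<^sup>2) * 1)"
        using norm_exp_le_1[OF z(1), of w] w \<alpha>
        by (intro mult_left_mono mult_mono) (auto simp: norm_tpow powr_minus powr_numeral K_def divide_inverse)
      finally show ?thesis by simp
    qed
  qed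
  also have "\<dots> \<le> K / y" using y by (simp add: K_def)
  finally have main: "norm (\<Psi> y' - \<Psi> y) \<le> K / y" .
  have Rle: "norm (R w) \<le> norm \<alpha> / (norm z * y)" if "y \<le> w" for w
  proof -
    have w: "0 < w" using that y by simp
    have "norm (R w) = norm \<alpha> / norm z * (norm (tpow (\<alpha> - 1) w) * norm (exp (- z * of_real w)))"
      by (simp only: R_def norm_mult norm_divide)
    also have "\<dots> \<le> norm \<alpha> / norm z * ((1 / y) * 1)"
      using norm_exp_le_1[OF z(1), of w] w \<alpha> that y
      by (intro mult_left_mono mult_mono) (auto simp: norm_tpow powr_minus intro: le_imp_inverse_le simp flip: inverse_eq_divide)
    finally show ?thesis by simp
  qed
  have "tgam \<alpha> z y' - tgam \<alpha> z y = (\<Psi> y' - \<Psi> y) - R y' + R y" by (simp add: \<Psi>_def)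
  also have "norm \<dots> \<le> norm (\<Psi> y' - \<Psi> y) + norm (R y') + norm (R y)"
    by (rule order_trans[OF norm_triangle_ineq add_right_mono[OF norm_triangle_ineq4]])
  also have "\<dots> \<le> K / y + norm \<alpha> / (norm z * y) + norm \<alpha> / (norm z * y)"
    using main Rle[of y'] Rle[of y] y by (intro add_mono) auto
  also have "\<dots> = (2 * norm \<alpha> + norm \<alpha> * norm (\<alpha> - 1)) / (norm z * y)"
    using y z by (simp add: K_def field_simps)
  finally show ?thesis .
qed (use y in simp)

text \<open>For Re z > 0 the boundary term of \<open>tgam\<close> decays exponentially, and
  \<open>z\<close> times the complete Laplace integral is Gamma(\<alpha>+1) z^(-\<alpha>).\<close>

lemma tgam_limit:
  assumes z: "0 < Re z"
  shows "(\<lambda>n. tgam \<alpha> z (real n)) \<longlonglongrightarrow> Gamma (\<alpha> + 1) * z powr (- \<alpha>)"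
proof -
  have nz: "z \<noteq> 0" using z by auto
  have L: "integrable lborel (\<lambda>w. tpow \<alpha> w * exp (- z * of_real w))"
    "(LINT w|lborel. tpow \<alpha> w * exp (- z * of_real w)) = Gamma (\<alpha> + 1) * z powr (- \<alpha> - 1)"
    using Laplace_tpow[OF \<alpha> z] by (auto simp: has_bochner_integral_iff)
  have "(\<lambda>n. tint \<alpha> z (real n)) \<longlonglongrightarrow> (LINT w|lborel. tpow \<alpha> w * exp (- z * of_real w))"
    unfolding tint_def
  proof (rule integral_dominated_convergence[where w = "\<lambda>w. norm (tpow \<alpha> w * exp (- z * of_real w))"])
    show "integrable lborel (\<lambda>w. norm (tpow \<alpha> w * exp (- z * of_real w)))" using L(1) by (rule integrable_norm)
    show "AE w in lborel. (\<lambda>n. indicator {0<..<real n} w * (tpow \<alpha> w * exp (- z * of_real w)))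
        \<longlonglongrightarrow> tpow \<alpha> w * exp (- z * of_real w)"
    proof (intro AE_I2 tendsto_eventually)
      fix w
      obtain N where "w < real N" using reals_Archimedean2 by blast
      then show "\<forall>\<^sub>F n in sequentially. indicator {0<..<real n} w * (tpow \<alpha> w * exp (- z * of_real w))
          = tpow \<alpha> w * exp (- z * of_real w)"
        by (intro eventually_sequentiallyI[of N]) (auto simp: indicator_def not_less)
    qed
    show "AE w in lborel. norm (indicator {0<..<real n} w * (tpow \<alpha> w * exp (- z * of_real w)))
        \<le> norm (tpow \<alpha> w * exp (- z * of_real w))" for n
      by (intro AE_I2) (auto simp: indicator_def)
  qed measurable
  then have A: "(\<lambda>n. z * tint \<alpha> z (real n)) \<longlonglongrightarrow> z * (Gamma (\<alpha> + 1) * z powr (- \<alpha> - 1))"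
    unfolding L(2) by (rule tendsto_mult_left)
  have E: "z * (Gamma (\<alpha> + 1) * z powr (- \<alpha> - 1)) = Gamma (\<alpha> + 1) * z powr (- \<alpha>)"
    using nz by (simp add: powr_diff)
  have Z: "(\<lambda>n. tpow \<alpha> (real n) * exp (- z * of_real (real n))) \<longlonglongrightarrow> 0"
  proof (rule Lim_null_comparison)
    show "\<forall>\<^sub>F n in sequentially. norm (tpow \<alpha> (real n) * exp (- z * of_real (real n))) \<le> exp (- Re z) ^ n"
      using norm_tpow_imaginary_le[OF \<alpha>]
      by (intro always_eventually allI) (simp add: norm_mult norm_exp_eq_Re mult.commute flip: exp_of_nat_mult)
    show "(\<lambda>n. exp (- Re z) ^ n) \<longlonglongrightarrow> 0" by (rule LIMSEQ_power_zero) (use z in simp)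
  qed
  show ?thesis
    using tendsto_add[OF Z A] unfolding tgam_def E by simp
qed

lemma tgam_bound_right_half_plane:
  assumes z: "0 < Re z" and y: "0 < y"
  shows "norm (tgam \<alpha> z y - Gamma (\<alpha> + 1) * z powr (- \<alpha>)) \<le> (2 * norm \<alpha> + norm \<alpha> * norm (\<alpha> - 1)) / (norm z * y)"
proof -
  have "(\<lambda>n. norm (tgam \<alpha> z (real n) - tgam \<alpha> z y)) \<longlonglongrightarrow> norm (Gamma (\<alpha> + 1) * z powr (- \<alpha>) - tgam \<alpha> z y)"
    by (intro tendsto_intros tgam_limit z)
  moreover have "\<forall>\<^sub>F n in sequentially. norm (tgam \<alpha> z (real n) - tgam \<alpha> z y) \<le> (2 * norm \<alpha> + norm \<alpha> * norm (\<alpha> - 1)) / (norm z * y)"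
  proof (rule eventually_sequentiallyI)
    fix n assume "nat \<lceil>y\<rceil> \<le> n"
    then have "y \<le> real n" by linarith
    then show "norm (tgam \<alpha> z (real n) - tgam \<alpha> z y) \<le> (2 * norm \<alpha> + norm \<alpha> * norm (\<alpha> - 1)) / (norm z * y)"
      using z y by (intro tgam_tail) auto
  qed
  ultimately have "norm (Gamma (\<alpha> + 1) * z powr (- \<alpha>) - tgam \<alpha> z y) \<le> (2 * norm \<alpha> + norm \<alpha> * norm (\<alpha> - 1)) / (norm z * y)"
    by (intro tendsto_upperbound) auto
  then show ?thesis by (simp add: norm_minus_commute)
qed

text \<open>The case of interest is the imaginary axis, where the complete Laplace integral does not
  converge absolutely. The bound in the open half plane involves only \<open>norm z\<close> and
  \<open>y\<close>, hence survives shifting \<open>z\<close> to the right by 1/(n+1) and letting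
  \<open>n\<close> grow.\<close>

lemma tgam_bound:
  assumes z: "0 \<le> Re z" "z \<noteq> 0" and y: "0 < y"
  shows "norm (tgam \<alpha> z y - Gamma (\<alpha> + 1) * z powr (- \<alpha>)) \<le> (2 * norm \<alpha> + norm \<alpha> * norm (\<alpha> - 1)) / (norm z * y)"
proof -
  define \<delta> where "\<delta> n = complex_of_real (inverse (real (Suc n)))" for n
  have \<delta>: "\<delta> \<longlonglongrightarrow> 0"
    unfolding \<delta>_def using tendsto_of_real[OF LIMSEQ_inverse_real_of_nat] by (simp only: of_real_0)
  have z\<delta>: "(\<lambda>n. z + \<delta> n) \<longlonglongrightarrow> z" using tendsto_add[OF tendsto_const \<delta>] by simp
  have pos: "0 < Re (z + \<delta> n)" for n using z by (simp add: \<delta>_def add_nonneg_pos del: of_nat_Suc)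
  \<comment> \<open>A nonzero point of the closed right half plane avoids the branch cut, so the
    power is continuous there.\<close>
  have zpos: "z \<notin> \<real>\<^sub>\<le>\<^sub>0" using z by (auto simp: complex_nonpos_Reals_iff complex_eq_iff)
  have "(\<lambda>n. tint \<alpha> (z + \<delta> n) y) \<longlonglongrightarrow> tint \<alpha> z y"
    unfolding tint_def
  proof (rule integral_dominated_convergence[where w = "\<lambda>w. indicator {0<..<y} w"])
    show "AE w in lborel. (\<lambda>n. indicator {0<..<y} w * (tpow \<alpha> w * exp (- (z + \<delta> n) * of_real w)))
        \<longlonglongrightarrow> indicator {0<..<y} w * (tpow \<alpha> w * exp (- z * of_real w))"
      by (intro AE_I2 tendsto_intros z\<delta>)
    show "AE w in lborel. norm (indicator {0<..<y} w * (tpow \<alpha> w * exp (- (z + \<delta> n) * of_real w)))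
        \<le> indicator {0<..<y} w" for n
      using norm_tpow_exp_le[OF less_imp_le[OF pos]] by (intro AE_I2) (simp add: indicator_def)
  qed (use y in auto)
  then have lhs: "(\<lambda>n. norm (tgam \<alpha> (z + \<delta> n) y - Gamma (\<alpha> + 1) * (z + \<delta> n) powr (- \<alpha>)))
      \<longlonglongrightarrow> norm (tgam \<alpha> z y - Gamma (\<alpha> + 1) * z powr (- \<alpha>))"
    unfolding tgam_def using zpos by (intro tendsto_intros z\<delta>) auto
  have rhs: "(\<lambda>n. (2 * norm \<alpha> + norm \<alpha> * norm (\<alpha> - 1)) / (norm (z + \<delta> n) * y))
      \<longlonglongrightarrow> (2 * norm \<alpha> + norm \<alpha> * norm (\<alpha> - 1)) / (norm z * y)"
    using z y by (intro tendsto_intros z\<delta>) auto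
  show ?thesis
    by (rule LIMSEQ_le[OF lhs rhs]) (use tgam_bound_right_half_plane[OF pos y] in auto)
qed

text \<open>For imaginary \<alpha> the modulus of z^(-\<alpha>) is exp(Im \<alpha> Arg z): it
  depends on the argument alone, which is at most pi in modulus.\<close>

lemma norm_powr_imaginary_le:
  "norm (z powr (- \<alpha>)) \<le> exp (pi * \<bar>Im \<alpha>\<bar>)"
proof (cases "z = 0")
  case False
  have "Im \<alpha> * Arg z \<le> \<bar>Im \<alpha>\<bar> * \<bar>Arg z\<bar>" by (metis abs_ge_self abs_mult)
  also have "\<dots> \<le> \<bar>Im \<alpha>\<bar> * pi"
    using Arg_bounded[of z] by (intro mult_left_mono) auto
  finally show ?thesis using False \<alpha> by (simp add: norm_powr_complex mult.commute)
qed simp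

text \<open>For |z| y \<le> 1 the integrand of modulus at most one gives |z tint| \<le> 1 and hence
  the bound 2; for |z| y > 1 the error term of \<open>tgam_bound\<close> is bounded by its
  numerator. The constant serves as majorant for dominated convergence near the jump points, where
  \<open>tgam_bound\<close> degenerates.\<close>

lemma tgam_bounded:
  obtains C where "0 \<le> C" "\<And>z y. 0 \<le> Re z \<Longrightarrow> 0 < y \<Longrightarrow> norm (tgam \<alpha> z y) \<le> C"
proof -
  define K where "K = 2 * norm \<alpha> + norm \<alpha> * norm (\<alpha> - 1)"
  define C where "C = 2 + norm (Gamma (\<alpha> + 1)) * exp (pi * \<bar>Im \<alpha>\<bar>) + K"
  have K: "0 \<le> K" by (simp add: K_def)
  have "norm (tgam \<alpha> z y) \<le> C" if z: "0 \<le> Re z" and y: "0 < y" for z y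
  proof (cases "norm z * y \<le> 1")
    case True
    have "norm (tint \<alpha> z y) \<le> (LINT w|lborel. indicator {0<..<y} w)"
      unfolding tint_def
    proof (rule Bochner_Integration.integral_norm_bound_integral[OF tint_integrable[OF z]])
      show "integrable lborel (\<lambda>w. indicator {0<..<y} w :: real)"
        using y by (intro integrable_real_indicator) auto
    qed (use norm_tpow_exp_le[OF z] in \<open>simp add: norm_mult indicator_def\<close>)
    then have "norm (tint \<alpha> z y) \<le> y" using y by simp
    then have "norm z * norm (tint \<alpha> z y) \<le> 1"
      using mult_left_mono[of "norm (tint \<alpha> z y)" y "norm z"] True by simp
    then have "norm (tgam \<alpha> z y) \<le> 1 + 1"
      unfolding tgam_def using norm_tpow_exp_le[OF z, of y]
      by (intro order_trans[OF norm_triangle_ineq add_mono]) (auto simp: norm_mult)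
    moreover have "0 \<le> norm (Gamma (\<alpha> + 1)) * exp (pi * \<bar>Im \<alpha>\<bar>)" by simp
    ultimately show ?thesis using K unfolding C_def by linarith
  next
    case False
    then have nz: "z \<noteq> 0" and "K / (norm z * y) \<le> K"
      using K mult_left_mono[of 1 "norm z * y" K] by (auto simp: field_simps)
    then have "norm (tgam \<alpha> z y - Gamma (\<alpha> + 1) * z powr (- \<alpha>)) \<le> K"
      using tgam_bound[OF z nz y] by (simp add: K_def)
    moreover have "norm (Gamma (\<alpha> + 1) * z powr (- \<alpha>)) \<le> norm (Gamma (\<alpha> + 1)) * exp (pi * \<bar>Im \<alpha>\<bar>)"
      unfolding norm_mult by (intro mult_left_mono norm_powr_imaginary_le) auto
    ultimately show ?thesis
      using norm_triangle_sub[of "tgam \<alpha> z y" "Gamma (\<alpha> + 1) * z powr (- \<alpha>)"] by (simp add: C_def)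
  qed
  moreover have "0 \<le> C" using K by (simp add: C_def add_nonneg_nonneg)
  ultimately show ?thesis using that by blast
qed

text \<open>Euler's argument: \<open>f\<close> is integrated over the wedge 0 < w < y in both
  orders. Scaling w by y gives the Beta integral times Gamma(2) = 1; translating y by w gives the
  product of the Gamma values. This is the constant behind the inversion of J^\<alpha> by
  J^(-\<alpha>).\<close>

lemma Beta_integral_imaginary:
  "(LINT w|lborel. indicator {0<..<1} w * (tpow (- \<alpha>) (1 - w) * tpow \<alpha> w)) = Gamma (1 - \<alpha>) * Gamma (1 + \<alpha>)"
proof -
  define c where "c = (LINT w|lborel. indicator {0<..<1} w * (tpow (- \<alpha>) (1 - w) * tpow \<alpha> w))"
  define f where "f y w = tpow (- \<alpha>) (y - w) * tpow \<alpha> w * exp (- complex_of_real y)" for y w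
  have fm [measurable]: "(\<lambda>(y, w). f y w) \<in> borel_measurable (lborel \<Otimes>\<^sub>M lborel)"
    unfolding f_def by measurable
  have f_norm: "norm (f y w) = indicator {0<..<y} w * exp (- y)" for y w
    using \<alpha> by (auto simp: f_def norm_mult norm_tpow_imaginary indicator_def)
  have inner_w: "(LINT w|lborel. f y w) = c * (tpow 1 y * exp (- complex_of_real y))" for y
  proof (cases "0 < y")
    case True
    have "(LINT w|lborel. f y w) = y *\<^sub>R (LINT w|lborel. f y (0 + y * w))"
      using lborel_integral_real_affine[of y "f y" 0] True by simp
    also have "(\<lambda>w. f y (0 + y * w)) = (\<lambda>w. exp (- complex_of_real y) * (indicator {0<..<1} w * (tpow (- \<alpha>) (1 - w) * tpow \<alpha> w)))"
    proof
      fix w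
      define e where "e = exp (- complex_of_real y)"
      have 1: "tpow (- \<alpha>) (y - y * w) = tpow (- \<alpha>) y * tpow (- \<alpha>) (1 - w)"
        using tpow_mult[OF True, of "-\<alpha>" "1 - w"] by (simp add: algebra_simps)
      have 2: "tpow (- \<alpha>) y * tpow \<alpha> y = 1" using True by (simp add: tpow_add tpow_zero)
      have 3: "tpow (- \<alpha>) (1 - w) * tpow \<alpha> w = indicator {0<..<1} w * (tpow (- \<alpha>) (1 - w) * tpow \<alpha> w)"
        by (auto simp: indicator_def tpow_def)
      have "f y (0 + y * w) = (tpow (- \<alpha>) y * tpow (- \<alpha>) (1 - w)) * (tpow \<alpha> y * tpow \<alpha> w) * e"
        using True by (simp add: f_def tpow_mult 1 e_def)
      also have "\<dots> = e * ((tpow (- \<alpha>) y * tpow \<alpha> y) * (tpow (- \<alpha>) (1 - w) * tpow \<alpha> w))"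
        by (simp only: mult_ac)
      also have "\<dots> = e * (indicator {0<..<1} w * (tpow (- \<alpha>) (1 - w) * tpow \<alpha> w))"
        by (subst 2, subst mult_1_left, rule arg_cong[where f = "(*) e"], rule 3)
      finally show "f y (0 + y * w) = exp (- complex_of_real y) * (indicator {0<..<1} w * (tpow (- \<alpha>) (1 - w) * tpow \<alpha> w))"
        by (simp only: e_def)
    qed
    finally show ?thesis
      using True tpow_of_nat[OF True, of 1] by (simp add: c_def scaleR_conv_of_real)
  next
    case False
    then have "f y = (\<lambda>w. 0)" by (auto simp: f_def fun_eq_iff not_less tpow_def)
    then show ?thesis using False by simp
  qed
  have G2: "has_bochner_integral lborel (\<lambda>y. tpow 1 y * exp (- complex_of_real y)) 1"
    using Gamma_integral_tpow_1[of 2] Gamma_fact[of 1, where 'a = complex] by simp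
  \<comment> \<open>Both powers have modulus one, so the absolute value integrates over w to y
    exp(-y), which settles the integrability for Fubini.\<close>
  have nn_inner: "(LINT w|lborel. norm (f y w)) = norm (tpow 1 y * exp (- complex_of_real y))" for y
  proof (cases "0 < y")
    case True
    then show ?thesis by (simp add: f_norm norm_mult norm_tpow)
  qed (auto simp: f_norm greaterThanLessThan_empty)
  have int: "integrable (lborel \<Otimes>\<^sub>M lborel) (\<lambda>(y, w). f y w)"
  proof (rule lborel_pair.Fubini_integrable[OF fm])
    show "integrable lborel (\<lambda>y. LINT w|lborel. norm (case (y, w) of (y, w) \<Rightarrow> f y w))"
      using G2 integrable_norm unfolding prod.case nn_inner has_bochner_integral_iff by blast
    show "AE y in lborel. integrable lborel (\<lambda>w. case (y, w) of (y, w) \<Rightarrow> f y w)"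
    proof (rule AE_I2)
      fix y
      have [measurable]: "f y \<in> borel_measurable borel" unfolding f_def[abs_def] by measurable
      have "integrable lborel (\<lambda>w. indicator {0<..<y} w * f y w)"
        by (rule integrable_indicator_bounded[where C = "exp (- y)"]) (auto simp: f_norm)
      moreover have "indicator {0<..<y} w * f y w = f y w" for w
        by (auto simp: indicator_def f_def tpow_def)
      ultimately show "integrable lborel (\<lambda>w. case (y, w) of (y, w) \<Rightarrow> f y w)" by simp
    qed
  qed
  have "c = (LINT y|lborel. LINT w|lborel. f y w)"
    using G2 by (simp add: inner_w has_bochner_integral_iff)
  also have "\<dots> = (LINT w|lborel. LINT y|lborel. f y w)"
    using lborel_pair.Fubini_integral[OF int] by simp
  also have "\<dots> = (LINT w|lborel. Gamma (1 - \<alpha>) * (tpow \<alpha> w * exp (- complex_of_real w)))"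
  proof (rule Bochner_Integration.integral_cong[OF refl])
    fix w
    have "(LINT y|lborel. f y w) = (LINT y|lborel. f (w + 1 * y) w)"
      using lborel_integral_real_affine[of 1 "\<lambda>y. f y w" w] by simp
    also have "(\<lambda>y. f (w + 1 * y) w) = (\<lambda>y. (tpow \<alpha> w * exp (- complex_of_real w)) * (tpow ((1 - \<alpha>) - 1) y * exp (- complex_of_real y)))"
    proof
      fix y
      have "exp (- complex_of_real (w + y)) = exp (- complex_of_real w) * exp (- complex_of_real y)"
        by (subst exp_add[symmetric]) simp
      then show "f (w + 1 * y) w = (tpow \<alpha> w * exp (- complex_of_real w)) * (tpow ((1 - \<alpha>) - 1) y * exp (- complex_of_real y))"
        by (simp add: f_def mult_ac del: of_real_add)
    qed
    also have "(LINT y|lborel. (tpow \<alpha> w * exp (- complex_of_real w)) * (tpow ((1 - \<alpha>) - 1) y * exp (- complex_of_real y)))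
        = (tpow \<alpha> w * exp (- complex_of_real w)) * Gamma (1 - \<alpha>)"
      using Gamma_integral_tpow_1[of "1 - \<alpha>"] \<alpha> by (simp add: has_bochner_integral_iff)
    finally show "(LINT y|lborel. f y w) = Gamma (1 - \<alpha>) * (tpow \<alpha> w * exp (- complex_of_real w))"
      by simp
  qed
  also have "\<dots> = Gamma (1 - \<alpha>) * Gamma (1 + \<alpha>)"
    using Gamma_integral_tpow_1[of "1 + \<alpha>"] \<alpha> by (simp add: has_bochner_integral_iff)
  finally show ?thesis by (simp add: c_def)
qed

end

section \<open>A Plancherel inequality\<close>

lemma integrable_product_bounded:
  fixes f h :: "real \<Rightarrow> complex"
  assumes f: "integrable lborel f" and h: "integrable lborel h"
    and k [measurable]: "(\<lambda>(x, y). k x y) \<in> borel_measurable (lborel \<Otimes>\<^sub>M lborel)"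
    and le: "\<And>x y. norm (k x y) \<le> 1"
  shows "integrable (lborel \<Otimes>\<^sub>M lborel) (\<lambda>(x, y). f x * (h y * k x y))"
proof -
  have [measurable]: "f \<in> borel_measurable borel" "h \<in> borel_measurable borel"
    using f h borel_measurable_integrable by auto
  have m: "(\<lambda>(x, y). f x * (h y * k x y)) \<in> borel_measurable (lborel \<Otimes>\<^sub>M lborel)" by measurable
  have kx [measurable]: "k x \<in> borel_measurable borel" for x
    using measurable_compose[OF measurable_Pair1'[of x lborel lborel] k] by simp
  have hk: "integrable lborel (\<lambda>y. h y * k x y)" for x
    by (rule Bochner_Integration.integrable_bound[OF h])
       (use le in \<open>auto simp: norm_mult mult_left_le\<close>)
  show ?thesis
  proof (rule lborel_pair.Fubini_integrable[OF m])
    show "AE x in lborel. integrable lborel (\<lambda>y. case (x, y) of (x, y) \<Rightarrow> f x * (h y * k x y))"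
      using hk by (intro AE_I2) simp
    have "integrable lborel (\<lambda>x. LINT y|lborel. norm (f x * (h y * k x y)))"
    proof (rule Bochner_Integration.integrable_bound)
      show "integrable lborel (\<lambda>x. f x * of_real (LINT y|lborel. norm (h y)))" using f by simp
      show "AE x in lborel. norm (LINT y|lborel. norm (f x * (h y * k x y))) \<le> norm (f x * of_real (LINT y|lborel. norm (h y)))"
      proof (rule AE_I2)
        fix x
        have "(LINT y|lborel. norm (h y * k x y)) \<le> (LINT y|lborel. norm (h y))"
          using le by (intro integral_mono integrable_norm hk h) (simp add: norm_mult mult_left_le)
        then have "norm (f x) * (LINT y|lborel. norm (h y * k x y)) \<le> norm (f x) * (LINT y|lborel. norm (h y))"
          by (rule mult_left_mono) simp
        moreover have "(LINT y|lborel. norm (f x * (h y * k x y))) = norm (f x) * (LINT y|lborel. norm (h y * k x y))"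
          by (simp only: norm_mult[of "f x"] integral_mult_right_zero)
        moreover have "0 \<le> (LINT y|lborel. norm (f x * (h y * k x y)))" by (rule integral_nonneg_AE) simp
        moreover have "norm (f x * of_real (LINT y|lborel. norm (h y))) = norm (f x) * (LINT y|lborel. norm (h y))"
          by (simp add: norm_mult)
        ultimately show "norm (LINT y|lborel. norm (f x * (h y * k x y))) \<le> norm (f x * of_real (LINT y|lborel. norm (h y)))"
          by simp
      qed
    qed measurable
    then show "integrable lborel (\<lambda>x. LINT y|lborel. norm (case (x, y) of (x, y) \<Rightarrow> f x * (h y * k x y)))" by simp
  qed
qed

lemma Fubini_product_bounded:
  fixes f h :: "real \<Rightarrow> complex"
  assumes f: "integrable lborel f" and h: "integrable lborel h"
    and k: "(\<lambda>(x, y). k x y) \<in> borel_measurable (lborel \<Otimes>\<^sub>M lborel)"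
    and le: "\<And>x y. norm (k x y) \<le> 1"
  shows "(LINT x|lborel. f x * (LINT y|lborel. h y * k x y)) = (LINT y|lborel. h y * (LINT x|lborel. f x * k x y))"
proof -
  have "(LINT x|lborel. f x * (LINT y|lborel. h y * k x y)) = (LINT x|lborel. LINT y|lborel. f x * (h y * k x y))"
    by simp
  also have "\<dots> = (LINT y|lborel. LINT x|lborel. f x * (h y * k x y))"
    using lborel_pair.Fubini_integral[OF integrable_product_bounded[OF assms]] by simp
  also have "\<dots> = (LINT y|lborel. LINT x|lborel. h y * (f x * k x y))"
    by (simp add: mult.left_commute)
  finally show ?thesis by simp
qed

definition fourier :: "(real \<Rightarrow> complex) \<Rightarrow> real \<Rightarrow> complex" where
  "fourier g \<xi> = (LINT x|lborel. g x * iexp (- (\<xi> * x)))"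

lemma fourier_measurable [measurable]:
  assumes [measurable]: "g \<in> borel_measurable borel"
  shows "fourier g \<in> borel_measurable borel"
  unfolding fourier_def[abs_def] by measurable

lemma norm_fourier_le:
  assumes "integrable lborel g"
  shows "norm (fourier g \<xi>) \<le> (LINT x|lborel. norm (g x))"
  unfolding fourier_def by (rule order_trans[OF integral_norm_bound]) (simp add: norm_mult)

lemma std_normal_fourier:
  "(LINT \<xi>|lborel. complex_of_real (std_normal_density \<xi>) * iexp (t * \<xi>)) = complex_of_real (exp (- t\<^sup>2 / 2))"
proof -
  have "(LINT \<xi>|lborel. complex_of_real (std_normal_density \<xi>) * iexp (t * \<xi>)) = char std_normal_distribution t"
    unfolding char_def by (subst integral_density) (auto simp: scaleR_conv_of_real)
  then show ?thesis by (simp add: char_std_normal_distribution)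
qed

lemma integrable_std_normal: "integrable lborel (\<lambda>\<xi>. complex_of_real (std_normal_density \<xi>))"
  using integrable_normal_density[of 1 0] by (simp add: complex_of_real_integrable_eq)

text \<open>For \<open>s > 0\<close>, after rescaling, this is \<open>s\<close> times the integral
  of |fourier g|^2 against the Gaussian density at s\<xi>. The cut-off makes it finite for every
  integrable \<open>g\<close>, and division by \<open>s\<close> followed by s \<rightarrow> 0
  recovers the full energy.\<close>

definition gauss_energy :: "(real \<Rightarrow> complex) \<Rightarrow> real \<Rightarrow> real" where
  "gauss_energy g s = (LINT \<xi>|lborel. std_normal_density \<xi> * (norm (fourier g (\<xi> / s)))\<^sup>2)"

lemma gauss_energy_integrable:
  assumes g: "integrable lborel g"
  shows "integrable lborel (\<lambda>\<xi>. std_normal_density \<xi> * (norm (fourier g (\<xi> / s)))\<^sup>2)"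
proof (rule Bochner_Integration.integrable_bound)
  have [measurable]: "g \<in> borel_measurable borel" using borel_measurable_integrable[OF g] by simp
  show "integrable lborel (\<lambda>\<xi>. std_normal_density \<xi> * (LINT x|lborel. norm (g x))\<^sup>2)"
    using integrable_normal_density[of 1 0] by simp
  show "(\<lambda>\<xi>. std_normal_density \<xi> * (norm (fourier g (\<xi> / s)))\<^sup>2) \<in> borel_measurable lborel"
    by measurable
  show "AE \<xi> in lborel. norm (std_normal_density \<xi> * (norm (fourier g (\<xi> / s)))\<^sup>2)
      \<le> norm (std_normal_density \<xi> * (LINT x|lborel. norm (g x))\<^sup>2)"
    using norm_fourier_le[OF g] by (intro AE_I2) (auto simp: abs_mult intro!: mult_left_mono power_mono)
qed

text \<open>Two exchanges of integration. As the Fourier transform of a Gaussian is a Gaussian, the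
  frequency cut-off becomes a Gaussian kernel of width \<open>s\<close> in space.\<close>

lemma gauss_energy_eq:
  assumes g: "integrable lborel g" and s: "0 < s"
  shows "complex_of_real (gauss_energy g s)
      = (LINT x|lborel. g x * (LINT y|lborel. cnj (g y) * complex_of_real (exp (- ((x - y) / s)\<^sup>2 / 2))))"
proof -
  have [measurable]: "g \<in> borel_measurable borel" using borel_measurable_integrable[OF g] by simp
  have [measurable]: "(\<lambda>x. cnj (g x)) \<in> borel_measurable borel"
    by (intro borel_measurable_continuous_on[of cnj] continuous_intros) simp_all
  define n where "n \<xi> = complex_of_real (std_normal_density \<xi>)" for \<xi>
  define c where "c \<xi> = cnj (fourier g (\<xi> / s))" for \<xi>
  have n: "integrable lborel n" unfolding n_def by (rule integrable_std_normal)
  have [measurable]: "n \<in> borel_measurable borel" unfolding n_def[abs_def] by measurable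
  have [measurable]: "c \<in> borel_measurable borel"
    unfolding c_def[abs_def] by (intro borel_measurable_continuous_on[of cnj] continuous_intros) simp_all
  have c_eq: "c \<xi> = (LINT y|lborel. cnj (g y) * iexp (\<xi> * y / s))" for \<xi>
    unfolding c_def fourier_def by (subst Bochner_Integration.integral_cnj[symmetric]) (simp add: exp_cnj)
  have nc: "integrable lborel (\<lambda>\<xi>. n \<xi> * c \<xi>)"
  proof (rule Bochner_Integration.integrable_bound)
    show "integrable lborel (\<lambda>\<xi>. n \<xi> * of_real (LINT x|lborel. norm (g x)))" using n by simp
    show "AE \<xi> in lborel. norm (n \<xi> * c \<xi>) \<le> norm (n \<xi> * of_real (LINT x|lborel. norm (g x)))"
      using norm_fourier_le[OF g] by (intro AE_I2) (auto simp: norm_mult c_def intro!: mult_left_mono)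
  qed measurable
  have "complex_of_real (gauss_energy g s) = (LINT \<xi>|lborel. (n \<xi> * c \<xi>) * fourier g (\<xi> / s))"
    unfolding gauss_energy_def integral_complex_of_real[symmetric]
    by (rule Bochner_Integration.integral_cong[OF refl])
       (simp only: n_def c_def of_real_mult complex_norm_square mult_ac)
  also have "\<dots> = (LINT \<xi>|lborel. (n \<xi> * c \<xi>) * (LINT x|lborel. g x * iexp (- (\<xi> / s * x))))"
    by (simp only: fourier_def)
  also have "\<dots> = (LINT x|lborel. g x * (LINT \<xi>|lborel. (n \<xi> * c \<xi>) * iexp (- (\<xi> / s * x))))"
    by (rule Fubini_product_bounded[OF nc g]) (auto simp: norm_exp_i_times)
  also have "\<dots> = (LINT x|lborel. g x * (LINT y|lborel. cnj (g y) * complex_of_real (exp (- ((x - y) / s)\<^sup>2 / 2))))"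
  proof (rule Bochner_Integration.integral_cong[OF refl], rule arg_cong2[where f = "(*)", OF refl])
    fix x
    have nx: "integrable lborel (\<lambda>\<xi>. n \<xi> * iexp (- (\<xi> / s * x)))"
      by (rule Bochner_Integration.integrable_bound[OF n]) (auto simp: norm_mult)
    have gc: "integrable lborel (\<lambda>y. cnj (g y))" using g by simp
    have "(LINT \<xi>|lborel. (n \<xi> * c \<xi>) * iexp (- (\<xi> / s * x)))
        = (LINT \<xi>|lborel. (n \<xi> * iexp (- (\<xi> / s * x))) * (LINT y|lborel. cnj (g y) * iexp (\<xi> * y / s)))"
      by (rule Bochner_Integration.integral_cong) (simp_all only: c_eq mult_ac)
    also have "\<dots> = (LINT y|lborel. cnj (g y) * (LINT \<xi>|lborel. (n \<xi> * iexp (- (\<xi> / s * x))) * iexp (\<xi> * y / s)))"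
      by (rule Fubini_product_bounded[OF nx gc]) (auto simp: norm_exp_i_times)
    also have "\<dots> = (LINT y|lborel. cnj (g y) * complex_of_real (exp (- ((x - y) / s)\<^sup>2 / 2)))"
    proof (rule Bochner_Integration.integral_cong[OF refl], rule arg_cong2[where f = "(*)", OF refl])
      fix y
      have "(n \<xi> * iexp (- (\<xi> / s * x))) * iexp (\<xi> * y / s) = n \<xi> * iexp (((y - x) / s) * \<xi>)" for \<xi>
        unfolding mult.assoc exp_add[symmetric] using s by (simp add: field_simps)
      then have "(LINT \<xi>|lborel. (n \<xi> * iexp (- (\<xi> / s * x))) * iexp (\<xi> * y / s)) = complex_of_real (exp (- ((y - x) / s)\<^sup>2 / 2))"
        using std_normal_fourier[of "(y - x) / s"] by (simp only: n_def)
      then show "(LINT \<xi>|lborel. (n \<xi> * iexp (- (\<xi> / s * x))) * iexp (\<xi> * y / s)) = complex_of_real (exp (- ((x - y) / s)\<^sup>2 / 2))"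
        by (simp only: power_divide power2_commute[of y])
    qed
    finally show "(LINT \<xi>|lborel. (n \<xi> * c \<xi>) * iexp (- (\<xi> / s * x)))
        = (LINT y|lborel. cnj (g y) * complex_of_real (exp (- ((x - y) / s)\<^sup>2 / 2)))" .
  qed
  finally show ?thesis .
qed

text \<open>The Gaussian kernel of width \<open>s\<close>, divided by \<open>s\<close>, is an
  approximate identity of mass sqrt(2 pi). Boundedness of \<open>g\<close> provides the majorant and
  continuity almost everywhere the pointwise limit; the functions to which this is applied have only
  finitely many discontinuities.\<close>

lemma gauss_energy_limit:
  assumes g: "integrable lborel g" and bnd: "\<And>x. norm (g x) \<le> M" and cont: "AE x in lborel. isCont g x"
  shows "(\<lambda>m. gauss_energy g (1 / real (Suc m)) * real (Suc m)) \<longlonglongrightarrow> sqrt (2 * pi) * (LINT x|lborel. (norm (g x))\<^sup>2)"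
proof -
  have [measurable]: "g \<in> borel_measurable borel" using borel_measurable_integrable[OF g] by simp
  have [measurable]: "(\<lambda>x. cnj (g x)) \<in> borel_measurable borel"
    by (intro borel_measurable_continuous_on[of cnj] continuous_intros) simp_all
  define e where "e v = complex_of_real (exp (- v\<^sup>2 / 2))" for v :: real
  have e_eq: "e v = of_real (sqrt (2 * pi)) * complex_of_real (std_normal_density v)" for v
    by (simp add: e_def std_normal_density_def)
  have e: "integrable lborel e"
    unfolding e_eq[abs_def] using integrable_std_normal by simp
  have [measurable]: "e \<in> borel_measurable borel" using borel_measurable_integrable[OF e] by simp
  have e_int: "(LINT v|lborel. e v) = of_real (sqrt (2 * pi))"
    using std_normal_fourier[of 0] by (simp add: e_eq)
  have M: "0 \<le> M" using order_trans[OF norm_ge_zero bnd] by blast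
  define s where "s m = 1 / real (Suc m)" for m
  have s: "0 < s m" for m by (simp add: s_def)
  have s0: "s \<longlonglongrightarrow> 0"
    unfolding s_def using LIMSEQ_inverse_real_of_nat by (simp add: inverse_eq_divide)
  \<comment> \<open>The inner integral after y = x + s v: the scale leaves the Gaussian and enters
    the argument of \<open>g\<close>.\<close>
  define I where "I m x = (LINT v|lborel. cnj (g (x + s m * v)) * e v)" for m x
  have [measurable]: "I m \<in> borel_measurable borel" for m
    unfolding I_def[abs_def] by measurable
  have I_eq: "(LINT y|lborel. cnj (g y) * e ((x - y) / s m)) = of_real (s m) * I m x" for m x
  proof -
    have "(LINT y|lborel. cnj (g y) * e ((x - y) / s m))
        = \<bar>s m\<bar> *\<^sub>R (LINT v|lborel. cnj (g (x + s m * v)) * e ((x - (x + s m * v)) / s m))"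
      by (rule lborel_integral_real_affine) (use s[of m] in auto)
    then show ?thesis
      using s[of m] by (simp add: I_def scaleR_conv_of_real e_def power_mult_distrib)
  qed
  have I_le: "norm (I m x) \<le> M * sqrt (2 * pi)" for m x
  proof -
    have "norm (I m x) \<le> (LINT v|lborel. M * norm (e v))"
      unfolding I_def
    proof (rule Bochner_Integration.integral_norm_bound_integral)
      show "integrable lborel (\<lambda>v. M * norm (e v))" using e by simp
      then show "integrable lborel (\<lambda>v. cnj (g (x + s m * v)) * e v)"
        by (rule Bochner_Integration.integrable_bound)
           (use bnd M in \<open>auto simp: norm_mult intro!: mult_right_mono\<close>)
      show "norm (cnj (g (x + s m * v)) * e v) \<le> M * norm (e v)" for v
        using bnd by (auto simp: norm_mult intro!: mult_right_mono)
    qed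
    also have "\<dots> = M * sqrt (2 * pi)"
    proof -
      have "complex_of_real (LINT v|lborel. norm (e v)) = (LINT v|lborel. e v)"
        unfolding integral_complex_of_real[symmetric] by (simp add: e_def)
      then have "(LINT v|lborel. norm (e v)) = sqrt (2 * pi)"
        unfolding e_int by (simp only: of_real_eq_iff)
      then show ?thesis by simp
    qed
    finally show ?thesis .
  qed
  have "complex_of_real (gauss_energy g (s m) * real (Suc m)) = (LINT x|lborel. g x * I m x)" for m
  proof -
    have "complex_of_real (gauss_energy g (s m)) = (LINT x|lborel. g x * (of_real (s m) * I m x))"
      unfolding gauss_energy_eq[OF g s] e_def[symmetric] I_eq ..
    also have "\<dots> = of_real (s m) * (LINT x|lborel. g x * I m x)"
      by (subst integral_mult_right_zero[symmetric]) (simp only: mult_ac)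
    finally show ?thesis by (simp add: s_def del: of_nat_Suc)
  qed
  moreover have "(\<lambda>m. LINT x|lborel. g x * I m x) \<longlonglongrightarrow> (LINT x|lborel. g x * (cnj (g x) * of_real (sqrt (2 * pi))))"
  proof (rule integral_dominated_convergence[where w = "\<lambda>x. norm (g x) * (M * sqrt (2 * pi))"])
    show "integrable lborel (\<lambda>x. norm (g x) * (M * sqrt (2 * pi)))" using g by simp
    show "AE x in lborel. norm (g x * I m x) \<le> norm (g x) * (M * sqrt (2 * pi))" for m
      using I_le by (intro AE_I2) (auto simp: norm_mult intro: mult_left_mono)
    show "AE x in lborel. (\<lambda>m. g x * I m x) \<longlonglongrightarrow> g x * (cnj (g x) * of_real (sqrt (2 * pi)))"
      using cont
    proof eventually_elim
      case (elim x)
      have "(\<lambda>m. I m x) \<longlonglongrightarrow> (LINT v|lborel. cnj (g x) * e v)"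
        unfolding I_def
      proof (rule integral_dominated_convergence[where w = "\<lambda>v. M * norm (e v)"])
        show "integrable lborel (\<lambda>v. M * norm (e v))" using e by simp
        show "AE v in lborel. norm (cnj (g (x + s m * v)) * e v) \<le> M * norm (e v)" for m
          using bnd by (intro AE_I2) (auto simp: norm_mult intro: mult_right_mono)
        show "AE v in lborel. (\<lambda>m. cnj (g (x + s m * v)) * e v) \<longlonglongrightarrow> cnj (g x) * e v"
        proof (rule AE_I2)
          fix v
          have "(\<lambda>m. x + s m * v) \<longlonglongrightarrow> x + 0 * v" by (intro tendsto_intros s0)
          then have "(\<lambda>m. g (x + s m * v)) \<longlonglongrightarrow> g x"
            using isCont_tendsto_compose[OF elim] by simp
          then show "(\<lambda>m. cnj (g (x + s m * v)) * e v) \<longlonglongrightarrow> cnj (g x) * e v"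
            by (intro tendsto_intros)
        qed
      qed measurable
      then show ?case by (intro tendsto_mult_left) (simp add: e_int)
    qed
  qed measurable
  ultimately have "(\<lambda>m. complex_of_real (gauss_energy g (s m) * real (Suc m))) \<longlonglongrightarrow> (LINT x|lborel. g x * (cnj (g x) * of_real (sqrt (2 * pi))))"
    by simp
  moreover have "(LINT x|lborel. g x * (cnj (g x) * of_real (sqrt (2 * pi)))) = complex_of_real (sqrt (2 * pi) * (LINT x|lborel. (norm (g x))\<^sup>2))"
  proof -
    have "z * (cnj z * of_real r) = complex_of_real (r * (norm z)\<^sup>2)" for z and r :: real
      by (simp only: of_real_mult complex_norm_square mult_ac)
    then have "(LINT x|lborel. g x * (cnj (g x) * of_real (sqrt (2 * pi)))) = (LINT x|lborel. complex_of_real (sqrt (2 * pi) * (norm (g x))\<^sup>2))"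
      by (intro Bochner_Integration.integral_cong[OF refl])
    then show ?thesis by (simp only: integral_complex_of_real) simp
  qed
  ultimately have "(\<lambda>m. complex_of_real (gauss_energy g (s m) * real (Suc m)))
      \<longlonglongrightarrow> complex_of_real (sqrt (2 * pi) * (LINT x|lborel. (norm (g x))\<^sup>2))"
    by (simp only:)
  then show ?thesis by (simp only: tendsto_of_real_iff s_def)
qed

text \<open>The half of Plancherel's theorem that is needed, with Gaussian regularisation.\<close>

lemma L2_le_of_fourier_le:
  assumes f: "integrable lborel f" "\<And>x. norm (f x) \<le> M" "AE x in lborel. isCont f x"
    and g: "integrable lborel g" "\<And>x. norm (g x) \<le> M'" "AE x in lborel. isCont g x"
    and le: "\<And>\<xi>. norm (fourier g \<xi>) \<le> C * norm (fourier f \<xi>)" and C: "0 \<le> C"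
  shows "(LINT x|lborel. (norm (g x))\<^sup>2) \<le> C\<^sup>2 * (LINT x|lborel. (norm (f x))\<^sup>2)"
proof -
  have "gauss_energy g s \<le> C\<^sup>2 * gauss_energy f s" for s
  proof -
    have "gauss_energy g s \<le> (LINT \<xi>|lborel. C\<^sup>2 * (std_normal_density \<xi> * (norm (fourier f (\<xi> / s)))\<^sup>2))"
      unfolding gauss_energy_def
    proof (rule integral_mono[OF gauss_energy_integrable[OF g(1)]])
      show "integrable lborel (\<lambda>\<xi>. C\<^sup>2 * (std_normal_density \<xi> * (norm (fourier f (\<xi> / s)))\<^sup>2))"
        using gauss_energy_integrable[OF f(1)] by simp
      fix \<xi>
      have "(norm (fourier g (\<xi> / s)))\<^sup>2 \<le> (C * norm (fourier f (\<xi> / s)))\<^sup>2"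
        by (intro power_mono le) auto
      from mult_left_mono[OF this, of "std_normal_density \<xi>"]
      show "std_normal_density \<xi> * (norm (fourier g (\<xi> / s)))\<^sup>2 \<le> C\<^sup>2 * (std_normal_density \<xi> * (norm (fourier f (\<xi> / s)))\<^sup>2)"
        by (simp add: power_mult_distrib mult_ac)
    qed
    then show ?thesis by (simp add: gauss_energy_def)
  qed
  then have "gauss_energy g s * r \<le> C\<^sup>2 * (gauss_energy f s * r)" if "0 \<le> r" for s r
    using mult_right_mono[OF _ that, of "gauss_energy g s" "C\<^sup>2 * gauss_energy f s"] by (simp add: mult_ac)
  then have "sqrt (2 * pi) * (LINT x|lborel. (norm (g x))\<^sup>2) \<le> C\<^sup>2 * (sqrt (2 * pi) * (LINT x|lborel. (norm (f x))\<^sup>2))"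
    by (intro LIMSEQ_le[OF gauss_energy_limit[OF g] tendsto_mult_left[OF gauss_energy_limit[OF f]]]) auto
  then have "sqrt (2 * pi) * (LINT x|lborel. (norm (g x))\<^sup>2) \<le> sqrt (2 * pi) * (C\<^sup>2 * (LINT x|lborel. (norm (f x))\<^sup>2))"
    by (simp only: mult_ac)
  then show ?thesis by (rule mult_left_le_imp_le) simp
qed

section \<open>Boundedness and inversion of \<open>J\<^sup>\<alpha>\<close>\<close>

lemma integral_leb_borel:
  fixes h :: "real \<Rightarrow> 'a::{banach, second_countable_topology}"
  assumes [measurable]: "h \<in> borel_measurable borel"
  shows "(LINT x|leb \<omega>. h x) = (LINT x|lborel. indicator {0<..<\<omega>} x *\<^sub>R h x)"
  by (subst integral_restrict_space) (simp_all add: integral_completion)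

lemma Gamma_imaginary_nonzero:
  assumes "Re \<alpha> = 0"
  shows "Gamma (\<alpha> + 1) \<noteq> 0"
proof -
  have "\<alpha> + 1 \<notin> \<int>\<^sub>\<le>\<^sub>0" using assms by (auto elim!: nonpos_Ints_cases simp: complex_eq_iff)
  then show ?thesis by (simp add: Gamma_eq_zero_iff)
qed

text \<open>The weight exp(-x) moves the Laplace variable to 1 + i\<xi>, inside the half plane of
  \<open>Laplace_tpow\<close>; the translation by \<open>a\<close> contributes the exponential
  factor.\<close>

lemma shifted_tpow_transform:
  assumes \<alpha>: "Re \<alpha> = 0"
  shows "has_bochner_integral lborel (\<lambda>x. tpow \<alpha> (x - a) * exp (- of_real x) * iexp (- (\<xi> * x)))
     (exp (- (1 + \<i> * of_real \<xi>) * of_real a) * (Gamma (\<alpha> + 1) * (1 + \<i> * of_real \<xi>) powr (- \<alpha> - 1)))"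
proof -
  define z where "z = 1 + \<i> * of_real \<xi>"
  have "has_bochner_integral lborel (\<lambda>x. exp (- z * of_real a) * (tpow \<alpha> x * exp (- z * of_real x)))
     (exp (- z * of_real a) * (Gamma (\<alpha> + 1) * z powr (- \<alpha> - 1)))"
    by (intro has_bochner_integral_mult_right Laplace_tpow \<alpha>) (simp add: z_def)
  moreover have "exp (- z * of_real a) * (tpow \<alpha> x * exp (- z * of_real x)) =
      tpow \<alpha> ((a + 1 * x) - a) * exp (- of_real (a + 1 * x)) * iexp (- (\<xi> * (a + 1 * x)))" for x
  proof -
    have "exp (- z * of_real a) * exp (- z * of_real x) = exp (- of_real (a + 1 * x)) * iexp (- (\<xi> * (a + 1 * x)))"
      unfolding exp_add[symmetric] z_def by (simp add: algebra_simps)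
    then show ?thesis by (simp add: mult_ac)
  qed
  ultimately have "has_bochner_integral lborel (\<lambda>x. tpow \<alpha> ((a + 1 * x) - a) * exp (- of_real (a + 1 * x)) * iexp (- (\<xi> * (a + 1 * x))))
     (exp (- z * of_real a) * (Gamma (\<alpha> + 1) * z powr (- \<alpha> - 1)) /\<^sub>R \<bar>1\<bar>)"
    by (simp only: abs_one inverse_1 scaleR_one)
  then show ?thesis
    unfolding z_def by (subst (asm) lborel_has_bochner_integral_real_affine_iff[symmetric]) auto
qed

text \<open>Collects the hypotheses of \<open>L2_le_of_fourier_le\<close> for the weighted image of
  a step function under J^\<alpha>. The instance \<alpha> = 0 treats the weighted step function
  itself, so one lemma serves both sides of the inequality.\<close>

lemma weighted_tpow_sum:
  fixes \<alpha> :: complex and c :: "real \<Rightarrow> complex"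
  assumes \<alpha>: "Re \<alpha> = 0" and A: "finite A" "A \<subseteq> {0..}"
  defines "g \<equiv> (\<lambda>x. \<Sum>a\<in>A. c a * (tpow \<alpha> (x - a) * exp (- complex_of_real x)) / Gamma (\<alpha> + 1))"
  shows "integrable lborel g" "\<And>x. norm (g x) \<le> (\<Sum>a\<in>A. norm (c a) / norm (Gamma (\<alpha> + 1)))"
    "AE x in lborel. isCont g x"
    "\<And>\<xi>. fourier g \<xi> = (\<Sum>a\<in>A. c a * exp (- (1 + \<i> * of_real \<xi>) * of_real a)) * (1 + \<i> * of_real \<xi>) powr (- \<alpha> - 1)"
proof -
  have nz: "Gamma (\<alpha> + 1) \<noteq> 0" by (rule Gamma_imaginary_nonzero[OF \<alpha>])
  have single: "integrable lborel (\<lambda>x. tpow \<alpha> (x - a) * exp (- complex_of_real x))" for a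
    using shifted_tpow_transform[OF \<alpha>, of a 0] by (simp add: has_bochner_integral_iff)
  show "integrable lborel g"
    unfolding g_def by (intro Bochner_Integration.integrable_sum integrable_divide integrable_mult_right single)
  show "norm (g x) \<le> (\<Sum>a\<in>A. norm (c a) / norm (Gamma (\<alpha> + 1)))" for x
    unfolding g_def
  proof (rule sum_norm_le)
    fix a assume "a \<in> A"
    have "norm (tpow \<alpha> (x - a) * exp (- complex_of_real x)) \<le> 1"
    proof (cases "a < x")
      case True
      then have "0 < x" using \<open>a \<in> A\<close> A(2) by force
      then have "norm (exp (- complex_of_real x)) \<le> 1" by (simp add: norm_exp_eq_Re)
      then show ?thesis using mult_mono[OF norm_tpow_imaginary_le[OF \<alpha>, of "x - a"]] by (force simp: norm_mult)
    qed simp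
    then show "norm (c a * (tpow \<alpha> (x - a) * exp (- complex_of_real x)) / Gamma (\<alpha> + 1)) \<le> norm (c a) / norm (Gamma (\<alpha> + 1))"
      unfolding norm_divide norm_mult[of "c a"] by (intro divide_right_mono mult_left_le) auto
  qed
  have "AE x in lborel. x \<notin> A"
    by (rule AE_not_in) (use A(1) in \<open>simp add: finite_imp_null_set_lborel\<close>)
  then show "AE x in lborel. isCont g x"
  proof eventually_elim
    case (elim x)
    have "isCont (\<lambda>x. tpow \<alpha> (x - a)) x" if "a \<in> A" for a
    proof (rule isCont_o2[where g = "tpow \<alpha>" and f = "\<lambda>x. x - a"])
      show "isCont (tpow \<alpha>) (x - a)"
        using elim that isCont_tpow[of "x - a" \<alpha>] isCont_tpow_neg[of "x - a" \<alpha>] by (cases x a rule: linorder_cases) auto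
    qed simp
    then show ?case unfolding g_def using nz by (intro continuous_intros) auto
  qed
  show "fourier g \<xi> = (\<Sum>a\<in>A. c a * exp (- (1 + \<i> * of_real \<xi>) * of_real a)) * (1 + \<i> * of_real \<xi>) powr (- \<alpha> - 1)" for \<xi>
  proof -
    have "fourier g \<xi> = (LINT x|lborel. (\<Sum>a\<in>A. (c a / Gamma (\<alpha> + 1)) * (tpow \<alpha> (x - a) * exp (- of_real x) * iexp (- (\<xi> * x)))))"
      unfolding fourier_def g_def by (simp add: sum_distrib_right mult.assoc)
    also have "\<dots> = (\<Sum>a\<in>A. (c a / Gamma (\<alpha> + 1)) * (LINT x|lborel. tpow \<alpha> (x - a) * exp (- of_real x) * iexp (- (\<xi> * x))))"
      using shifted_tpow_transform[OF \<alpha>]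
      by (subst Bochner_Integration.integral_sum) (auto simp: has_bochner_integral_iff)
    also have "\<dots> = (\<Sum>a\<in>A. (c a / Gamma (\<alpha> + 1)) * (exp (- (1 + \<i> * of_real \<xi>) * of_real a) * (Gamma (\<alpha> + 1) * (1 + \<i> * of_real \<xi>) powr (- \<alpha> - 1))))"
      using shifted_tpow_transform[OF \<alpha>] by (simp only: has_bochner_integral_iff)
    also have "\<dots> = (\<Sum>a\<in>A. c a * exp (- (1 + \<i> * of_real \<xi>) * of_real a)) * (1 + \<i> * of_real \<xi>) powr (- \<alpha> - 1)"
      unfolding sum_distrib_right by (rule sum.cong) (use nz in \<open>auto simp: field_simps\<close>)
    finally show ?thesis .
  qed
qed

lemma tpow_zero_shift: "tpow 0 (x - a) = indicator {a<..} x"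
  by (simp add: tpow_zero indicator_def)

text \<open>The function on the left is J^\<alpha> of the step function on the right. With the
  weight exp(-x) their Fourier transforms differ by the factor (1 + i\<xi>)^(-\<alpha>), of modulus
  at most exp(pi |Im \<alpha>|). Removing the weight from the image on (0, \<omega>) costs the
  factor exp \<omega>.\<close>

lemma steps_J_bound:
  fixes \<alpha> :: complex
  assumes \<alpha>: "Re \<alpha> = 0" and A: "finite A" "A \<subseteq> {0..\<omega>}" "sum c A = 0"
  shows "L2_norm (leb \<omega>) (\<lambda>x. \<Sum>a\<in>A. c a * tpow \<alpha> (x - a) / Gamma (\<alpha> + 1))
    \<le> exp (pi * \<bar>Im \<alpha>\<bar>) * exp \<omega> * L2_norm (leb \<omega>) (\<lambda>x. \<Sum>a\<in>A. c a * indicator {a<..} x)"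
proof -
  define s where "s x = (\<Sum>a\<in>A. c a * indicator {a<..} x)" for x
  define T where "T x = (\<Sum>a\<in>A. c a * tpow \<alpha> (x - a) / Gamma (\<alpha> + 1))" for x
  have [measurable]: "s \<in> borel_measurable borel" "T \<in> borel_measurable borel"
    unfolding s_def[abs_def] T_def[abs_def] by measurable
  define g where "g = (\<lambda>x. \<Sum>a\<in>A. c a * (tpow \<alpha> (x - a) * exp (- complex_of_real x)) / Gamma (\<alpha> + 1))"
  define f where "f = (\<lambda>x. \<Sum>a\<in>A. c a * (tpow 0 (x - a) * exp (- complex_of_real x)) / Gamma (0 + 1))"
  have g_eq: "g x = T x * exp (- complex_of_real x)" for x
    by (simp add: g_def T_def sum_distrib_right mult.assoc)
  have f_eq: "f x = s x * exp (- complex_of_real x)" for x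
    by (simp add: f_def s_def sum_distrib_right tpow_zero_shift mult.assoc)
  have A0: "A \<subseteq> {0..}" using A(2) by auto
  have rot: "norm (fourier g \<xi>) \<le> exp (pi * \<bar>Im \<alpha>\<bar>) * norm (fourier f \<xi>)" for \<xi>
  proof -
    define z where "z = 1 + \<i> * complex_of_real \<xi>"
    have "z powr (- \<alpha> - 1) = z powr (- \<alpha>) * z powr (- 0 - 1)"
      by (simp flip: powr_add)
    then have "fourier g \<xi> = z powr (- \<alpha>) * fourier f \<xi>"
      using weighted_tpow_sum(4)[where c = c, OF \<alpha> A(1) A0, of \<xi>] weighted_tpow_sum(4)[where \<alpha> = 0 and c = c, OF zero_complex.sel(1) A(1) A0, of \<xi>]
      unfolding g_def[symmetric] f_def[symmetric] z_def[symmetric] by (simp only: mult_ac)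
    then show ?thesis
      using norm_powr_imaginary_le[OF \<alpha>, of z] by (simp add: norm_mult mult_right_mono)
  qed
  have F: "integrable lborel f" "AE x in lborel. isCont f x"
    unfolding f_def by (rule weighted_tpow_sum[OF zero_complex.sel(1) A(1) A0])+
  have fb: "norm (f x) \<le> (\<Sum>a\<in>A. norm (c a) / norm (Gamma (0 + 1 :: complex)))" for x
    unfolding f_def by (rule weighted_tpow_sum(2)[OF zero_complex.sel(1) A(1) A0])
  have G: "integrable lborel g" "AE x in lborel. isCont g x"
    unfolding g_def by (rule weighted_tpow_sum[OF \<alpha> A(1) A0])+
  have gb: "norm (g x) \<le> (\<Sum>a\<in>A. norm (c a) / norm (Gamma (\<alpha> + 1)))" for x
    unfolding g_def by (rule weighted_tpow_sum(2)[OF \<alpha> A(1) A0])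
  have main: "(LINT x|lborel. (norm (g x))\<^sup>2) \<le> (exp (pi * \<bar>Im \<alpha>\<bar>))\<^sup>2 * (LINT x|lborel. (norm (f x))\<^sup>2)"
    by (rule L2_le_of_fourier_le[OF F(1) fb F(2) G(1) gb G(2) rot]) auto
  have sq_int: "integrable lborel (\<lambda>x. (norm (h x))\<^sup>2)"
    if h: "integrable lborel h" "\<And>x. norm (h x) \<le> M" for h :: "real \<Rightarrow> complex" and M
  proof (rule Bochner_Integration.integrable_bound)
    show "integrable lborel (\<lambda>x. M * norm (h x))" using h(1) by simp
    show "(\<lambda>x. (norm (h x))\<^sup>2) \<in> borel_measurable lborel" using borel_measurable_integrable[OF h(1)] by measurable
    have "0 \<le> M" using order_trans[OF norm_ge_zero h(2)] by blast
    then show "AE x in lborel. norm ((norm (h x))\<^sup>2) \<le> norm (M * norm (h x))"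
      using h(2) by (intro AE_I2) (auto simp: power2_eq_square intro: mult_right_mono)
  qed
  have g2: "integrable lborel (\<lambda>x. (norm (g x))\<^sup>2)" and f2: "integrable lborel (\<lambda>x. (norm (f x))\<^sup>2)"
    using sq_int[OF G(1) gb] sq_int[OF F(1) fb] by auto
  have sbound: "norm (s x) \<le> (\<Sum>a\<in>A. norm (c a))" for x
    unfolding s_def by (rule sum_norm_le) (auto simp: norm_mult indicator_def)
  have Tbound: "norm (T x) \<le> (\<Sum>a\<in>A. norm (c a) / norm (Gamma (\<alpha> + 1)))" for x
    unfolding T_def using norm_tpow_imaginary_le[OF \<alpha>]
    by (intro sum_norm_le) (auto simp: norm_mult norm_divide intro!: divide_right_mono mult_left_le)
  have ind_int: "integrable lborel (\<lambda>x. indicator {0<..<\<omega>} x *\<^sub>R (norm (h x))\<^sup>2 :: real)"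
    if [measurable]: "h \<in> borel_measurable borel" and h: "\<And>x. norm (h x) \<le> M" for h :: "real \<Rightarrow> complex" and M
  proof -
    have "integrable lborel (\<lambda>x. indicator {0<..<\<omega>} x * complex_of_real ((norm (h x))\<^sup>2))"
      by (rule integrable_indicator_bounded[where C = "M\<^sup>2"]) (use h in \<open>auto simp: norm_power intro: power_mono\<close>)
    then have "integrable lborel (\<lambda>x. complex_of_real (indicator {0<..<\<omega>} x * (norm (h x))\<^sup>2))"
      by (simp add: of_real_indicator)
    then show ?thesis unfolding complex_of_real_integrable_eq by simp
  qed
  have "(L2_norm (leb \<omega>) T)\<^sup>2 = (LINT x|lborel. indicator {0<..<\<omega>} x *\<^sub>R (norm (T x))\<^sup>2)"
    unfolding L2_norm_square by (rule integral_leb_borel) measurable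
  also have "\<dots> \<le> (LINT x|lborel. (exp \<omega>)\<^sup>2 * (norm (g x))\<^sup>2)"
  proof (rule integral_mono[OF ind_int[OF _ Tbound]])
    show "integrable lborel (\<lambda>x. (exp \<omega>)\<^sup>2 * (norm (g x))\<^sup>2)" using g2 by simp
    fix x
    show "indicator {0<..<\<omega>} x *\<^sub>R (norm (T x))\<^sup>2 \<le> (exp \<omega>)\<^sup>2 * (norm (g x))\<^sup>2"
    proof (cases "x < \<omega>")
      case True
      have "norm (T x) = exp x * norm (g x)"
        by (simp add: g_eq norm_mult norm_exp_eq_Re mult.left_commute flip: exp_add)
      also have "\<dots> \<le> exp \<omega> * norm (g x)" using True by (intro mult_right_mono) auto
      finally have "(norm (T x))\<^sup>2 \<le> (exp \<omega> * norm (g x))\<^sup>2" by (rule power_mono) simp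
      then show ?thesis by (auto simp: indicator_def power_mult_distrib)
    qed (simp add: indicator_def)
  qed measurable
  also have "\<dots> \<le> (exp \<omega>)\<^sup>2 * ((exp (pi * \<bar>Im \<alpha>\<bar>))\<^sup>2 * (LINT x|lborel. (norm (f x))\<^sup>2))"
    using main by (simp add: mult_left_mono)
  also have "(LINT x|lborel. (norm (f x))\<^sup>2) \<le> (LINT x|lborel. indicator {0<..<\<omega>} x *\<^sub>R (norm (s x))\<^sup>2)"
  proof (rule integral_mono_AE[OF f2 ind_int[OF _ sbound]])
    have "AE x in lborel. x \<noteq> \<omega>" by (rule AE_lborel_singleton)
    then show "AE x in lborel. (norm (f x))\<^sup>2 \<le> indicator {0<..<\<omega>} x *\<^sub>R (norm (s x))\<^sup>2"
    proof eventually_elim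
      case (elim x)
      \<comment> \<open>Left of 0 no jump has occurred; inside the interval the weight is at most 1;
        beyond \<omega> all jumps have occurred and cancel because
        \<open>sum c A = 0\<close>.\<close>
      consider "x \<le> 0" | "0 < x" "x < \<omega>" | "\<omega> < x" using elim by linarith
      then show ?case
      proof cases
        case 1
        then have "s x = 0" unfolding s_def using A0 by (intro sum.neutral) (auto simp: indicator_def)
        then show ?thesis by (simp add: f_eq)
      next
        case 2
        then have "norm (f x) \<le> norm (s x)" by (simp add: f_eq norm_mult norm_exp_eq_Re mult_left_le)
        then show ?thesis using 2 by (simp add: power_mono)
      next
        case 3
        then have "s x = sum c A" unfolding s_def using A(2) by (intro sum.cong) (auto simp: indicator_def)
        then show ?thesis using A(3) by (simp add: f_eq)
      qed
    qed
  qed measurable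
  also have "(LINT x|lborel. indicator {0<..<\<omega>} x *\<^sub>R (norm (s x))\<^sup>2) = (L2_norm (leb \<omega>) s)\<^sup>2"
    unfolding L2_norm_square by (rule integral_leb_borel[symmetric]) measurable
  finally have "(L2_norm (leb \<omega>) T)\<^sup>2 \<le> (exp (pi * \<bar>Im \<alpha>\<bar>) * exp \<omega> * L2_norm (leb \<omega>) s)\<^sup>2"
    by (simp add: power_mult_distrib mult_ac mult_left_mono)
  then show ?thesis
    unfolding T_def s_def by (rule power2_le_imp_le) simp
qed

text \<open>The Riemann-Liouville integral of order \<alpha> + 1 without its Gamma factor; the upper
  limit \<open>u\<close> is built into \<open>tpow\<close>. For imaginary \<alpha> the kernel is
  bounded, so every single value is a continuous functional on L^2. For \<alpha> = 0 it is the
  ordinary primitive.\<close>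

definition rlint :: "real \<Rightarrow> complex \<Rightarrow> (real \<Rightarrow> complex) \<Rightarrow> real \<Rightarrow> complex" where
  "rlint \<omega> \<alpha> f u = (LINT t|leb \<omega>. tpow \<alpha> (u - t) * f t)"

lemma rlint_eq_set_integral:
  assumes "u \<le> \<omega>"
  shows "(LINT t:{0<..<u}|lebesgue. complex_of_real (u - t) powr \<alpha> * f t) = rlint \<omega> \<alpha> f u"
  unfolding rlint_def set_lebesgue_integral_def
  by (subst integral_restrict_space)
     (use assms in \<open>auto simp: indicator_def tpow_eq_powr intro!: Bochner_Integration.integral_cong\<close>)

lemma primitive_eq_rlint:
  assumes "u \<le> \<omega>"
  shows "(LINT t:{0<..<u}|lebesgue. f t) = rlint \<omega> 0 f u"
  unfolding rlint_def set_lebesgue_integral_def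
  by (subst integral_restrict_space)
     (use assms in \<open>auto simp: indicator_def tpow_zero intro!: Bochner_Integration.integral_cong\<close>)

lemma kernel_L2:
  assumes "Re \<alpha> = 0"
  shows "(\<lambda>t. tpow \<alpha> (u - t)) \<in> L2 (leb \<omega>)"
proof -
  interpret finite_measure "leb \<omega>" by (rule finite_measure_leb)
  have "(\<lambda>t. tpow \<alpha> (u - t) * 1) \<in> L2 (leb \<omega>)"
    by (rule L2_mult_bounded[OF L2_const, where C = 1]) (use norm_tpow_imaginary_le[OF assms] in auto)
  then show ?thesis by simp
qed

lemma rlint_add:
  assumes "Re \<alpha> = 0" "f \<in> L2 (leb \<omega>)" "g \<in> L2 (leb \<omega>)"
  shows "rlint \<omega> \<alpha> (\<lambda>t. f t + g t) u = rlint \<omega> \<alpha> f u + rlint \<omega> \<alpha> g u"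
  unfolding rlint_def distrib_left
  by (rule Bochner_Integration.integral_add) (intro L2_mult_integrable kernel_L2 assms)+

lemma rlint_diff:
  assumes "Re \<alpha> = 0" "f \<in> L2 (leb \<omega>)" "g \<in> L2 (leb \<omega>)"
  shows "rlint \<omega> \<alpha> (\<lambda>t. f t - g t) u = rlint \<omega> \<alpha> f u - rlint \<omega> \<alpha> g u"
  unfolding rlint_def right_diff_distrib
  by (rule Bochner_Integration.integral_diff) (intro L2_mult_integrable kernel_L2 assms)+

lemma rlint_cmult: "rlint \<omega> \<alpha> (\<lambda>t. c * f t) u = c * rlint \<omega> \<alpha> f u"
  by (simp add: rlint_def mult.left_commute)

lemma rlint_sum:
  assumes "Re \<alpha> = 0" "\<And>a. a \<in> A \<Longrightarrow> f a \<in> L2 (leb \<omega>)"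
  shows "rlint \<omega> \<alpha> (\<lambda>t. \<Sum>a\<in>A. f a t) u = (\<Sum>a\<in>A. rlint \<omega> \<alpha> (f a) u)"
  unfolding rlint_def sum_distrib_left
  by (rule Bochner_Integration.integral_sum) (intro L2_mult_integrable kernel_L2 assms)

lemma rlint_cong_AE:
  assumes "f \<in> L2 (leb \<omega>)" "g \<in> L2 (leb \<omega>)" "AE x in leb \<omega>. f x = g x"
  shows "rlint \<omega> \<alpha> f u = rlint \<omega> \<alpha> g u"
proof -
  note [measurable] = L2_measurable[OF assms(1)] L2_measurable[OF assms(2)]
  show ?thesis unfolding rlint_def
    by (rule integral_cong_AE) (use assms(3) in \<open>auto elim: eventually_mono\<close>)
qed

text \<open>Cauchy-Schwarz against the kernel. L^2 convergence thus gives convergence at every point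
  \<open>u\<close>, which is the reason why \<open>is_J\<close> is a closed relation.\<close>

lemma rlint_tendsto:
  assumes \<alpha>: "Re \<alpha> = 0" and lim: "L2_tendsto (leb \<omega>) g l F"
  shows "((\<lambda>n. rlint \<omega> \<alpha> (g n) u) \<longlongrightarrow> rlint \<omega> \<alpha> l u) F"
proof -
  have l: "l \<in> L2 (leb \<omega>)" and ev: "\<forall>\<^sub>F t in F. g t \<in> L2 (leb \<omega>)"
    and lim: "((\<lambda>t. L2_norm (leb \<omega>) (\<lambda>x. g t x - l x)) \<longlongrightarrow> 0) F"
    using lim by (auto simp: L2_tendsto_def)
  define K where "K = L2_norm (leb \<omega>) (\<lambda>t. tpow \<alpha> (u - t))"
  have "((\<lambda>n. rlint \<omega> \<alpha> (g n) u - rlint \<omega> \<alpha> l u) \<longlongrightarrow> 0) F"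
  proof (rule Lim_null_comparison)
    show "\<forall>\<^sub>F n in F. norm (rlint \<omega> \<alpha> (g n) u - rlint \<omega> \<alpha> l u) \<le> K * L2_norm (leb \<omega>) (\<lambda>x. g n x - l x)"
      using ev
    proof eventually_elim
      case (elim n)
      show ?case
        unfolding rlint_diff[OF \<alpha> elim l, symmetric] K_def
        by (subst rlint_def) (rule L2_Cauchy_Schwarz[OF kernel_L2[OF \<alpha>] L2_diff[OF elim l]])
    qed
    show "((\<lambda>n. K * L2_norm (leb \<omega>) (\<lambda>x. g n x - l x)) \<longlongrightarrow> 0) F"
      using tendsto_mult_left[OF lim, of K] by simp
  qed
  then show ?thesis by (simp add: LIM_zero_iff)
qed

text \<open>\<open>is_J \<omega> \<alpha> f g\<close> says that \<open>J\<^sup>\<alpha>\<^sup>+\<^sup>1 f\<close> is the primitive of \<open>g\<close>. Unlike the pointwise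
  derivative in the definition of \<^const>\<open>J\<close>, this relation is closed under \<open>L\<^sup>2\<close> limits.\<close>

definition is_J :: "real \<Rightarrow> complex \<Rightarrow> (real \<Rightarrow> complex) \<Rightarrow> (real \<Rightarrow> complex) \<Rightarrow> bool" where
  "is_J \<omega> \<alpha> f g \<longleftrightarrow> (\<forall>u. 0 < u \<longrightarrow> u < \<omega> \<longrightarrow> rlint \<omega> \<alpha> f u = Gamma (\<alpha> + 1) * rlint \<omega> 0 g u)"

text \<open>Both sides of \<open>is_J\<close> agree on an open interval around \<open>x\<close>, so
  Lebesgue's differentiation theorem for the primitive of \<open>g\<close> also differentiates the
  integral in \<open>J\<close>. It doubles as a uniqueness statement: two functions related to the
  same \<open>f\<close> agree almost everywhere.\<close>

lemma is_J_imp_J: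
  assumes \<alpha>: "Re \<alpha> = 0" and g: "g \<in> L2 (leb \<omega>)" and isJ: "is_J \<omega> \<alpha> f g"
  shows "AE x in leb \<omega>. J \<alpha> f x = g x"
proof -
  have "AE x in leb \<omega>. x \<in> space (leb \<omega>)" by (rule AE_space)
  then show ?thesis
    using primitive_has_vector_derivative_AE[OF g]
  proof eventually_elim
    case (elim x)
    then have x: "0 < x" "x < \<omega>" by auto
    have "((\<lambda>u. Gamma (\<alpha> + 1) * (LINT t:{0<..<u}|lebesgue. g t)) has_vector_derivative Gamma (\<alpha> + 1) * g x) (at x)"
      using elim(2) by (rule has_vector_derivative_mult_right)
    then have "((\<lambda>u. LINT t:{0<..<u}|lebesgue. complex_of_real (u - t) powr \<alpha> * f t) has_vector_derivative Gamma (\<alpha> + 1) * g x) (at x)"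
    proof (rule has_vector_derivative_transform_within_open[where S = "{0<..<\<omega>}"])
      fix u assume "u \<in> {0<..<\<omega>}"
      then show "Gamma (\<alpha> + 1) * (LINT t:{0<..<u}|lebesgue. g t)
          = (LINT t:{0<..<u}|lebesgue. complex_of_real (u - t) powr \<alpha> * f t)"
        using isJ rlint_eq_set_integral[of u \<omega> \<alpha> f] primitive_eq_rlint[of u \<omega> g] by (simp add: is_J_def)
    qed (use x in auto)
    then show ?case
      using Gamma_imaginary_nonzero[OF \<alpha>] by (simp add: J_def vector_derivative_at)
  qed
qed

lemma is_J_diff:
  assumes "Re \<alpha> = 0" "f \<in> L2 (leb \<omega>)" "f' \<in> L2 (leb \<omega>)" "g \<in> L2 (leb \<omega>)" "g' \<in> L2 (leb \<omega>)"
    "is_J \<omega> \<alpha> f g" "is_J \<omega> \<alpha> f' g'"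
  shows "is_J \<omega> \<alpha> (\<lambda>x. f x - f' x) (\<lambda>x. g x - g' x)"
  using assms by (simp add: is_J_def rlint_diff right_diff_distrib)

lemma is_J_limit:
  assumes \<alpha>: "Re \<alpha> = 0" and "L2_tendsto (leb \<omega>) f f' sequentially" "L2_tendsto (leb \<omega>) g g' sequentially"
    and "\<And>n. is_J \<omega> \<alpha> (f n) (g n)"
  shows "is_J \<omega> \<alpha> f' g'"
  unfolding is_J_def
proof (intro allI impI)
  fix u assume u: "0 < u" "u < \<omega>"
  have "(\<lambda>n. Gamma (\<alpha> + 1) * rlint \<omega> 0 (g n) u) \<longlonglongrightarrow> Gamma (\<alpha> + 1) * rlint \<omega> 0 g' u"
    by (intro tendsto_mult_left rlint_tendsto assms) simp
  moreover have "(\<lambda>n. rlint \<omega> \<alpha> (f n) u) \<longlonglongrightarrow> rlint \<omega> \<alpha> f' u"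
    by (intro rlint_tendsto assms)
  moreover have "rlint \<omega> \<alpha> (f n) u = Gamma (\<alpha> + 1) * rlint \<omega> 0 (g n) u" for n
    using assms(4) u by (simp add: is_J_def)
  ultimately show "rlint \<omega> \<alpha> f' u = Gamma (\<alpha> + 1) * rlint \<omega> 0 g' u"
    using LIMSEQ_unique by auto
qed

section \<open>Convolutions of truncated powers and J^\<alpha> on step functions\<close>

definition tconv :: "complex \<Rightarrow> complex \<Rightarrow> real \<Rightarrow> complex" where
  "tconv \<beta> \<gamma> y = (LINT w|lborel. tpow \<beta> (y - w) * tpow \<gamma> w)"

lemma tconv_commute: "tconv \<beta> \<gamma> y = tconv \<gamma> \<beta> y"
  unfolding tconv_def
  by (subst lborel_integral_real_affine[where c = "-1" and t = y]) (auto simp: mult.commute)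

lemma rlint_shifted_tpow:
  assumes "0 \<le> a" "u < \<omega>"
  shows "rlint \<omega> \<beta> (\<lambda>x. tpow \<gamma> (x - a)) u = tconv \<beta> \<gamma> (u - a)"
proof -
  have "rlint \<omega> \<beta> (\<lambda>x. tpow \<gamma> (x - a)) u = (LINT t|lborel. tpow \<beta> (u - t) * tpow \<gamma> (t - a))"
    unfolding rlint_def
    by (subst integral_leb_borel)
       (use assms in \<open>auto simp: indicator_def intro!: Bochner_Integration.integral_cong\<close>)
  also have "\<dots> = tconv \<beta> \<gamma> (u - a)"
    unfolding tconv_def by (subst lborel_integral_real_affine[where c = 1 and t = a]) (auto simp: algebra_simps)
  finally show ?thesis .
qed

text \<open>The exponents -\<alpha> and \<alpha> cancel under scaling, so the convolution is
  \<open>y\<close> times a Beta integral; the same computation at exponent 0, where the Beta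
  integral is 1, evaluates \<open>tconv 0 0 y\<close>.\<close>

lemma tconv_imaginary_inverse:
  assumes \<alpha>: "Re \<alpha> = 0"
  shows "tconv (- \<alpha>) \<alpha> y = Gamma (1 - \<alpha>) * Gamma (1 + \<alpha>) * tconv 0 0 y"
proof (cases "0 < y")
  case True
  have scale: "tconv (- \<beta>) \<beta> y = of_real y * (LINT w|lborel. indicator {0<..<1} w * (tpow (- \<beta>) (1 - w) * tpow \<beta> w))" for \<beta>
  proof -
    have pt: "tpow (- \<beta>) (y - y * w) * tpow \<beta> (y * w) = indicator {0<..<1} w * (tpow (- \<beta>) (1 - w) * tpow \<beta> w)" for w
    proof -
      have "tpow (- \<beta>) (y - y * w) * tpow \<beta> (y * w) = (tpow (- \<beta>) y * tpow \<beta> y) * (tpow (- \<beta>) (1 - w) * tpow \<beta> w)"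
        using tpow_mult[OF True, of "-\<beta>" "1 - w"] tpow_mult[OF True, of \<beta> w] by (simp add: algebra_simps)
      also have "\<dots> = tpow (- \<beta>) (1 - w) * tpow \<beta> w" using True by (simp add: tpow_add tpow_zero)
      also have "\<dots> = indicator {0<..<1} w * (tpow (- \<beta>) (1 - w) * tpow \<beta> w)" by (auto simp: indicator_def tpow_def)
      finally show ?thesis .
    qed
    have "tconv (- \<beta>) \<beta> y = of_real y * (LINT w|lborel. tpow (- \<beta>) (y - y * w) * tpow \<beta> (y * w))"
      unfolding tconv_def using True
      by (subst lborel_integral_real_affine[where c = y and t = 0]) (auto simp: scaleR_conv_of_real)
    then show ?thesis by (simp only: pt)
  qed
  show ?thesis
    using scale[of \<alpha>] scale[of 0] Beta_integral_imaginary[OF \<alpha>] Beta_integral_imaginary[of 0] by simp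
next
  case False
  then have "tpow \<beta> (y - w) * tpow \<gamma> w = 0" for \<beta> \<gamma> w by (auto simp: tpow_def)
  then show ?thesis by (simp only: tconv_def Bochner_Integration.integral_zero mult_zero_right)
qed

lemma shifted_tpow_L2:
  assumes "Re \<alpha> = 0"
  shows "(\<lambda>x. tpow \<alpha> (x - a)) \<in> L2 (leb \<omega>)"
proof -
  interpret finite_measure "leb \<omega>" by (rule finite_measure_leb)
  have "(\<lambda>t. tpow \<alpha> (t - a) * 1) \<in> L2 (leb \<omega>)"
    by (rule L2_mult_bounded[OF L2_const, where C = 1]) (use norm_tpow_imaginary_le[OF assms] in auto)
  then show ?thesis by simp
qed

text \<open>The image is explicit, a combination of shifted truncated powers, and both relations
  reduce to convolutions term by term. The forward one is the commutativity of \<open>tconv\<close>,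
  the backward one is \<open>tconv_imaginary_inverse\<close>.\<close>

lemma is_J_steps:
  assumes \<alpha>: "Re \<alpha> = 0" and s: "s \<in> steps \<omega>"
  obtains g where "g \<in> L2 (leb \<omega>)" "is_J \<omega> \<alpha> s g" "is_J \<omega> (- \<alpha>) g s"
    "L2_norm (leb \<omega>) g \<le> exp (pi * \<bar>Im \<alpha>\<bar>) * exp \<omega> * L2_norm (leb \<omega>) s"
proof -
  obtain A c where A: "finite A" "A \<subseteq> {0..\<omega>}" "sum c A = 0" and s_eq: "s = (\<lambda>x. \<Sum>a\<in>A. c a * indicator {a<..} x)"
    using s unfolding steps_def by blast
  define g where "g = (\<lambda>x. \<Sum>a\<in>A. c a * tpow \<alpha> (x - a) / Gamma (\<alpha> + 1))"
  have g_eq: "g = (\<lambda>x. \<Sum>a\<in>A. (c a / Gamma (\<alpha> + 1)) * tpow \<alpha> (x - a))"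
    by (simp add: g_def)
  have s_eq': "s = (\<lambda>x. \<Sum>a\<in>A. c a * tpow 0 (x - a))"
    by (simp add: s_eq tpow_zero_shift)
  have nz: "Gamma (\<alpha> + 1) \<noteq> 0" by (rule Gamma_imaginary_nonzero[OF \<alpha>])
  have g: "g \<in> L2 (leb \<omega>)" unfolding g_eq by (intro L2_sum L2_cmult shifted_tpow_L2 \<alpha>)
  have fs: "rlint \<omega> \<beta> s u = (\<Sum>a\<in>A. c a * tconv \<beta> 0 (u - a))" if "Re \<beta> = 0" "u < \<omega>" for \<beta> u
    unfolding s_eq' using that A
    by (subst rlint_sum) (auto intro!: L2_cmult shifted_tpow_L2 sum.cong simp: rlint_cmult rlint_shifted_tpow subset_eq)
  have fg: "rlint \<omega> \<beta> g u = (\<Sum>a\<in>A. (c a / Gamma (\<alpha> + 1)) * tconv \<beta> \<alpha> (u - a))" if "Re \<beta> = 0" "u < \<omega>" for \<beta> u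
    unfolding g_eq using that A \<alpha>
    by (subst rlint_sum) (auto intro!: L2_cmult shifted_tpow_L2 sum.cong simp: rlint_cmult rlint_shifted_tpow subset_eq simp del: times_divide_eq_left)
  have 1: "is_J \<omega> \<alpha> s g"
    unfolding is_J_def using \<alpha> nz by (auto simp: fs fg sum_distrib_left tconv_commute[of \<alpha> 0] intro!: sum.cong)
  have 2: "is_J \<omega> (- \<alpha>) g s"
    unfolding is_J_def using \<alpha> nz by (auto simp: fs fg sum_distrib_left tconv_imaginary_inverse add.commute intro!: sum.cong)
  show ?thesis
    using that[OF g 1 2] steps_J_bound[OF \<alpha> A] unfolding g_def s_eq by simp
qed

text \<open>Step functions at distance less than 2^(-n) from \<open>f\<close> have images that form
  a fast Cauchy sequence, by the bound on step functions. Both \<open>is_J\<close> relations and the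
  norm bound pass to the limit, so inversion is obtained together with existence.\<close>

lemma J_exists:
  assumes \<omega>: "0 < \<omega>" and \<alpha>: "Re \<alpha> = 0" and f: "f \<in> L2 (leb \<omega>)"
  obtains g where "g \<in> L2 (leb \<omega>)" "is_J \<omega> \<alpha> f g" "is_J \<omega> (- \<alpha>) g f"
    "L2_norm (leb \<omega>) g \<le> exp (pi * \<bar>Im \<alpha>\<bar>) * exp \<omega> * L2_norm (leb \<omega>) f"
proof -
  interpret finite_measure "leb \<omega>" by (rule finite_measure_leb)
  define C where "C = exp (pi * \<bar>Im \<alpha>\<bar>) * exp \<omega>"
  have C: "0 < C" by (simp add: C_def)
  have "\<exists>s\<in>steps \<omega>. L2_norm (leb \<omega>) (\<lambda>x. f x - s x) < (1/2)^n" for n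
    by (rule steps_dense[OF \<omega> f]) simp
  then obtain s where s: "\<And>n. s n \<in> steps \<omega>" "\<And>n. L2_norm (leb \<omega>) (\<lambda>x. f x - s n x) < (1/2)^n"
    by metis
  have sL: "s n \<in> L2 (leb \<omega>)" for n by (rule steps_L2[OF s(1)])
  have "\<exists>g. g \<in> L2 (leb \<omega>) \<and> is_J \<omega> \<alpha> (s n) g \<and> is_J \<omega> (- \<alpha>) g (s n) \<and> L2_norm (leb \<omega>) g \<le> C * L2_norm (leb \<omega>) (s n)" for n
    using is_J_steps[OF \<alpha> s(1)[of n]] unfolding C_def by metis
  then obtain g where g: "\<And>n. g n \<in> L2 (leb \<omega>)" "\<And>n. is_J \<omega> \<alpha> (s n) (g n)" "\<And>n. is_J \<omega> (- \<alpha>) (g n) (s n)"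
    "\<And>n. L2_norm (leb \<omega>) (g n) \<le> C * L2_norm (leb \<omega>) (s n)" by metis
  have slim: "L2_tendsto (leb \<omega>) s f sequentially"
    unfolding L2_tendsto_def
  proof (intro conjI f always_eventually allI sL)
    have "(\<lambda>n. (1/2)^n :: real) \<longlonglongrightarrow> 0" by (rule LIMSEQ_power_zero) simp
    then show "(\<lambda>n. L2_norm (leb \<omega>) (\<lambda>x. s n x - f x)) \<longlonglongrightarrow> 0"
      by (rule tendsto_sandwich[OF _ _ tendsto_const, rotated 2])
         (use s(2) L2_norm_minus_commute[of "leb \<omega>" f] in \<open>auto intro!: always_eventually less_imp_le\<close>)
  qed
  have "L2_norm (leb \<omega>) (\<lambda>x. g (Suc n) x - g n x) \<le> (2 * C) * (1/2)^n" for n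
  proof -
    have d: "(\<lambda>x. s (Suc n) x - s n x) \<in> steps \<omega>"
      using steps_add[OF s(1)[of "Suc n"] steps_cmult[OF s(1)[of n], of "-1"]] by simp
    \<comment> \<open>The norm bound is available for some image \<open>h\<close> of the difference,
      not for the difference of the images already chosen; the two coincide almost everywhere
      because both are \<open>J\<close> of the same function.\<close>
    obtain h where h: "h \<in> L2 (leb \<omega>)" "is_J \<omega> \<alpha> (\<lambda>x. s (Suc n) x - s n x) h"
      "L2_norm (leb \<omega>) h \<le> C * L2_norm (leb \<omega>) (\<lambda>x. s (Suc n) x - s n x)"
      using is_J_steps[OF \<alpha> d] unfolding C_def by metis
    have gd: "(\<lambda>x. g (Suc n) x - g n x) \<in> L2 (leb \<omega>)" by (intro L2_diff g)
    have "is_J \<omega> \<alpha> (\<lambda>x. s (Suc n) x - s n x) (\<lambda>x. g (Suc n) x - g n x)"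
      by (rule is_J_diff[OF \<alpha> sL sL g(1) g(1) g(2) g(2)])
    from is_J_imp_J[OF \<alpha> gd this] is_J_imp_J[OF \<alpha> h(1,2)]
    have "AE x in leb \<omega>. g (Suc n) x - g n x = h x" by eventually_elim simp
    then have "L2_norm (leb \<omega>) (\<lambda>x. g (Suc n) x - g n x) = L2_norm (leb \<omega>) h"
      by (intro L2_norm_cong_AE L2_measurable gd h(1))
    also note h(3)
    also have "L2_norm (leb \<omega>) (\<lambda>x. s (Suc n) x - s n x) \<le> 2 * (1/2)^n"
      using L2_norm_triangle3[OF sL f sL, of "Suc n" n] s(2)[of "Suc n"] s(2)[of n]
        L2_norm_minus_commute[of "leb \<omega>" f "s (Suc n)"] L2_norm_nonneg[of "leb \<omega>" "\<lambda>x. s (Suc n) x - f x"]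
      unfolding power_Suc by linarith
    finally show ?thesis using C by (simp add: mult_ac)
  qed
  from L2_complete[OF g(1) this] obtain l where l: "L2_tendsto (leb \<omega>) g l sequentially" by blast
  have lL: "l \<in> L2 (leb \<omega>)" using l by (simp add: L2_tendsto_def)
  have norm_lim: "(\<lambda>n. L2_norm (leb \<omega>) (h n)) \<longlonglongrightarrow> L2_norm (leb \<omega>) k"
    if "L2_tendsto (leb \<omega>) h k sequentially" "\<And>n. h n \<in> L2 (leb \<omega>)" for h k
  proof -
    have k: "k \<in> L2 (leb \<omega>)" using that by (simp add: L2_tendsto_def)
    have "(\<lambda>n. L2_norm (leb \<omega>) (h n) - L2_norm (leb \<omega>) k) \<longlonglongrightarrow> 0"
    proof (rule Lim_null_comparison)
      show "\<forall>\<^sub>F n in sequentially. norm (L2_norm (leb \<omega>) (h n) - L2_norm (leb \<omega>) k) \<le> L2_norm (leb \<omega>) (\<lambda>x. h n x - k x)"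
      proof (intro always_eventually allI)
        fix n
        show "norm (L2_norm (leb \<omega>) (h n) - L2_norm (leb \<omega>) k) \<le> L2_norm (leb \<omega>) (\<lambda>x. h n x - k x)"
          using L2_norm_le_add_diff[OF that(2) k, of n] L2_norm_le_add_diff[OF k that(2), of n]
            L2_norm_minus_commute[of "leb \<omega>" "h n" k] by (simp add: abs_le_iff)
      qed
      show "(\<lambda>n. L2_norm (leb \<omega>) (\<lambda>x. h n x - k x)) \<longlonglongrightarrow> 0" using that(1) by (simp add: L2_tendsto_def)
    qed
    then show ?thesis by (simp add: LIM_zero_iff)
  qed
  have "L2_norm (leb \<omega>) l \<le> C * L2_norm (leb \<omega>) f"
    by (rule LIMSEQ_le[OF norm_lim[OF l g(1)] tendsto_mult_left[OF norm_lim[OF slim sL]]]) (use g(4) in auto)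
  moreover have "is_J \<omega> \<alpha> f l" by (rule is_J_limit[OF \<alpha> slim l g(2)])
  moreover have "is_J \<omega> (- \<alpha>) l f" by (rule is_J_limit[OF _ l slim g(3)]) (use \<alpha> in simp)
  ultimately show ?thesis using that lL by (simp add: C_def)
qed

text \<open>\<open>J \<alpha> f\<close> agrees almost everywhere with the function of
  \<open>J_exists\<close>, and all four properties depend only on the class of that
  function.\<close>

lemma J_properties:
  assumes "0 < \<omega>" "Re \<alpha> = 0" "f \<in> L2 (leb \<omega>)"
  shows "J \<alpha> f \<in> L2 (leb \<omega>)" "is_J \<omega> \<alpha> f (J \<alpha> f)" "is_J \<omega> (- \<alpha>) (J \<alpha> f) f"
    "L2_norm (leb \<omega>) (J \<alpha> f) \<le> exp (pi * \<bar>Im \<alpha>\<bar>) * exp \<omega> * L2_norm (leb \<omega>) f"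
proof -
  obtain g where g: "g \<in> L2 (leb \<omega>)" "is_J \<omega> \<alpha> f g" "is_J \<omega> (- \<alpha>) g f"
    "L2_norm (leb \<omega>) g \<le> exp (pi * \<bar>Im \<alpha>\<bar>) * exp \<omega> * L2_norm (leb \<omega>) f"
    by (rule J_exists[OF assms])
  have eq: "AE x in leb \<omega>. J \<alpha> f x = g x" by (rule is_J_imp_J[OF assms(2) g(1,2)])
  then have eq': "AE x in leb \<omega>. g x = J \<alpha> f x" by eventually_elim simp
  show L: "J \<alpha> f \<in> L2 (leb \<omega>)" by (rule L2_leb_AE[OF g(1) eq'])
  have "rlint \<omega> \<beta> (J \<alpha> f) u = rlint \<omega> \<beta> g u" for \<beta> u by (rule rlint_cong_AE[OF L g(1) eq])
  then show "is_J \<omega> \<alpha> f (J \<alpha> f)" "is_J \<omega> (- \<alpha>) (J \<alpha> f) f"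
    using g(2,3) by (simp_all add: is_J_def)
  have "L2_norm (leb \<omega>) (J \<alpha> f) = L2_norm (leb \<omega>) g"
    by (rule L2_norm_cong_AE[OF L2_measurable[OF L] L2_measurable[OF g(1)] eq])
  then show "L2_norm (leb \<omega>) (J \<alpha> f) \<le> exp (pi * \<bar>Im \<alpha>\<bar>) * exp \<omega> * L2_norm (leb \<omega>) f"
    using g(4) by simp
qed

text \<open>At points without a derivative \<open>J\<close> has an arbitrary value, so linearity is
  not obtained from calculus rules. It comes from the linearity of \<open>is_J\<close> in the pair
  of functions, followed by the uniqueness in \<open>is_J_imp_J\<close>.\<close>

lemma bounded_op_J:
  assumes \<omega>: "0 < \<omega>" and \<alpha>: "Re \<alpha> = 0"
  shows "bounded_op (leb \<omega>) (J \<alpha>)"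
  unfolding bounded_op_def
proof (intro conjI ballI allI impI)
  note P = J_properties[OF \<omega> \<alpha>]
  fix f assume f: "f \<in> L2 (leb \<omega>)"
  show "J \<alpha> f \<in> L2 (leb \<omega>)" by (rule P(1)[OF f])
  fix c
  have "is_J \<omega> \<alpha> (\<lambda>y. c * f y) (\<lambda>x. c * J \<alpha> f x)"
    using P(2)[OF f] by (simp add: is_J_def rlint_cmult)
  then show "AE x in leb \<omega>. J \<alpha> (\<lambda>y. c * f y) x = c * J \<alpha> f x"
    by (rule is_J_imp_J[OF \<alpha> L2_cmult[OF P(1)[OF f]]])
next
  note P = J_properties[OF \<omega> \<alpha>]
  fix f g assume fg: "f \<in> L2 (leb \<omega>)" "g \<in> L2 (leb \<omega>)"
  have "is_J \<omega> \<alpha> (\<lambda>y. f y + g y) (\<lambda>x. J \<alpha> f x + J \<alpha> g x)"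
    using P(2)[OF fg(1)] P(2)[OF fg(2)] P(1)[OF fg(1)] P(1)[OF fg(2)] fg \<alpha>
    by (simp add: is_J_def rlint_add distrib_left)
  then show "AE x in leb \<omega>. J \<alpha> (\<lambda>y. f y + g y) x = J \<alpha> f x + J \<alpha> g x"
    by (rule is_J_imp_J[OF \<alpha> L2_add[OF P(1)[OF fg(1)] P(1)[OF fg(2)]]])
  assume eq: "AE x in leb \<omega>. f x = g x"
  have "is_J \<omega> \<alpha> f (J \<alpha> g)"
    using P(2)[OF fg(2)] rlint_cong_AE[OF fg eq] by (simp add: is_J_def)
  then show "AE x in leb \<omega>. J \<alpha> f x = J \<alpha> g x"
    by (rule is_J_imp_J[OF \<alpha> P(1)[OF fg(2)]])
next
  show "\<exists>K. \<forall>f\<in>L2 (leb \<omega>). L2_norm (leb \<omega>) (J \<alpha> f) \<le> K * L2_norm (leb \<omega>) f"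
    using J_properties(4)[OF \<omega> \<alpha>] by blast
qed

lemma J_inverse:
  assumes "0 < \<omega>" "Re \<alpha> = 0" "f \<in> L2 (leb \<omega>)"
  shows "AE x in leb \<omega>. J (- \<alpha>) (J \<alpha> f) x = f x"
  by (rule is_J_imp_J[OF _ assms(3) J_properties(3)[OF assms]]) (use assms in simp)

section \<open>Conjugation of \<open>J\<^sup>\<alpha>\<close> with modulations\<close>

text \<open>The substitution t = u - w splits the modulation into a factor depending on
  \<open>u\<close> alone and an exponential in w, leaving the truncated Laplace integral at the
  boundary point z = -i\<tau>.\<close>

lemma rlint_modulated:
  assumes "0 \<le> a" "u < \<omega>"
  shows "rlint \<omega> \<alpha> (\<lambda>t. exp (- (\<i> * of_real \<tau>) * of_real t) * indicator {a<..} t) u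
    = exp (- (\<i> * of_real \<tau>) * of_real u) * tint \<alpha> (- (\<i> * of_real \<tau>)) (u - a)"
proof -
  define e where "e = exp (- (\<i> * of_real \<tau>) * complex_of_real u)"
  have "rlint \<omega> \<alpha> (\<lambda>t. exp (- (\<i> * of_real \<tau>) * of_real t) * indicator {a<..} t) u
      = (LINT t|lborel. tpow \<alpha> (u - t) * (exp (- (\<i> * of_real \<tau>) * of_real t) * tpow 0 (t - a)))"
    unfolding rlint_def
    by (subst integral_leb_borel)
       (use assms in \<open>auto simp: indicator_def tpow_zero_shift intro!: Bochner_Integration.integral_cong\<close>)
  also have "\<dots> = (LINT w|lborel. tpow \<alpha> (u - (u + (- 1) * w)) *
      (exp (- (\<i> * of_real \<tau>) * of_real (u + (- 1) * w)) * tpow 0 (u + (- 1) * w - a)))"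
    by (subst lborel_integral_real_affine[where c = "-1" and t = u]) auto
  also have "\<dots> = (LINT w|lborel. e * (indicator {0<..<u - a} w * (tpow \<alpha> w * exp (- (- (\<i> * of_real \<tau>)) * of_real w))))"
  proof (rule Bochner_Integration.integral_cong[OF refl])
    fix w
    have "exp (- (\<i> * of_real \<tau>) * of_real (u + (- 1) * w)) = e * exp (- (- (\<i> * of_real \<tau>)) * of_real w)"
      unfolding e_def exp_add[symmetric] by (simp add: algebra_simps)
    then show "tpow \<alpha> (u - (u + (- 1) * w)) * (exp (- (\<i> * of_real \<tau>) * of_real (u + (- 1) * w)) * tpow 0 (u + (- 1) * w - a))
        = e * (indicator {0<..<u - a} w * (tpow \<alpha> w * exp (- (- (\<i> * of_real \<tau>)) * of_real w)))"
      by (auto simp: tpow_zero indicator_def)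
  qed
  also have "\<dots> = e * tint \<alpha> (- (\<i> * of_real \<tau>)) (u - a)"
    unfolding tint_def by simp
  finally show ?thesis by (simp add: e_def)
qed

text \<open>With z = -i\<tau> the primitive is exp(zu) \<open>tint \<alpha> z (u - a)\<close>, and
  the product rule yields exp(zu) times \<open>tgam\<close>; this is the origin of that combination.
  The formula holds at every point other than the jump, not merely almost everywhere.\<close>

lemma J_modulated:
  assumes \<alpha>: "Re \<alpha> = 0" and a: "0 \<le> a" and x: "0 < x" "x \<noteq> a"
  shows "J \<alpha> (\<lambda>t. exp (- (\<i> * of_real \<tau>) * of_real t) * indicator {a<..} t) x
    = (if a < x then exp (- (\<i> * of_real \<tau>) * of_real x) * tgam \<alpha> (- (\<i> * of_real \<tau>)) (x - a) / Gamma (\<alpha> + 1) else 0)"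
proof -
  define z where "z = - (\<i> * complex_of_real \<tau>)"
  define f where "f t = exp (- (\<i> * of_real \<tau>) * complex_of_real t) * indicator {a<..} t" for t
  define F where "F u = exp (- (\<i> * of_real \<tau>) * complex_of_real u) * tint \<alpha> z (u - a)" for u
  define D where "D = (if a < x then exp (- (\<i> * of_real \<tau>) * complex_of_real x) * tgam \<alpha> z (x - a) else 0)"
  have z: "0 \<le> Re z" by (simp add: z_def)
  \<comment> \<open>The integral up to \<open>u\<close> does not involve \<omega>, so any value
    beyond \<open>u\<close>, here \<open>u + 1\<close>, can take its place.\<close>
  have F_eq: "(LINT t:{0<..<u}|lebesgue. complex_of_real (u - t) powr \<alpha> * f t) = F u" for u
    using rlint_eq_set_integral[of u "u + 1" \<alpha> f] rlint_modulated[OF a, of u "u + 1" \<alpha> \<tau>]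
    by (simp add: F_def f_def[abs_def] z_def)
  have "(F has_vector_derivative D) (at x)"
  proof (cases "a < x")
    case True
    have shift: "((\<lambda>u. u - a) has_vector_derivative 1) (at x)"
      by (auto intro!: derivative_eq_intros)
    have "((tint \<alpha> z \<circ> (\<lambda>u. u - a)) has_vector_derivative 1 *\<^sub>R (tpow \<alpha> (x - a) * exp (- z * of_real (x - a)))) (at x)"
      by (rule vector_diff_chain_at[OF shift tint_has_vector_derivative[OF \<alpha> z]]) (use True in simp)
    then have t: "((\<lambda>u. tint \<alpha> z (u - a)) has_vector_derivative tpow \<alpha> (x - a) * exp (- z * of_real (x - a))) (at x)"
      by (simp add: o_def)
    have "(F has_vector_derivative exp (- (\<i> * of_real \<tau>) * of_real x) * (tpow \<alpha> (x - a) * exp (- z * of_real (x - a)))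
        + (- (\<i> * of_real \<tau>) * exp (- (\<i> * of_real \<tau>) * of_real x)) * tint \<alpha> z (x - a)) (at x)"
      unfolding F_def[abs_def] by (rule has_vector_derivative_mult[OF exp_has_vector_derivative[OF \<alpha>] t])
    then show ?thesis
      by (rule has_vector_derivative_eq_rhs) (use True in \<open>simp add: D_def tgam_def z_def algebra_simps\<close>)
  next
    case False
    have "((\<lambda>u. 0) has_vector_derivative D) (at x)" using False by (simp add: D_def)
    then show ?thesis
    proof (rule has_vector_derivative_transform_within_open[where S = "{..<a}"])
      fix u assume "u \<in> {..<a}"
      then show "0 = F u" by (simp add: F_def tint_def greaterThanLessThan_empty)
    qed (use False x in auto)
  qed
  then show ?thesis
    unfolding J_def f_def[symmetric] F_eq by (simp add: vector_derivative_at D_def z_def)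
qed

text \<open>The source of the phase: -i\<sigma> has principal argument -\<sigma> pi/2, hence
  (-i\<sigma>)^(-\<alpha>) = exp(\<sigma> i\<alpha> pi/2), while the powers of the positive number
  \<open>r\<close> cancel.\<close>

lemma powr_imaginary_axis:
  assumes "0 < r" "\<sigma> = 1 \<or> \<sigma> = (-1::real)"
  shows "complex_of_real r powr \<alpha> * (- (\<i> * of_real (\<sigma> * r))) powr (- \<alpha>) = exp (of_real \<sigma> * \<i> * \<alpha> * of_real pi / 2)"
proof -
  have "(- (\<i> * of_real (\<sigma> * r))) powr (- \<alpha>) = (of_real r * (- (\<i> * of_real \<sigma>))) powr (- \<alpha>)"
    by (simp add: mult_ac)
  also have "\<dots> = of_real r powr (- \<alpha>) * (- (\<i> * of_real \<sigma>)) powr (- \<alpha>)"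
    by (rule powr_times_real_left) (use assms in auto)
  finally have "complex_of_real r powr \<alpha> * (- (\<i> * of_real (\<sigma> * r))) powr (- \<alpha>)
      = (complex_of_real r powr \<alpha> * of_real r powr (- \<alpha>)) * (- (\<i> * of_real \<sigma>)) powr (- \<alpha>)"
    by (simp only: mult.assoc)
  also have "complex_of_real r powr \<alpha> * of_real r powr (- \<alpha>) = 1"
    using assms(1) by (simp flip: powr_add)
  also have "1 * (- (\<i> * of_real \<sigma>)) powr (- \<alpha>) = exp (of_real \<sigma> * \<i> * \<alpha> * of_real pi / 2)"
    using assms(2) by (auto simp: powr_def algebra_simps)
  finally show ?thesis .
qed

text \<open>The sign \<sigma> is the direction of time and \<open>r\<close> is |t|. For x > a the
  asymptotics in \<open>tgam_bound\<close> give an error of order 1/(r (x - a)), not uniform near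
  \<open>a\<close>; the constant from \<open>tgam_bounded\<close> provides the majorant for
  dominated convergence.\<close>

lemma modulated_limit_interval:
  assumes \<omega>: "0 < \<omega>" and \<alpha>: "Re \<alpha> = 0" and a: "0 \<le> a" and \<sigma>: "\<sigma> = 1 \<or> \<sigma> = (-1::real)"
  shows "L2_tendsto (leb \<omega>)
    (\<lambda>r x. complex_of_real r powr \<alpha> * (exp (\<i> * of_real (\<sigma> * r) * of_real x) *
        J \<alpha> (\<lambda>t. exp (- (\<i> * of_real (\<sigma> * r)) * of_real t) * indicator {a<..} t) x))
    (\<lambda>x. exp (of_real \<sigma> * \<i> * \<alpha> * of_real pi / 2) * indicator {a<..} x) at_top"
proof -
  interpret finite_measure "leb \<omega>" by (rule finite_measure_leb)
  define E where "E = exp (of_real \<sigma> * \<i> * \<alpha> * of_real pi / 2)"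
  obtain C where C: "0 \<le> C" "\<And>z y. 0 \<le> Re z \<Longrightarrow> 0 < y \<Longrightarrow> norm (tgam \<alpha> z y) \<le> C"
    using tgam_bounded[OF \<alpha>] by blast
  define G where "G = Gamma (\<alpha> + 1)"
  have G: "G \<noteq> 0" unfolding G_def by (rule Gamma_imaginary_nonzero[OF \<alpha>])
  define f where "f r t = exp (- (\<i> * of_real (\<sigma> * r)) * complex_of_real t) * indicator {a<..} t" for r t :: real
  have fL: "f r \<in> L2 (leb \<omega>)" for r
  proof -
    have "(\<lambda>t. (exp (- (\<i> * of_real (\<sigma> * r)) * complex_of_real t) * indicator {a<..} t) * 1) \<in> L2 (leb \<omega>)"
      by (rule L2_mult_bounded[OF L2_const, where C = 1]) (auto simp: norm_mult norm_exp_eq_Re indicator_def)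
    then show ?thesis unfolding f_def by simp
  qed
  define g where "g r x = complex_of_real r powr \<alpha> * (exp (\<i> * of_real (\<sigma> * r) * of_real x) * J \<alpha> (f r) x)" for r x
  have Jm [measurable]: "J \<alpha> (f r) \<in> borel_measurable (leb \<omega>)" for r
    by (rule L2_measurable[OF J_properties(1)[OF \<omega> \<alpha> fL]])
  have g_eq: "g r x = (if a < x then complex_of_real r powr \<alpha> * tgam \<alpha> (- (\<i> * of_real (\<sigma> * r))) (x - a) / G else 0)"
    if "0 < x" "x \<noteq> a" for r x
  proof -
    have "exp (\<i> * of_real (\<sigma> * r) * of_real x) * exp (- (\<i> * of_real (\<sigma> * r)) * of_real x) = 1"
      unfolding exp_add[symmetric] by simp
    then have "exp (\<i> * of_real (\<sigma> * r) * of_real x) * (exp (- (\<i> * of_real (\<sigma> * r)) * of_real x) * k) = k" for k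
      by (simp only: mult.assoc[symmetric] mult_1_left)
    then show ?thesis
      unfolding g_def f_def J_modulated[OF \<alpha> a that] G_def
      by (simp only: if_distrib[of "(*) _"] mult_zero_right times_divide_eq_right)
  qed
  have AEx: "AE x in leb \<omega>. 0 < x \<and> x \<noteq> a"
  proof -
    have "AE x in lebesgue. x \<noteq> a" by (intro AE_completion AE_lborel_singleton)
    then have "AE x in lebesgue. x \<in> {0<..<\<omega>} \<longrightarrow> 0 < x \<and> x \<noteq> a" by eventually_elim auto
    then show ?thesis by (subst AE_restrict_space_iff) auto
  qed
  have "L2_tendsto (leb \<omega>) g (\<lambda>x. E * indicator {a<..} x) at_top"
  proof (rule L2_tendsto_dominated_at_top[where c = 0 and w = "\<lambda>x. of_real (C / norm G)"])
    show "g r \<in> borel_measurable (leb \<omega>)" for r unfolding g_def[abs_def] by measurable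
    show "AE x in leb \<omega>. ((\<lambda>r. g r x) \<longlongrightarrow> E * indicator {a<..} x) at_top"
      using AEx
    proof eventually_elim
      case (elim x)
      show ?case
      proof (cases "a < x")
        case True
        define y where "y = x - a"
        have y: "0 < y" using True by (simp add: y_def)
        define K where "K = 2 * norm \<alpha> + norm \<alpha> * norm (\<alpha> - 1)"
        have "((\<lambda>r. g r x - E) \<longlongrightarrow> 0) at_top"
        proof (rule Lim_null_comparison)
          have "((\<lambda>r. (K / y / norm G) / r) \<longlongrightarrow> 0) at_top"
            by (intro tendsto_divide_0[OF tendsto_const] filterlim_at_top_imp_at_infinity filterlim_ident)
          then show "((\<lambda>r. (K / y / norm G) / r) \<longlongrightarrow> 0) at_top" .
          show "\<forall>\<^sub>F r in at_top. norm (g r x - E) \<le> (K / y / norm G) / r"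
            using eventually_gt_at_top[of 0]
          proof eventually_elim
            case (elim r)
            define z where "z = - (\<i> * complex_of_real (\<sigma> * r))"
            have z: "0 \<le> Re z" "z \<noteq> 0" "norm z = r" using elim \<sigma> by (auto simp: z_def norm_mult)
            have "g r x - E = complex_of_real r powr \<alpha> * (tgam \<alpha> z y - G * z powr (- \<alpha>)) / G"
              unfolding E_def powr_imaginary_axis[OF elim \<sigma>, of \<alpha>, symmetric]
              using True G \<open>0 < x \<and> x \<noteq> a\<close> by (simp add: g_eq z_def y_def field_simps)
            moreover have "norm (complex_of_real r powr \<alpha>) = 1"
              using elim \<alpha> by (simp add: norm_powr_real_powr)
            ultimately have "norm (g r x - E) = norm (tgam \<alpha> z y - G * z powr (- \<alpha>)) / norm G"
              by (simp add: norm_mult norm_divide)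
            also have "\<dots> \<le> (K / (norm z * y)) / norm G"
              using tgam_bound[OF \<alpha> z(1,2) y] by (intro divide_right_mono) (auto simp: K_def G_def)
            finally show ?case using z by (simp add: field_simps)
          qed
        qed
        then show ?thesis using True by (simp add: LIM_zero_iff)
      next
        case False
        then show ?thesis using elim by (simp add: g_eq)
      qed
    qed
    show "AE x in leb \<omega>. norm (g r x) \<le> norm (complex_of_real (C / norm G))" if "0 < r" for r
      using AEx
    proof eventually_elim
      case (elim x)
      have "norm (complex_of_real r powr \<alpha>) = 1"
        using that \<alpha> by (simp add: norm_powr_real_powr)
      then show ?case
        using elim C(1) C(2)[of "- (\<i> * of_real (\<sigma> * r))" "x - a"]
        by (auto simp: g_eq norm_mult norm_divide intro: divide_right_mono)
    qed
  qed (auto intro: L2_const)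
  then show ?thesis unfolding g_def f_def E_def .
qed

lemma L2_tendsto_const: "f \<in> L2 M \<Longrightarrow> L2_tendsto M (\<lambda>t. f) f F"
  by (simp add: L2_tendsto_def)

lemma L2_tendsto_sum:
  assumes "\<And>i. i \<in> I \<Longrightarrow> L2_tendsto M (f i) (l i) F"
  shows "L2_tendsto M (\<lambda>t x. \<Sum>i\<in>I. f i t x) (\<lambda>x. \<Sum>i\<in>I. l i x) F"
  using assms
  by (induction I rule: infinite_finite_induct) (auto intro: L2_tendsto_add L2_tendsto_const L2_zero)

text \<open>\<open>modJ \<alpha> c t\<close> is \<open>c exp(itQ) J\<^sup>\<alpha> exp(-itQ)\<close>.\<close>

definition modJ :: "complex \<Rightarrow> complex \<Rightarrow> real \<Rightarrow> real fop" where
  "modJ \<alpha> c t f = (\<lambda>x. c * (exp (\<i> * of_real t * of_real x) *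
     J \<alpha> (\<lambda>s. exp (- (\<i> * of_real t) * of_real s) * f s) x))"

lemma bounded_op_unimodular:
  assumes "\<And>x. norm (m x) = 1" and "m \<in> borel_measurable M"
  shows "bounded_op M (\<lambda>f x. m x * f x)"
  by (rule bounded_op_multiplication[where C = 1]) (use assms in auto)

lemma norm_iexp_mult: "norm (exp (\<i> * of_real t * of_real x)) = 1"
  "norm (exp (- (\<i> * of_real t) * of_real x)) = 1"
  by (simp_all add: norm_exp_eq_Re)

lemma bounded_op_const: "bounded_op M (\<lambda>f x. c * f x)" for c :: complex
  by (rule bounded_op_multiplication[where C = "norm c"]) auto

lemma modJ_comp:
  "modJ \<alpha> c t = (\<lambda>f x. c * f x) \<circ> ((\<lambda>f x. exp (\<i> * of_real t * of_real x) * f x) \<circ>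
     (J \<alpha> \<circ> (\<lambda>f x. exp (- (\<i> * of_real t) * of_real x) * f x)))"
  by (simp add: modJ_def fun_eq_iff)

lemma bounded_op_modJ:
  assumes "0 < \<omega>" "Re \<alpha> = 0"
  shows "bounded_op (leb \<omega>) (modJ \<alpha> c t)"
  unfolding modJ_comp
  by (intro bounded_op_comp bounded_op_const bounded_op_unimodular bounded_op_J assms norm_iexp_mult) auto

text \<open>Modulations are isometries, so the bound of J^\<alpha> carries over with a constant
  independent of \<open>t\<close>, as the density argument requires.\<close>

lemma modJ_norm_le:
  assumes "0 < \<omega>" "Re \<alpha> = 0" "norm c = 1" "f \<in> L2 (leb \<omega>)"
  shows "L2_norm (leb \<omega>) (modJ \<alpha> c t f) \<le> exp (pi * \<bar>Im \<alpha>\<bar>) * exp \<omega> * L2_norm (leb \<omega>) f"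
proof -
  define h where "h = (\<lambda>s. exp (- (\<i> * of_real t) * complex_of_real s) * f s)"
  have h: "h \<in> L2 (leb \<omega>)"
    unfolding h_def by (rule L2_mult_bounded[OF assms(4), where C = 1]) (auto simp: norm_exp_eq_Re)
  have "L2_norm (leb \<omega>) (modJ \<alpha> c t f) = L2_norm (leb \<omega>) (J \<alpha> h)"
    unfolding modJ_def h_def[symmetric] L2_norm_cmult assms(3) by (simp add: L2_norm_unimodular norm_exp_eq_Re)
  also have "\<dots> \<le> exp (pi * \<bar>Im \<alpha>\<bar>) * exp \<omega> * L2_norm (leb \<omega>) h"
    by (rule J_properties(4)[OF assms(1,2) h])
  also have "L2_norm (leb \<omega>) h = L2_norm (leb \<omega>) f"
    unfolding h_def by (rule L2_norm_unimodular) (simp add: norm_exp_eq_Re)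
  finally show ?thesis .
qed

lemma modJ_limit_steps:
  assumes \<omega>: "0 < \<omega>" and \<alpha>: "Re \<alpha> = 0" and \<sigma>: "\<sigma> = 1 \<or> \<sigma> = (-1::real)" and s: "s \<in> steps \<omega>"
  shows "L2_tendsto (leb \<omega>) (\<lambda>r. modJ \<alpha> (complex_of_real r powr \<alpha>) (\<sigma> * r) s)
    (\<lambda>x. exp (of_real \<sigma> * \<i> * \<alpha> * of_real pi / 2) * s x) at_top"
proof -
  define E where "E = exp (of_real \<sigma> * \<i> * \<alpha> * of_real pi / 2)"
  obtain A c where A: "finite A" "A \<subseteq> {0..\<omega>}" and s_eq: "s = (\<lambda>x. \<Sum>a\<in>A. c a * indicator {a<..} x)"
    using s unfolding steps_def by blast
  interpret finite_measure "leb \<omega>" by (rule finite_measure_leb)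
  define h where "h a = (\<lambda>x. indicator {a<..} x :: complex)" for a :: real
  have h: "h a \<in> L2 (leb \<omega>)" for a
  proof -
    have "(\<lambda>x. indicator {a<..} x * 1) \<in> L2 (leb \<omega>)"
      by (rule L2_mult_bounded[OF L2_const, where C = 1]) (auto simp: indicator_def)
    then show ?thesis unfolding h_def by simp
  qed
  let ?T = "\<lambda>r. modJ \<alpha> (complex_of_real r powr \<alpha>) (\<sigma> * r)"
  have T: "bounded_op (leb \<omega>) (?T r)" for r by (rule bounded_op_modJ[OF \<omega> \<alpha>])
  have "L2_tendsto (leb \<omega>) (\<lambda>r x. \<Sum>a\<in>A. c a * ?T r (h a) x) (\<lambda>x. \<Sum>a\<in>A. c a * (E * h a x)) at_top"
  proof (intro L2_tendsto_sum L2_tendsto_cmult)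
    fix a assume "a \<in> A"
    then have "0 \<le> a" using A by auto
    from modulated_limit_interval[OF \<omega> \<alpha> this \<sigma>]
    show "L2_tendsto (leb \<omega>) (\<lambda>r x. ?T r (h a) x) (\<lambda>x. E * h a x) at_top"
      unfolding modJ_def h_def E_def .
  qed
  then show ?thesis
  proof (rule L2_tendsto_cong_AE)
    have sh: "s = (\<lambda>x. \<Sum>a\<in>A. c a * h a x)" by (simp only: s_eq h_def)
    have "AE x in leb \<omega>. ?T r s x = (\<Sum>a\<in>A. c a * ?T r (h a) x)" for r
    proof -
      have "AE x in leb \<omega>. ?T r (\<lambda>x. \<Sum>a\<in>A. c a * h a x) x = (\<Sum>a\<in>A. ?T r (\<lambda>x. c a * h a x) x)"
        by (rule bounded_op_sum[OF T L2_cmult[OF h]])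
      moreover have "AE x in leb \<omega>. \<forall>a\<in>A. ?T r (\<lambda>x. c a * h a x) x = c a * ?T r (h a) x"
        using A(1) by (subst AE_finite_all) (auto intro: bounded_op_cmult[OF T h])
      ultimately show ?thesis
        unfolding sh by eventually_elim simp
    qed
    then show "\<forall>\<^sub>F r in at_top. ?T r s \<in> L2 (leb \<omega>) \<and> (AE x in leb \<omega>. ?T r s x = (\<Sum>a\<in>A. c a * ?T r (h a) x))"
      using bounded_op_L2[OF T steps_L2[OF s]] by simp
    show "(\<lambda>x. exp (of_real \<sigma> * \<i> * \<alpha> * of_real pi / 2) * s x) \<in> L2 (leb \<omega>)"
      by (rule L2_cmult[OF steps_L2[OF s]])
    show "AE x in leb \<omega>. exp (of_real \<sigma> * \<i> * \<alpha> * of_real pi / 2) * s x = (\<Sum>a\<in>A. c a * (E * h a x))"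
      unfolding sh E_def by (simp only: sum_distrib_left mult.left_commute) simp
  qed
qed

lemma modJ_limit:
  assumes \<omega>: "0 < \<omega>" and \<alpha>: "Re \<alpha> = 0" and \<sigma>: "\<sigma> = 1 \<or> \<sigma> = (-1::real)" and f: "f \<in> L2 (leb \<omega>)"
  shows "L2_tendsto (leb \<omega>) (\<lambda>r. modJ \<alpha> (complex_of_real r powr \<alpha>) (\<sigma> * r) f)
    (\<lambda>x. exp (of_real \<sigma> * \<i> * \<alpha> * of_real pi / 2) * f x) at_top"
proof -
  \<comment> \<open>The density argument asks for a norm bound at every real \<open>r\<close>, but
    the power need not have modulus one for r \<le> 0; it is replaced by 1 there, away from the
    limit.\<close>
  define c where "c r = (if 0 < r then complex_of_real r powr \<alpha> else 1)" for r :: real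
  have c: "norm (c r) = 1" for r using \<alpha> by (simp add: c_def norm_powr_real_powr)
  have ev: "\<forall>\<^sub>F r in at_top. c r = complex_of_real r powr \<alpha>"
    using eventually_gt_at_top[of 0] by eventually_elim (simp add: c_def)
  define E where "E = exp (of_real \<sigma> * \<i> * \<alpha> * of_real pi / 2)"
  have B1: "bounded_op (leb \<omega>) (modJ \<alpha> b t)" for b t by (rule bounded_op_modJ[OF \<omega> \<alpha>])
  have steps: "L2_tendsto (leb \<omega>) (\<lambda>r. modJ \<alpha> (c r) (\<sigma> * r) s) (\<lambda>x. E * s x) at_top" if s: "s \<in> steps \<omega>" for s
  proof (rule L2_tendsto_cong_AE[OF modJ_limit_steps[OF \<omega> \<alpha> \<sigma> s]])
    show "\<forall>\<^sub>F r in at_top. modJ \<alpha> (c r) (\<sigma> * r) s \<in> L2 (leb \<omega>) \<and>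
      (AE x in leb \<omega>. modJ \<alpha> (c r) (\<sigma> * r) s x = modJ \<alpha> (complex_of_real r powr \<alpha>) (\<sigma> * r) s x)"
      using ev by eventually_elim (use bounded_op_L2[OF B1 steps_L2[OF s]] in simp)
  qed (auto simp: E_def intro: L2_cmult steps_L2[OF s])
  have "L2_tendsto (leb \<omega>) (\<lambda>r. modJ \<alpha> (c r) (\<sigma> * r) f) (\<lambda>x. E * f x) at_top"
  proof (rule L2_tendsto_uniformly_bounded[where T = "\<lambda>r. modJ \<alpha> (c r) (\<sigma> * r)" and W = "\<lambda>f x. E * f x", OF B1 bounded_op_const _ f])
    show "L2_norm (leb \<omega>) (modJ \<alpha> (c r) (\<sigma> * r) g) \<le> exp (pi * \<bar>Im \<alpha>\<bar>) * exp \<omega> * L2_norm (leb \<omega>) g"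
      if "g \<in> L2 (leb \<omega>)" for r g by (rule modJ_norm_le[OF \<omega> \<alpha> c that])
    show "\<exists>s\<in>L2 (leb \<omega>). L2_norm (leb \<omega>) (\<lambda>x. f x - s x) < e \<and>
        L2_tendsto (leb \<omega>) (\<lambda>r. modJ \<alpha> (c r) (\<sigma> * r) s) (\<lambda>x. E * s x) at_top" if "0 < e" for e
      using steps_dense[OF \<omega> f that] steps steps_L2 by blast
  qed
  then show ?thesis
  proof (rule L2_tendsto_cong_AE)
    show "\<forall>\<^sub>F r in at_top. modJ \<alpha> (complex_of_real r powr \<alpha>) (\<sigma> * r) f \<in> L2 (leb \<omega>) \<and>
      (AE x in leb \<omega>. modJ \<alpha> (complex_of_real r powr \<alpha>) (\<sigma> * r) f x = modJ \<alpha> (c r) (\<sigma> * r) f x)"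
      using ev by eventually_elim (use bounded_op_L2[OF B1 f] in simp)
  qed (auto simp: E_def intro: L2_cmult f)
qed

section \<open>Exponentials, spectral measure and wave operators\<close>

lemma id_measurable_leb [measurable]: "(\<lambda>x. x) \<in> borel_measurable (leb \<omega>)"
  by (rule borel_imp_leb_measurable) simp

lemma AE_leb_bounded: "AE x in leb \<omega>. norm (c * complex_of_real x) \<le> norm c * \<omega>"
proof -
  have "AE x in leb \<omega>. x \<in> space (leb \<omega>)" by (rule AE_space)
  then show ?thesis by eventually_elim (auto simp: norm_mult intro!: mult_left_mono)
qed

lemma bounded_op_Q: "bounded_op (leb \<omega>) Q"
  unfolding Q_def[abs_def] using AE_leb_bounded[of 1 \<omega>]
  by (intro bounded_op_multiplication[where C = \<omega>]) auto

lemma op_scale_Q_power: "(op_scale c Q ^^ n) f x = (c * of_real x) ^ n * f x"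
  by (induction n arbitrary: x) (simp_all add: op_scale_def Q_def)

text \<open>All partial sums are dominated by exp(|c| \<omega>) |g| because the variable is bounded
  by \<omega>. The general \<open>g\<close> serves both exponentials: that of \<open>Q\<close> with
  g = f and that of \<open>B\<close> with g = J^\<alpha> f.\<close>

lemma exp_partial_sums_tendsto:
  assumes g: "g \<in> L2 (leb \<omega>)"
  shows "L2_tendsto (leb \<omega>) (\<lambda>N x. \<Sum>n<N. (c * of_real x) ^ n / fact n * g x) (\<lambda>x. exp (c * of_real x) * g x) sequentially"
proof -
  note [measurable] = L2_measurable[OF g]
  show ?thesis
  proof (rule L2_tendsto_dominated_seq[where w = "\<lambda>x. complex_of_real (exp (norm c * \<omega>)) * g x"])
    show "AE x in leb \<omega>. (\<lambda>N. \<Sum>n<N. (c * of_real x) ^ n / fact n * g x) \<longlonglongrightarrow> exp (c * of_real x) * g x"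
    proof (rule AE_I2)
      fix x
      have "(\<lambda>n. (c * of_real x) ^ n /\<^sub>R fact n) sums exp (c * of_real x)" by (rule exp_converges)
      then have "(\<lambda>n. (c * of_real x) ^ n / fact n * g x) sums (exp (c * of_real x) * g x)"
        by (intro sums_mult2) (simp add: scaleR_conv_of_real divide_inverse mult.commute)
      then show "(\<lambda>N. \<Sum>n<N. (c * of_real x) ^ n / fact n * g x) \<longlonglongrightarrow> exp (c * of_real x) * g x"
        by (simp add: sums_def)
    qed
    show "AE x in leb \<omega>. norm (\<Sum>n<N. (c * of_real x) ^ n / fact n * g x) \<le> norm (complex_of_real (exp (norm c * \<omega>)) * g x)" for N
      using AE_leb_bounded[of c \<omega>]
    proof eventually_elim
      case (elim x)
      define r where "r = norm (c * complex_of_real x)"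
      have "norm (\<Sum>n<N. (c * of_real x) ^ n / fact n) \<le> (\<Sum>n<N. r ^ n /\<^sub>R fact n)"
        by (rule sum_norm_le) (simp add: r_def norm_mult norm_power norm_inverse divide_inverse mult.commute)
      also have "\<dots> \<le> (\<Sum>n. r ^ n /\<^sub>R fact n)"
        using summable_exp_generic[of r] by (intro sum_le_suminf) (auto simp: r_def)
      also have "\<dots> = exp r" by (simp add: exp_def)
      also have "\<dots> \<le> exp (norm c * \<omega>)" using elim by (simp add: r_def)
      finally have "norm (\<Sum>n<N. (c * of_real x) ^ n / fact n) * norm (g x) \<le> exp (norm c * \<omega>) * norm (g x)"
        by (rule mult_right_mono) simp
      then show ?case by (simp only: norm_mult norm_of_real abs_exp_cancel flip: sum_distrib_right)
    qed
  qed (auto intro: L2_cmult g)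
qed

lemma op_exp_Q:
  assumes "f \<in> L2 (leb \<omega>)"
  shows "op_exp (leb \<omega>) (op_scale c Q) f \<in> L2 (leb \<omega>)"
    "AE x in leb \<omega>. op_exp (leb \<omega>) (op_scale c Q) f x = exp (c * of_real x) * f x"
proof -
  have "L2_tendsto (leb \<omega>) (\<lambda>N x. \<Sum>n<N. (op_scale c Q ^^ n) f x / fact n) (\<lambda>x. exp (c * of_real x) * f x) sequentially"
    using exp_partial_sums_tendsto[OF assms, of c] by (simp add: op_scale_Q_power)
  from op_exp_eq[OF this]
  show "op_exp (leb \<omega>) (op_scale c Q) f \<in> L2 (leb \<omega>)"
    "AE x in leb \<omega>. op_exp (leb \<omega>) (op_scale c Q) f x = exp (c * of_real x) * f x" .
qed

lemma mult_power_L2: "g \<in> L2 (leb \<omega>) \<Longrightarrow> (\<lambda>x. (c * of_real x) ^ n * g x) \<in> L2 (leb \<omega>)"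
proof (induction n)
  case (Suc n)
  have "(\<lambda>x. (c * complex_of_real x) * ((c * of_real x) ^ n * g x)) \<in> L2 (leb \<omega>)"
    by (rule L2_mult_bounded[OF Suc.IH[OF Suc.prems] _ AE_leb_bounded]) measurable
  then show ?case by (simp add: mult.assoc)
qed simp

lemma bounded_op_B:
  assumes "0 < \<omega>" "Re \<alpha> = 0"
  shows "bounded_op (leb \<omega>) (B \<alpha>)"
  unfolding B_def
  by (intro bounded_op_comp bounded_op_J bounded_op_Q assms(1)) (use assms in auto)

text \<open>Adjacent factors J^\<alpha> J^(-\<alpha>) cancel in a power of J^(-\<alpha>) Q
  J^\<alpha>. Each cancellation holds only almost everywhere, and membership in L^2 is carried
  through the induction so that such equalities can be passed under the next operator.\<close>

lemma op_scale_B_power: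
  assumes \<omega>: "0 < \<omega>" and \<alpha>: "Re \<alpha> = 0" and f: "f \<in> L2 (leb \<omega>)"
  shows "(op_scale c (B \<alpha>) ^^ n) f \<in> L2 (leb \<omega>) \<and>
    (AE x in leb \<omega>. (op_scale c (B \<alpha>) ^^ n) f x = J (- \<alpha>) (\<lambda>x. (c * of_real x) ^ n * J \<alpha> f x) x)"
proof (induction n)
  case 0
  show ?case using f J_inverse[OF \<omega> \<alpha> f] by (auto elim: eventually_mono)
next
  case (Suc n)
  define A where "A = (op_scale c (B \<alpha>) ^^ n) f"
  define h where "h n = (\<lambda>x. (c * of_real x) ^ n * J \<alpha> f x)" for n
  have \<alpha>': "Re (- \<alpha>) = 0" using \<alpha> by simp
  note J1 = bounded_op_J[OF \<omega> \<alpha>] and J2 = bounded_op_J[OF \<omega> \<alpha>']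
  have A: "A \<in> L2 (leb \<omega>)" "AE x in leb \<omega>. A x = J (- \<alpha>) (h n) x"
    using Suc by (simp_all add: A_def h_def)
  have h: "h n \<in> L2 (leb \<omega>)" for n
    unfolding h_def by (rule mult_power_L2[OF bounded_op_L2[OF J1 f]])
  have "AE x in leb \<omega>. J \<alpha> A x = J \<alpha> (J (- \<alpha>) (h n)) x"
    by (rule bounded_op_cong[OF J1 A(1) bounded_op_L2[OF J2 h] A(2)])
  moreover have "AE x in leb \<omega>. J \<alpha> (J (- \<alpha>) (h n)) x = h n x"
    using J_inverse[OF \<omega> \<alpha>' h] by simp
  ultimately have "AE x in leb \<omega>. Q (J \<alpha> A) x = of_real x * h n x"
    by eventually_elim (simp add: Q_def)
  moreover have xh: "(\<lambda>x. of_real x * h n x) \<in> L2 (leb \<omega>)"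
    using mult_power_L2[OF h[of n], of 1 1] by simp
  moreover have "Q (J \<alpha> A) \<in> L2 (leb \<omega>)"
    by (rule bounded_op_L2[OF bounded_op_Q bounded_op_L2[OF J1 A(1)]])
  ultimately have "AE x in leb \<omega>. J (- \<alpha>) (Q (J \<alpha> A)) x = J (- \<alpha>) (\<lambda>x. of_real x * h n x) x"
    by (intro bounded_op_cong[OF J2])
  moreover have "AE x in leb \<omega>. J (- \<alpha>) (\<lambda>x. c * (of_real x * h n x)) x = c * J (- \<alpha>) (\<lambda>x. of_real x * h n x) x"
    by (rule bounded_op_cmult[OF J2 xh])
  moreover have "(\<lambda>x. c * (of_real x * h n x)) = (\<lambda>x. (c * of_real x) ^ Suc n * J \<alpha> f x)"
    by (simp add: h_def mult_ac)
  ultimately have "AE x in leb \<omega>. op_scale c (B \<alpha>) A x = J (- \<alpha>) (\<lambda>x. (c * of_real x) ^ Suc n * J \<alpha> f x) x"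
    by (simp add: op_scale_def B_def) (auto elim: eventually_elim2)
  moreover have "op_scale c (B \<alpha>) A \<in> L2 (leb \<omega>)"
    unfolding op_scale_def by (rule L2_cmult[OF bounded_op_L2[OF bounded_op_B[OF \<omega> \<alpha>] A(1)]])
  ultimately show ?case by (simp add: A_def)
qed

text \<open>The powers of \<open>B\<close> are conjugates of multiplications, so the continuous
  operator J^(-\<alpha>) can be taken out of the exponential series. Countably many exceptional null
  sets are united along the way.\<close>

lemma op_exp_B:
  assumes \<omega>: "0 < \<omega>" and \<alpha>: "Re \<alpha> = 0" and f: "f \<in> L2 (leb \<omega>)"
  shows "op_exp (leb \<omega>) (op_scale c (B \<alpha>)) f \<in> L2 (leb \<omega>)"
    "AE x in leb \<omega>. op_exp (leb \<omega>) (op_scale c (B \<alpha>)) f x = J (- \<alpha>) (\<lambda>x. exp (c * of_real x) * J \<alpha> f x) x"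
proof -
  have \<alpha>': "Re (- \<alpha>) = 0" using \<alpha> by simp
  note J1 = bounded_op_J[OF \<omega> \<alpha>] and J2 = bounded_op_J[OF \<omega> \<alpha>']
  define h where "h n = (\<lambda>x. (c * of_real x) ^ n * J \<alpha> f x)" for n
  have h: "h n \<in> L2 (leb \<omega>)" for n
    unfolding h_def by (rule mult_power_L2[OF bounded_op_L2[OF J1 f]])
  have hs: "(\<lambda>x. (1 / fact n) * h n x) \<in> L2 (leb \<omega>)" for n by (rule L2_cmult[OF h])
  have lim: "L2_tendsto (leb \<omega>) (\<lambda>N. J (- \<alpha>) (\<lambda>x. \<Sum>n<N. (1 / fact n) * h n x)) (J (- \<alpha>) (\<lambda>x. exp (c * of_real x) * J \<alpha> f x)) sequentially"
    using exp_partial_sums_tendsto[OF bounded_op_L2[OF J1 f], of c]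
    by (intro bounded_op_tendsto[OF J2]) (simp add: h_def)
  have ae: "AE x in leb \<omega>. (\<Sum>n<N. (op_scale c (B \<alpha>) ^^ n) f x / fact n) = J (- \<alpha>) (\<lambda>x. \<Sum>n<N. (1 / fact n) * h n x) x" for N
  proof -
    have "AE x in leb \<omega>. J (- \<alpha>) (\<lambda>x. \<Sum>n<N. (1 / fact n) * h n x) x = (\<Sum>n<N. J (- \<alpha>) (\<lambda>x. (1 / fact n) * h n x) x)"
      by (rule bounded_op_sum[OF J2 hs])
    moreover have "AE x in leb \<omega>. \<forall>n. J (- \<alpha>) (\<lambda>x. (1 / fact n) * h n x) x = (1 / fact n) * J (- \<alpha>) (h n) x"
      unfolding AE_all_countable using bounded_op_cmult[OF J2 h] by blast
    moreover have "AE x in leb \<omega>. \<forall>n. (op_scale c (B \<alpha>) ^^ n) f x = J (- \<alpha>) (h n) x"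
      unfolding AE_all_countable h_def using op_scale_B_power[OF \<omega> \<alpha> f] by blast
    ultimately show ?thesis by eventually_elim simp
  qed
  have "(op_scale c (B \<alpha>) ^^ n) f \<in> L2 (leb \<omega>)" for n using op_scale_B_power[OF \<omega> \<alpha> f] by blast
  then have "(\<lambda>x. \<Sum>n<N. (1 / fact n) * (op_scale c (B \<alpha>) ^^ n) f x) \<in> L2 (leb \<omega>)" for N
    by (intro L2_sum L2_cmult)
  then have L: "(\<lambda>x. \<Sum>n<N. (op_scale c (B \<alpha>) ^^ n) f x / fact n) \<in> L2 (leb \<omega>)" for N by simp
  have "L2_tendsto (leb \<omega>) (\<lambda>N x. \<Sum>n<N. (op_scale c (B \<alpha>) ^^ n) f x / fact n) (J (- \<alpha>) (\<lambda>x. exp (c * of_real x) * J \<alpha> f x)) sequentially"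
    by (rule L2_tendsto_cong_AE[OF lim]) (use lim L ae in \<open>auto simp: L2_tendsto_def\<close>)
  from op_exp_eq[OF this]
  show "op_exp (leb \<omega>) (op_scale c (B \<alpha>)) f \<in> L2 (leb \<omega>)"
    "AE x in leb \<omega>. op_exp (leb \<omega>) (op_scale c (B \<alpha>)) f x = J (- \<alpha>) (\<lambda>x. exp (c * of_real x) * J \<alpha> f x) x" .
qed

section \<open>The spectral measure of \<open>Q\<close>\<close>

lemma selfadjoint_multiplication:
  fixes m :: "'a \<Rightarrow> real"
  assumes [measurable]: "m \<in> borel_measurable M" and "AE x in M. norm (complex_of_real (m x)) \<le> C"
  shows "selfadjoint_op M (\<lambda>f x. complex_of_real (m x) * f x)"
  unfolding selfadjoint_op_def
proof (intro conjI ballI)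
  show "bounded_op M (\<lambda>f x. complex_of_real (m x) * f x)"
    by (rule bounded_op_multiplication[OF _ assms(2)]) measurable
qed (simp add: L2_inner_def mult_ac)

definition Q_spectral :: "real set \<Rightarrow> real fop" where
  "Q_spectral S f = (\<lambda>x. indicator S x * f x)"

lemma selfadjoint_Q_spectral:
  assumes "S \<in> sets borel"
  shows "selfadjoint_op (leb \<omega>) (Q_spectral S)"
proof -
  have "indicator S \<in> borel_measurable (leb \<omega>)"
    using assms by (intro borel_imp_leb_measurable borel_measurable_indicator)
  then have "selfadjoint_op (leb \<omega>) (\<lambda>f x. complex_of_real (indicator S x) * f x)"
    by (rule selfadjoint_multiplication[where C = 1]) (auto simp: indicator_def)
  then show ?thesis by (simp add: Q_spectral_def[abs_def] of_real_indicator)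
qed

lemma spectral_measure_Q: "spectral_measure (leb \<omega>) Q_spectral"
  unfolding spectral_measure_def
proof (intro conjI ballI allI impI)
  show "selfadjoint_op (leb \<omega>) (Q_spectral S)" if "S \<in> sets borel" for S
    by (rule selfadjoint_Q_spectral[OF that])
  show "op_eq (leb \<omega>) (Q_spectral S \<circ> Q_spectral S') (Q_spectral (S \<inter> S'))" for S S'
    by (auto simp: op_eq_def Q_spectral_def indicator_def)
  show "op_eq (leb \<omega>) (Q_spectral UNIV) id"
    by (auto simp: op_eq_def Q_spectral_def)
  fix D :: "nat \<Rightarrow> real set" assume D: "range D \<subseteq> sets borel \<and> disjoint_family D"
  have Dm: "D n \<in> sets borel" for n using D by auto
  have Um: "(\<Union>n. D n) \<in> sets borel" using Dm by auto
  have sum_eq: "(\<Sum>n<N. indicator (D n) x) = (indicator (\<Union>n<N. D n) x :: complex)" for N x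
    by (rule indicator_UN_disjoint[symmetric]) (use D in \<open>auto simp: disjoint_family_on_def\<close>)
  show "strong_limit (leb \<omega>) (\<lambda>N f x. \<Sum>n<N. Q_spectral (D n) f x) (Q_spectral (\<Union>n. D n)) sequentially"
    unfolding strong_limit_def
  proof
    fix f assume f: "f \<in> L2 (leb \<omega>)"
    have op: "Q_spectral S f \<in> borel_measurable (leb \<omega>)" if "S \<in> sets borel" for S
      using bounded_op_L2[OF _ f] selfadjoint_Q_spectral[OF that, of \<omega>] L2_measurable
      unfolding selfadjoint_op_def by blast
    show "L2_tendsto (leb \<omega>) (\<lambda>N x. \<Sum>n<N. Q_spectral (D n) f x) (Q_spectral (\<Union>n. D n) f) sequentially"
    proof (rule L2_tendsto_dominated_seq[OF op[OF Um] _ f])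
      show "(\<lambda>x. \<Sum>n<N. Q_spectral (D n) f x) \<in> borel_measurable (leb \<omega>)" for N
        using op[OF Dm] by (intro borel_measurable_sum)
      show "AE x in leb \<omega>. (\<lambda>N. \<Sum>n<N. Q_spectral (D n) f x) \<longlonglongrightarrow> Q_spectral (\<Union>n. D n) f x"
      proof (rule AE_I2)
        fix x
        have "(\<lambda>i. indicator (D i) x :: real) sums indicator (\<Union>i. D i) x"
          by (rule indicator_sums) (use D in \<open>auto simp: disjoint_family_on_def\<close>)
        then have "(\<lambda>i. complex_of_real (indicator (D i) x) * f x) sums (complex_of_real (indicator (\<Union>i. D i) x) * f x)"
          by (intro sums_mult2 sums_of_real)
        then show "(\<lambda>N. \<Sum>n<N. Q_spectral (D n) f x) \<longlonglongrightarrow> Q_spectral (\<Union>n. D n) f x"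
          by (simp add: sums_def Q_spectral_def of_real_indicator)
      qed
      show "AE x in leb \<omega>. norm (\<Sum>n<N. Q_spectral (D n) f x) \<le> norm (f x)" for N
      proof (rule AE_I2)
        fix x
        have "(\<Sum>n<N. Q_spectral (D n) f x) = indicator (\<Union>n<N. D n) x * f x"
          unfolding Q_spectral_def by (simp only: sum_distrib_right[symmetric] sum_eq)
        then show "norm (\<Sum>n<N. Q_spectral (D n) f x) \<le> norm (f x)"
          by (simp only: norm_mult) (simp add: indicator_def)
      qed
    qed
  qed
qed

text \<open>\<open>scalar_measure\<close> is built by \<open>measure_of\<close> from a bare set
  function and has the expected values only if that function is a measure. Here it is recognised as
  the Borel image of the density |f|^2, after which integrals and null sets can be computed.\<close>

lemma scalar_measure_Q:
  assumes f: "f \<in> L2 (leb \<omega>)"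
  shows "scalar_measure (leb \<omega>) Q_spectral f = distr (density (leb \<omega>) (\<lambda>x. ennreal ((norm (f x))\<^sup>2))) borel (\<lambda>x. x)"
    (is "_ = ?D")
proof -
  note [measurable] = L2_measurable[OF f]
  have eq: "ennreal (Re (L2_inner (leb \<omega>) (Q_spectral S f) f)) = emeasure ?D S" if S: "S \<in> sets borel" for S
  proof -
    have Sm [measurable]: "(\<lambda>x. indicator S x :: real) \<in> borel_measurable (leb \<omega>)"
      using S by (intro borel_imp_leb_measurable borel_measurable_indicator)
    have int: "integrable (leb \<omega>) (\<lambda>x. indicator S x * (norm (f x))\<^sup>2 :: real)"
    proof (rule Bochner_Integration.integrable_bound[OF L2_integrable[OF f]])
      show "(\<lambda>x. indicator S x * (norm (f x))\<^sup>2 :: real) \<in> borel_measurable (leb \<omega>)" by measurable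
      show "AE x in leb \<omega>. norm (indicator S x * (norm (f x))\<^sup>2 :: real) \<le> norm ((norm (f x))\<^sup>2)"
        by (intro AE_I2) (auto simp: indicator_def)
    qed
    have "L2_inner (leb \<omega>) (Q_spectral S f) f = (LINT x|leb \<omega>. complex_of_real (indicator S x * (norm (f x))\<^sup>2))"
      unfolding L2_inner_def Q_spectral_def
      by (rule Bochner_Integration.integral_cong[OF refl]) (simp only: of_real_mult complex_norm_square of_real_indicator mult.assoc)
    also have "\<dots> = complex_of_real (LINT x|leb \<omega>. indicator S x * (norm (f x))\<^sup>2)"
      by (rule integral_complex_of_real)
    finally have "ennreal (Re (L2_inner (leb \<omega>) (Q_spectral S f) f)) = ennreal (LINT x|leb \<omega>. indicator S x * (norm (f x))\<^sup>2)"
      by simp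
    also have "\<dots> = (\<integral>\<^sup>+x. ennreal (indicator S x * (norm (f x))\<^sup>2) \<partial>leb \<omega>)"
      by (rule nn_integral_eq_integral[symmetric, OF int]) simp
    also have "\<dots> = (\<integral>\<^sup>+x. ennreal ((norm (f x))\<^sup>2) * indicator (S \<inter> space (leb \<omega>)) x \<partial>leb \<omega>)"
      by (rule nn_integral_cong) (auto simp: indicator_def)
    also have "\<dots> = emeasure ?D S"
      using S by (subst emeasure_distr) (auto simp: emeasure_density intro: measurable_sets[OF id_measurable_leb, simplified])
    finally show ?thesis .
  qed
  have "scalar_measure (leb \<omega>) Q_spectral f = measure_of UNIV (sets borel) (emeasure ?D)"
    unfolding scalar_measure_def
    by (rule measure_of_eq) (use eq sets.sigma_sets_eq[of "borel :: real measure"] in auto)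
  also have "\<dots> = ?D" using measure_of_of_measure[of ?D] by simp
  finally show ?thesis .
qed

lemma spectral_measure_of_Q: "spectral_measure_of (leb \<omega>) Q Q_spectral"
  unfolding spectral_measure_of_def
proof (intro conjI ballI spectral_measure_Q)
  fix f assume f: "f \<in> L2 (leb \<omega>)"
  note [measurable] = L2_measurable[OF f]
  have "integrable (leb \<omega>) (\<lambda>x. (norm (f x))\<^sup>2 * x\<^sup>2)"
  proof -
    have "(\<lambda>x. (1 * complex_of_real x) ^ 1 * f x) \<in> L2 (leb \<omega>)" by (rule mult_power_L2[OF f])
    from L2_integrable[OF this] show ?thesis by (simp add: norm_mult power_mult_distrib mult.commute)
  qed
  then show "integrable (scalar_measure (leb \<omega>) Q_spectral f) (\<lambda>s. s\<^sup>2)"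
    unfolding scalar_measure_Q[OF f] by (subst integrable_distr_eq) (auto simp: integrable_density)
  have "L2_inner (leb \<omega>) (Q f) f = (LINT x|leb \<omega>. complex_of_real ((norm (f x))\<^sup>2 * x))"
    unfolding L2_inner_def Q_def
    by (rule Bochner_Integration.integral_cong[OF refl]) (simp only: of_real_mult complex_norm_square mult_ac)
  also have "\<dots> = complex_of_real (LINT x|leb \<omega>. (norm (f x))\<^sup>2 * x)" by (rule integral_complex_of_real)
  also have "(LINT x|leb \<omega>. (norm (f x))\<^sup>2 * x) = (LINT s|scalar_measure (leb \<omega>) Q_spectral f. s)"
    unfolding scalar_measure_Q[OF f] by (subst integral_distr) (auto simp: integral_density)
  finally show "L2_inner (leb \<omega>) (Q f) f = complex_of_real (LINT s|scalar_measure (leb \<omega>) Q_spectral f. s)" .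
qed

lemma ac_spectrum_Q: "ac_spectrum (leb \<omega>) Q"
  unfolding ac_spectrum_def
proof (intro exI[of _ Q_spectral] conjI ballI spectral_measure_of_Q)
  fix f assume f: "f \<in> L2 (leb \<omega>)"
  note [measurable] = L2_measurable[OF f]
  show "absolutely_continuous lborel (scalar_measure (leb \<omega>) Q_spectral f)"
    unfolding absolutely_continuous_def scalar_measure_Q[OF f]
  proof
    fix N assume N: "N \<in> null_sets (lborel :: real measure)"
    then have Nb [measurable]: "N \<in> sets borel" by auto
    have "AE x in lebesgue. x \<notin> N" using N by (intro AE_completion AE_not_in)
    then have "AE x in leb \<omega>. x \<notin> N" by (subst AE_restrict_space_iff) (auto elim: eventually_mono)
    then have ae: "AE x in leb \<omega>. ennreal ((norm (f x))\<^sup>2) * indicator (N \<inter> space (leb \<omega>)) x = 0"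
      by eventually_elim simp
    have "emeasure (distr (density (leb \<omega>) (\<lambda>x. ennreal ((norm (f x))\<^sup>2))) borel (\<lambda>x. x)) N
        = (\<integral>\<^sup>+x. ennreal ((norm (f x))\<^sup>2) * indicator (N \<inter> space (leb \<omega>)) x \<partial>leb \<omega>)"
      by (subst emeasure_distr) (auto simp: emeasure_density intro: measurable_sets[OF id_measurable_leb, simplified])
    also have "\<dots> = (\<integral>\<^sup>+x. 0 \<partial>leb \<omega>)" by (rule nn_integral_cong_AE[OF ae])
    finally show "N \<in> null_sets (distr (density (leb \<omega>) (\<lambda>x. ennreal ((norm (f x))\<^sup>2))) borel (\<lambda>x. x))"
      by (intro null_setsI) auto
  qed
qed

lemma selfadjoint_Q: "selfadjoint_op (leb \<omega>) Q"
proof -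
  have "AE x in leb \<omega>. norm (complex_of_real x) \<le> \<omega>" using AE_leb_bounded[of 1 \<omega>] by simp
  from selfadjoint_multiplication[OF id_measurable_leb this] show ?thesis by (simp add: Q_def[abs_def])
qed

section \<open>The scalar factor and the wave operators\<close>

definition phase :: "complex \<Rightarrow> real \<Rightarrow> complex" where
  "phase \<alpha> t = (if t = 0 then 1 else complex_of_real \<bar>t\<bar> powr \<alpha>)"

lemma W0_eq: "W0 \<alpha> t f = (\<lambda>x. phase \<alpha> t * f x)"
  by (simp add: W0_def phase_def op_scale_def)

lemma norm_phase: "Re \<alpha> = 0 \<Longrightarrow> norm (phase \<alpha> t) = 1"
  by (simp add: phase_def norm_powr_real_powr)

lemma unitary_W0:
  assumes "Re \<alpha> = 0"
  shows "unitary_op M (W0 \<alpha> t)"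
  unfolding unitary_op_def
proof (intro conjI ballI)
  show "bounded_op M (W0 \<alpha> t)" using bounded_op_const[of M "phase \<alpha> t"] by (simp add: W0_eq[abs_def])
  fix f g :: "real \<Rightarrow> complex"
  have u: "phase \<alpha> t * cnj (phase \<alpha> t) = 1"
    using norm_phase[OF assms, of t] by (simp flip: complex_norm_square)
  have "(phase \<alpha> t * f x) * cnj (phase \<alpha> t * g x) = (phase \<alpha> t * cnj (phase \<alpha> t)) * (f x * cnj (g x))" for x
    by (simp add: mult_ac)
  then have "(phase \<alpha> t * f x) * cnj (phase \<alpha> t * g x) = f x * cnj (g x)" for x
    by (simp only: u mult_1_left)
  then show "L2_inner M (W0 \<alpha> t f) (W0 \<alpha> t g) = L2_inner M f g"
    unfolding L2_inner_def W0_eq by (simp only:)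
next
  fix g assume g: "g \<in> L2 M"
  have "phase \<alpha> t \<noteq> 0" using norm_phase[OF assms, of t] by auto
  then show "\<exists>f\<in>L2 M. AE x in M. W0 \<alpha> t f x = g x"
    by (intro bexI[of _ "\<lambda>x. (1 / phase \<alpha> t) * g x"] L2_cmult g) (auto simp: W0_eq)
qed

text \<open>|t|^\<alpha> varies slowly: the ratio is exp(\<alpha> ln |t/(t+\<tau>)|), and
  t/(t+\<tau>) = 1 - \<tau>/(t+\<tau>) tends to 1. Stated for any filter tending to infinity in
  modulus, it covers both time directions.\<close>

lemma phase_ratio_tendsto:
  assumes F: "filterlim (\<lambda>t. t) at_infinity F"
  shows "((\<lambda>t. phase \<alpha> t / phase \<alpha> (t + \<tau>)) \<longlongrightarrow> 1) F"
proof -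
  have "filterlim (\<lambda>t. \<tau> + t) at_infinity F"
    by (rule tendsto_add_filterlim_at_infinity[OF tendsto_const F])
  then have inf: "filterlim (\<lambda>t. t + \<tau>) at_infinity F" by (simp add: add.commute)
  have "((\<lambda>t. ln \<bar>1 - \<tau> / (t + \<tau>)\<bar>) \<longlongrightarrow> ln \<bar>1 - 0\<bar>) F"
    by (intro tendsto_ln tendsto_rabs tendsto_diff tendsto_const tendsto_divide_0[OF tendsto_const inf]) simp
  then have "((\<lambda>t. exp (\<alpha> * of_real (ln \<bar>1 - \<tau> / (t + \<tau>)\<bar>))) \<longlongrightarrow> exp (\<alpha> * of_real (ln \<bar>1 - 0\<bar>))) F"
    by (intro tendsto_exp tendsto_mult tendsto_const tendsto_of_real)
  then have lim: "((\<lambda>t. exp (\<alpha> * of_real (ln \<bar>1 - \<tau> / (t + \<tau>)\<bar>))) \<longlongrightarrow> 1) F" by simp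
  \<comment> \<open>This keeps both \<open>t\<close> and \<open>t + \<tau>\<close> away from 0,
    where \<open>phase\<close> has its exceptional value.\<close>
  have ev: "\<forall>\<^sub>F t in F. norm t \<ge> \<bar>\<tau>\<bar> + 1"
    using F by (subst (asm) filterlim_at_infinity[of 0]) auto
  have eq: "\<forall>\<^sub>F t in F. exp (\<alpha> * of_real (ln \<bar>1 - \<tau> / (t + \<tau>)\<bar>)) = phase \<alpha> t / phase \<alpha> (t + \<tau>)"
    using ev
  proof eventually_elim
    case (elim t)
    then have nz: "t \<noteq> 0" "t + \<tau> \<noteq> 0" by auto
    have "1 - \<tau> / (t + \<tau>) = t / (t + \<tau>)" using nz by (simp add: field_simps)
    then have "ln \<bar>1 - \<tau> / (t + \<tau>)\<bar> = ln \<bar>t\<bar> - ln \<bar>t + \<tau>\<bar>" using nz by (simp add: abs_divide ln_div)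
    then show ?case
      using nz by (simp add: phase_def powr_def Ln_of_real right_diff_distrib exp_diff)
  qed
  show ?thesis by (rule Lim_transform_eventually[OF lim eq])
qed

text \<open>\<open>op_inv\<close> picks an arbitrary preimage, but as the phases are nonzero every
  preimage equals the quotient of the phases times \<open>f\<close> almost everywhere. The norm of
  the error is then |c - 1| times that of \<open>f\<close>.\<close>

lemma W0_slowly_varying:
  assumes \<alpha>: "Re \<alpha> = 0" and F: "filterlim (\<lambda>t. t) at_infinity F"
  shows "strong_limit M (\<lambda>t. op_inv M (W0 \<alpha> (t + \<tau>)) \<circ> W0 \<alpha> t) id F"
  unfolding strong_limit_def
proof
  fix f assume f: "f \<in> L2 M"
  define c where "c t = phase \<alpha> t / phase \<alpha> (t + \<tau>)" for t
  have nz: "phase \<alpha> t \<noteq> 0" for t using norm_phase[OF \<alpha>, of t] by auto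
  have inv: "op_inv M (W0 \<alpha> (t + \<tau>)) (W0 \<alpha> t f) \<in> L2 M \<and>
      (AE x in M. op_inv M (W0 \<alpha> (t + \<tau>)) (W0 \<alpha> t f) x = c t * f x)" for t
  proof -
    have "(\<lambda>x. c t * f x) \<in> L2 M \<and> (AE x in M. W0 \<alpha> (t + \<tau>) (\<lambda>x. c t * f x) x = W0 \<alpha> t f x)"
    proof
      show "(\<lambda>x. c t * f x) \<in> L2 M" by (rule L2_cmult[OF f])
      show "AE x in M. W0 \<alpha> (t + \<tau>) (\<lambda>x. c t * f x) x = W0 \<alpha> t f x"
        using nz by (simp add: W0_eq c_def)
    qed
    then have "op_inv M (W0 \<alpha> (t + \<tau>)) (W0 \<alpha> t f) \<in> L2 M \<and>
        (AE x in M. W0 \<alpha> (t + \<tau>) (op_inv M (W0 \<alpha> (t + \<tau>)) (W0 \<alpha> t f)) x = W0 \<alpha> t f x)"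
      unfolding op_inv_def
      by (rule someI[where P = "\<lambda>g. g \<in> L2 M \<and> (AE x in M. W0 \<alpha> (t + \<tau>) g x = W0 \<alpha> t f x)"])
    then show ?thesis
      using nz by (auto simp: W0_eq c_def field_simps elim!: eventually_mono)
  qed
  have "((\<lambda>t. norm (c t - 1) * L2_norm M f) \<longlongrightarrow> norm (1 - 1 :: complex) * L2_norm M f) F"
    unfolding c_def by (intro tendsto_intros phase_ratio_tendsto F)
  moreover have "L2_norm M (\<lambda>x. c t * f x - f x) = norm (c t - 1) * L2_norm M f" for t
    using L2_norm_cmult[of M "c t - 1" f] by (simp add: left_diff_distrib)
  ultimately have "L2_tendsto M (\<lambda>t x. c t * f x) f F"
    using f by (simp add: L2_tendsto_def L2_cmult)
  then show "L2_tendsto M (\<lambda>t. (op_inv M (W0 \<alpha> (t + \<tau>)) \<circ> W0 \<alpha> t) f) (id f) F"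
    by (rule L2_tendsto_cong_AE) (use f inv in auto)
qed

text \<open>The product of the three operators equals J^(-\<alpha>) \<open>modJ\<close> almost
  everywhere, J^(-\<alpha>) being the outer factor of exp(itB). Being bounded, it preserves the
  limit of \<open>modJ\<close> and commutes with the scalar phase.\<close>

lemma wave_operator_limit:
  assumes \<omega>: "0 < \<omega>" and \<alpha>: "Re \<alpha> = 0" and \<sigma>: "\<sigma> = 1 \<or> \<sigma> = (-1::real)" and f: "f \<in> L2 (leb \<omega>)"
  shows "L2_tendsto (leb \<omega>)
    (\<lambda>r. op_exp (leb \<omega>) (op_scale (\<i> * of_real (\<sigma> * r)) (B \<alpha>))
          (op_exp (leb \<omega>) (op_scale (- \<i> * of_real (\<sigma> * r)) Q) (W0 \<alpha> (\<sigma> * r) f)))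
    (\<lambda>x. exp (of_real \<sigma> * \<i> * \<alpha> * of_real pi / 2) * J (- \<alpha>) f x) at_top"
proof -
  define E where "E = exp (of_real \<sigma> * \<i> * \<alpha> * of_real pi / 2)"
  have \<alpha>': "Re (- \<alpha>) = 0" using \<alpha> by simp
  note J1 = bounded_op_J[OF \<omega> \<alpha>] and J2 = bounded_op_J[OF \<omega> \<alpha>']
  have V: "bounded_op (leb \<omega>) (modJ \<alpha> c t)" for c t by (rule bounded_op_modJ[OF \<omega> \<alpha>])
  have lim: "L2_tendsto (leb \<omega>) (\<lambda>r. J (- \<alpha>) (modJ \<alpha> (complex_of_real r powr \<alpha>) (\<sigma> * r) f)) (J (- \<alpha>) (\<lambda>x. E * f x)) at_top"
    unfolding E_def by (rule bounded_op_tendsto[OF J2 modJ_limit[OF \<omega> \<alpha> \<sigma> f]])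
  show ?thesis
  proof (rule L2_tendsto_cong_AE[OF lim])
    show "(\<lambda>x. exp (of_real \<sigma> * \<i> * \<alpha> * of_real pi / 2) * J (- \<alpha>) f x) \<in> L2 (leb \<omega>)"
      by (rule L2_cmult[OF bounded_op_L2[OF J2 f]])
    show "AE x in leb \<omega>. exp (of_real \<sigma> * \<i> * \<alpha> * of_real pi / 2) * J (- \<alpha>) f x = J (- \<alpha>) (\<lambda>x. E * f x) x"
      using bounded_op_cmult[OF J2 f, of E] by (auto simp: E_def elim: eventually_mono)
    show "\<forall>\<^sub>F r in at_top. op_exp (leb \<omega>) (op_scale (\<i> * of_real (\<sigma> * r)) (B \<alpha>))
          (op_exp (leb \<omega>) (op_scale (- \<i> * of_real (\<sigma> * r)) Q) (W0 \<alpha> (\<sigma> * r) f)) \<in> L2 (leb \<omega>) \<and>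
        (AE x in leb \<omega>. op_exp (leb \<omega>) (op_scale (\<i> * of_real (\<sigma> * r)) (B \<alpha>))
          (op_exp (leb \<omega>) (op_scale (- \<i> * of_real (\<sigma> * r)) Q) (W0 \<alpha> (\<sigma> * r) f)) x
          = J (- \<alpha>) (modJ \<alpha> (complex_of_real r powr \<alpha>) (\<sigma> * r) f) x)"
      using eventually_gt_at_top[of 0]
    proof eventually_elim
      case (elim r)
      define t where "t = \<sigma> * r"
      define c where "c = complex_of_real r powr \<alpha>"
      define h where "h = op_exp (leb \<omega>) (op_scale (- \<i> * of_real t) Q) (W0 \<alpha> t f)"
      define k where "k = (\<lambda>s. exp (- (\<i> * of_real t) * complex_of_real s) * f s)"
      have W: "W0 \<alpha> t f = (\<lambda>x. c * f x)"
        using elim \<sigma> by (auto simp: W0_eq phase_def t_def c_def)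
      have Wf: "W0 \<alpha> t f \<in> L2 (leb \<omega>)" unfolding W by (rule L2_cmult[OF f])
      have h: "h \<in> L2 (leb \<omega>)" unfolding h_def by (rule op_exp_Q(1)[OF Wf])
      have k: "k \<in> L2 (leb \<omega>)"
        unfolding k_def by (rule L2_mult_bounded[OF f, where C = 1]) (auto simp: norm_exp_eq_Re)
      have "AE x in leb \<omega>. h x = c * k x"
        using op_exp_Q(2)[OF Wf, of "- \<i> * of_real t"] unfolding h_def W k_def
        by eventually_elim (simp add: mult_ac)
      from bounded_op_cong[OF J1 h L2_cmult[OF k] this] bounded_op_cmult[OF J1 k, of c]
      have "AE x in leb \<omega>. exp (\<i> * of_real t * of_real x) * J \<alpha> h x = modJ \<alpha> c t f x"
        by eventually_elim (simp add: modJ_def k_def mult_ac)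
      moreover have "(\<lambda>x. exp (\<i> * of_real t * of_real x) * J \<alpha> h x) \<in> L2 (leb \<omega>)"
        by (rule L2_mult_bounded[OF bounded_op_L2[OF J1 h], where C = 1]) (auto simp: norm_exp_eq_Re)
      ultimately have "AE x in leb \<omega>. J (- \<alpha>) (\<lambda>x. exp (\<i> * of_real t * of_real x) * J \<alpha> h x) x = J (- \<alpha>) (modJ \<alpha> c t f) x"
        by (intro bounded_op_cong[OF J2] bounded_op_L2[OF V f])
      with op_exp_B(2)[OF \<omega> \<alpha> h, of "\<i> * of_real t"]
      have "AE x in leb \<omega>. op_exp (leb \<omega>) (op_scale (\<i> * of_real t) (B \<alpha>)) h x = J (- \<alpha>) (modJ \<alpha> c t f) x"
        by eventually_elim simp
      then show ?case
        using op_exp_B(1)[OF \<omega> \<alpha> h] by (simp add: h_def t_def c_def)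
    qed
  qed
qed

theorem proposition4p7:
  fixes \<omega> :: real and \<alpha> :: complex
  assumes "0 < \<omega>" and "Re \<alpha> = 0" and "\<alpha> \<noteq> 0"
  shows "generalized_wave_operators (lebesgue_on {0<..<\<omega>}) (B \<alpha>) Q (W0 \<alpha>)
           (op_scale (exp (\<i> * \<alpha> * of_real pi / 2)) (J (- \<alpha>)))
           (op_scale (exp (- \<i> * \<alpha> * of_real pi / 2)) (J (- \<alpha>)))"
proof -
  define T where "T = (\<lambda>t. op_exp (leb \<omega>) (op_scale (\<i> * of_real t) (B \<alpha>)) \<circ>
                    op_exp (leb \<omega>) (op_scale (- \<i> * of_real t) Q) \<circ> W0 \<alpha> t)"
  have Wp: "strong_limit (leb \<omega>) T (op_scale (exp (\<i> * \<alpha> * of_real pi / 2)) (J (- \<alpha>))) at_top"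
    unfolding strong_limit_def T_def op_scale_def[of "exp _"]
    using wave_operator_limit[OF assms(1,2), of 1] by simp
  have Wm: "strong_limit (leb \<omega>) T (op_scale (exp (- \<i> * \<alpha> * of_real pi / 2)) (J (- \<alpha>))) at_bot"
    unfolding strong_limit_def
  proof
    fix f assume f: "f \<in> L2 (leb \<omega>)"
    \<comment> \<open>Time reversal: \<sigma> = -1 describes t = -r with \<open>r\<close> tending to
      infinity, and substituting r = -t turns this into a limit at minus infinity.\<close>
    have "L2_tendsto (leb \<omega>) (\<lambda>r. T (- r) f) (op_scale (exp (- \<i> * \<alpha> * of_real pi / 2)) (J (- \<alpha>)) f) at_top"
      unfolding T_def op_scale_def[of "exp _"]
      using wave_operator_limit[OF assms(1,2) _ f, of "-1"] by simp
    from L2_tendsto_compose[OF this filterlim_uminus_at_top_at_bot]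
    show "L2_tendsto (leb \<omega>) (\<lambda>t. T t f) (op_scale (exp (- \<i> * \<alpha> * of_real pi / 2)) (J (- \<alpha>)) f) at_bot"
      by simp
  qed
  have inf: "filterlim (\<lambda>t::real. t) at_infinity at_top" "filterlim (\<lambda>t::real. t) at_infinity at_bot"
    by (simp_all add: filterlim_ident at_top_le_at_infinity at_bot_le_at_infinity filterlim_def)
  show ?thesis
    unfolding generalized_wave_operators_def Let_def T_def[symmetric]
  proof (intro conjI allI bounded_op_B selfadjoint_Q ac_spectrum_Q unitary_W0 Wp Wm assms W0_slowly_varying inf)
    show "op_eq (leb \<omega>) (W0 \<alpha> t \<circ> Q) (Q \<circ> W0 \<alpha> t)" for t
      by (simp add: op_eq_def W0_eq Q_def mult_ac)
    show "op_eq (leb \<omega>) (W0 \<alpha> t \<circ> W0 \<alpha> (t + \<tau>)) (W0 \<alpha> (t + \<tau>) \<circ> W0 \<alpha> t)" for t \<tau>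
      by (simp add: op_eq_def W0_eq mult_ac)
  qed
qed

end
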